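(* Let $T$ be $\mathrm{NTP}_2$ with the independence property. Then there are a small model $M$ and a global type $p\in S(\mathfrak{C})$ which does not fork over $M$ but is not invariant over $M$ (i.e. there is an automorphism $\sigma$ of $\mathfrak{C}$ fixing $M$ pointwise with $\sigma(p)\neq p$).
   Context: Monster model $\mathfrak{C}$ of a complete theory $T$. $T$ has the independence property if some formula $\phi(x,y)$ has tuples $a_i$ ($i<\omega$), $b_u$ ($u\subseteq\omega$) with $\phi(a_i,b_u)\iff i\in u$. Dividing: $\varphi(x,a)$ divides over $M$ if for some $k$ there is $\langle a_i\rangle_{i<\omega}$ with $\mathrm{tp}(a_i/M)=\mathrm{tp}(a/M)$ and $\{\varphi(x,a_i)\}$ $k$-inconsistent; forking: implying a finite disjunction of formulas dividing over $M$; a type does not fork over $M$ if no formula in it forks over $M$. $\mathrm{NTP}_2$: there are no $\phi(x,y)$, $k<\omega$, array $\langle a_i^j\rangle_{i,j<\omega}$ with every row $\{\phi(x,a^j_i):i<\omega\}$ $k$-inconsistent and every vertical path $\{\phi(x,a^j_{f(j)}):j<\omega\}$ ($f:\omega\to\omega$) consistent. *)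

theory Defs
  imports Main
begin

unbundle cardinal_syntax

section \<open>First-order languages, structures and satisfaction\<close>

record ('f, 'r) lang =
  funs :: "'f set"
  rels :: "'r set"
  fun_arity :: "'f \<Rightarrow> nat"
  rel_arity :: "'r \<Rightarrow> nat"

datatype 'f trm = Var nat | App 'f "'f trm list"

datatype ('f, 'r) fm =
    Eq "'f trm" "'f trm"
  | Rel 'r "'f trm list"
  | Neg "('f, 'r) fm"
  | Conj "('f, 'r) fm" "('f, 'r) fm"
  | Exi nat "('f, 'r) fm"

fun wf_trm :: "('f, 'r) lang \<Rightarrow> 'f trm \<Rightarrow> bool" where
  "wf_trm L (Var i) \<longleftrightarrow> True"
| "wf_trm L (App f ts) \<longleftrightarrow> f \<in> funs L \<and> length ts = fun_arity L f \<and> (\<forall>t\<in>set ts. wf_trm L t)"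

fun wf_fm :: "('f, 'r) lang \<Rightarrow> ('f, 'r) fm \<Rightarrow> bool" where
  "wf_fm L (Eq s t) \<longleftrightarrow> wf_trm L s \<and> wf_trm L t"
| "wf_fm L (Rel r ts) \<longleftrightarrow> r \<in> rels L \<and> length ts = rel_arity L r \<and> (\<forall>t\<in>set ts. wf_trm L t)"
| "wf_fm L (Neg \<phi>) \<longleftrightarrow> wf_fm L \<phi>"
| "wf_fm L (Conj \<phi> \<psi>) \<longleftrightarrow> wf_fm L \<phi> \<and> wf_fm L \<psi>"
| "wf_fm L (Exi i \<phi>) \<longleftrightarrow> wf_fm L \<phi>"

fun fv_trm :: "'f trm \<Rightarrow> nat set" where
  "fv_trm (Var i) = {i}"
| "fv_trm (App f ts) = (\<Union>t\<in>set ts. fv_trm t)"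

fun fv :: "('f, 'r) fm \<Rightarrow> nat set" where
  "fv (Eq s t) = fv_trm s \<union> fv_trm t"
| "fv (Rel r ts) = (\<Union>t\<in>set ts. fv_trm t)"
| "fv (Neg \<phi>) = fv \<phi>"
| "fv (Conj \<phi> \<psi>) = fv \<phi> \<union> fv \<psi>"
| "fv (Exi i \<phi>) = fv \<phi> - {i}"

definition formula :: "('f, 'r) lang \<Rightarrow> nat \<Rightarrow> ('f, 'r) fm \<Rightarrow> bool" where
  "formula L n \<phi> \<longleftrightarrow> wf_fm L \<phi> \<and> fv \<phi> \<subseteq> {..<n}"

abbreviation sentence :: "('f, 'r) lang \<Rightarrow> ('f, 'r) fm \<Rightarrow> bool" where
  "sentence L \<equiv> formula L 0"

record ('f, 'r, 'a) struct =
  univ :: "'a set"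
  fun_interp :: "'f \<Rightarrow> 'a list \<Rightarrow> 'a"
  rel_interp :: "'r \<Rightarrow> 'a list \<Rightarrow> bool"

definition tuples :: "'a set \<Rightarrow> nat \<Rightarrow> 'a list set" where
  "tuples A n = {a. length a = n \<and> set a \<subseteq> A}"

definition is_struct :: "('f, 'r) lang \<Rightarrow> ('f, 'r, 'a) struct \<Rightarrow> bool" where
  "is_struct L S \<longleftrightarrow> univ S \<noteq> {} \<and>
     (\<forall>f\<in>funs L. \<forall>a\<in>tuples (univ S) (fun_arity L f). fun_interp S f a \<in> univ S)"

fun val :: "('f, 'r, 'a) struct \<Rightarrow> (nat \<Rightarrow> 'a) \<Rightarrow> 'f trm \<Rightarrow> 'a" where
  "val S e (Var i) = e i"
| "val S e (App f ts) = fun_interp S f (map (val S e) ts)"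

fun sat :: "('f, 'r, 'a) struct \<Rightarrow> (nat \<Rightarrow> 'a) \<Rightarrow> ('f, 'r) fm \<Rightarrow> bool" where
  "sat S e (Eq s t) \<longleftrightarrow> val S e s = val S e t"
| "sat S e (Rel r ts) \<longleftrightarrow> rel_interp S r (map (val S e) ts)"
| "sat S e (Neg \<phi>) \<longleftrightarrow> \<not> sat S e \<phi>"
| "sat S e (Conj \<phi> \<psi>) \<longleftrightarrow> sat S e \<phi> \<and> sat S e \<psi>"
| "sat S e (Exi i \<phi>) \<longleftrightarrow> (\<exists>a\<in>univ S. sat S (e(i := a)) \<phi>)"

text \<open>The tuple \<open>a\<close> is substituted for the variables \<open>0, \<dots>, length a - 1\<close>; this is only used for
  \<open>formula L (length a) \<phi>\<close>, so that the unspecified values \<open>a ! i\<close> with \<open>i \<ge> length a\<close> play no role.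
  A formula \<open>\<phi>(x,y)\<close> with \<open>x\<close> of length \<open>n\<close> and \<open>y\<close> of length \<open>m\<close> is a \<open>\<phi>\<close> with
  \<open>formula L (n + m) \<phi>\<close>, and its truth value at \<open>(a,b)\<close> is \<open>holds S \<phi> (a @ b)\<close>.\<close>

definition holds :: "('f, 'r, 'a) struct \<Rightarrow> ('f, 'r) fm \<Rightarrow> 'a list \<Rightarrow> bool" where
  "holds S \<phi> a \<longleftrightarrow> sat S (\<lambda>i. a ! i) \<phi>"

definition models :: "('f, 'r) lang \<Rightarrow> ('f, 'r, 'a) struct \<Rightarrow> ('f, 'r) fm set \<Rightarrow> bool" where
  "models L S T \<longleftrightarrow> is_struct L S \<and> (\<forall>\<phi>\<in>T. holds S \<phi> [])"

text \<open>Consequence is tested on the models living on subsets of the type \<open>'a\<close>, as one cannot quantify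
  over types. By Loewenheim-Skolem this is no restriction when \<open>'a\<close> has at least as many
  elements as there are formulas; in any case completeness in the usual sense implies this one.\<close>

definition complete_theory :: "'a itself \<Rightarrow> ('f, 'r) lang \<Rightarrow> ('f, 'r) fm set \<Rightarrow> bool" where
  "complete_theory _ L T \<longleftrightarrow>
     (\<forall>\<phi>\<in>T. sentence L \<phi>) \<and>
     (\<exists>S :: ('f, 'r, 'a) struct. models L S T) \<and>
     (\<forall>\<phi>. sentence L \<phi> \<longrightarrow>
        (\<forall>S :: ('f, 'r, 'a) struct. models L S T \<longrightarrow> holds S \<phi> []) \<or>
        (\<forall>S :: ('f, 'r, 'a) struct. models L S T \<longrightarrow> holds S (Neg \<phi>) []))"

definition elementary_substruct ::
  "('f, 'r) lang \<Rightarrow> 'a set \<Rightarrow> ('f, 'r, 'a) struct \<Rightarrow> bool" where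
  "elementary_substruct L M S \<longleftrightarrow> M \<subseteq> univ S \<and> is_struct L (S\<lparr>univ := M\<rparr>) \<and>
     (\<forall>n \<phi>. \<forall>a\<in>tuples M n. formula L n \<phi> \<longrightarrow>
        (holds (S\<lparr>univ := M\<rparr>) \<phi> a \<longleftrightarrow> holds S \<phi> a))"

definition automorphism ::
  "('f, 'r) lang \<Rightarrow> ('f, 'r, 'a) struct \<Rightarrow> ('a \<Rightarrow> 'a) \<Rightarrow> bool" where
  "automorphism L S \<sigma> \<longleftrightarrow> bij_betw \<sigma> (univ S) (univ S) \<and>
     (\<forall>f\<in>funs L. \<forall>a\<in>tuples (univ S) (fun_arity L f).
        \<sigma> (fun_interp S f a) = fun_interp S f (map \<sigma> a)) \<and>
     (\<forall>r\<in>rels L. \<forall>a\<in>tuples (univ S) (rel_arity L r).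
        rel_interp S r a \<longleftrightarrow> rel_interp S r (map \<sigma> a))"

section \<open>Types\<close>

text \<open>A formula \<open>\<phi>(x,b)\<close> with parameters \<open>b\<close> is the pair \<open>(\<phi>, b)\<close>; below, \<open>n\<close> is the length of \<open>x\<close>.\<close>

definition fmls_over :: "('f, 'r) lang \<Rightarrow> nat \<Rightarrow> 'a set \<Rightarrow> (('f, 'r) fm \<times> 'a list) set" where
  "fmls_over L n A = {(\<phi>, b). set b \<subseteq> A \<and> formula L (n + length b) \<phi>}"

definition consistent ::
  "('f, 'r, 'a) struct \<Rightarrow> nat \<Rightarrow> (('f, 'r) fm \<times> 'a list) set \<Rightarrow> bool" where
  "consistent C n \<Sigma> \<longleftrightarrow>
     (\<forall>\<Delta>\<subseteq>\<Sigma>. finite \<Delta> \<longrightarrow> (\<exists>x\<in>tuples (univ C) n. \<forall>(\<phi>, b)\<in>\<Delta>. holds C \<phi> (x @ b)))"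

definition types ::
  "('f, 'r) lang \<Rightarrow> ('f, 'r, 'a) struct \<Rightarrow> nat \<Rightarrow> 'a set \<Rightarrow> (('f, 'r) fm \<times> 'a list) set set" where
  "types L C n A = {p. p \<subseteq> fmls_over L n A \<and> consistent C n p \<and>
     (\<forall>(\<phi>, b)\<in>fmls_over L n A. (\<phi>, b) \<in> p \<or> (Neg \<phi>, b) \<in> p)}"

definition tp ::
  "('f, 'r) lang \<Rightarrow> ('f, 'r, 'a) struct \<Rightarrow> 'a list \<Rightarrow> 'a set \<Rightarrow> (('f, 'r) fm \<times> 'a list) set" where
  "tp L C a A = {(\<phi>, b) \<in> fmls_over L (length a) A. holds C \<phi> (a @ b)}"

definition type_image ::
  "('a \<Rightarrow> 'a) \<Rightarrow> (('f, 'r) fm \<times> 'a list) set \<Rightarrow> (('f, 'r) fm \<times> 'a list) set" where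
  "type_image \<sigma> p = (\<lambda>(\<phi>, b). (\<phi>, map \<sigma> b)) ` p"

definition invariant_over ::
  "('f, 'r) lang \<Rightarrow> ('f, 'r, 'a) struct \<Rightarrow> 'a set \<Rightarrow> (('f, 'r) fm \<times> 'a list) set \<Rightarrow> bool" where
  "invariant_over L C A p \<longleftrightarrow>
     (\<forall>\<sigma>. automorphism L C \<sigma> \<and> (\<forall>a\<in>A. \<sigma> a = a) \<longrightarrow> type_image \<sigma> p = p)"

section \<open>Monster models\<close>

definition saturated ::
  "('f, 'r) lang \<Rightarrow> 'k rel \<Rightarrow> ('f, 'r, 'a) struct \<Rightarrow> bool" where
  "saturated L \<kappa> C \<longleftrightarrow>
     (\<forall>A\<subseteq>univ C. |A| <o \<kappa> \<longrightarrow>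
        (\<forall>n. \<forall>p\<in>types L C n A. \<exists>c\<in>tuples (univ C) n. tp L C c A = p))"

definition partial_elementary ::
  "('f, 'r) lang \<Rightarrow> ('f, 'r, 'a) struct \<Rightarrow> 'a set \<Rightarrow> ('a \<Rightarrow> 'a) \<Rightarrow> bool" where
  "partial_elementary L C A g \<longleftrightarrow> g ` A \<subseteq> univ C \<and>
     (\<forall>n \<phi>. \<forall>a\<in>tuples A n. formula L n \<phi> \<longrightarrow> (holds C \<phi> a \<longleftrightarrow> holds C \<phi> (map g a)))"

definition strongly_homogeneous ::
  "('f, 'r) lang \<Rightarrow> 'k rel \<Rightarrow> ('f, 'r, 'a) struct \<Rightarrow> bool" where
  "strongly_homogeneous L \<kappa> C \<longleftrightarrow>
     (\<forall>A\<subseteq>univ C. \<forall>g. |A| <o \<kappa> \<and> partial_elementary L C A g \<longrightarrow>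
        (\<exists>\<sigma>. automorphism L C \<sigma> \<and> (\<forall>a\<in>A. \<sigma> a = g a)))"

text \<open>A monster model of \<open>T\<close> is a \<open>\<kappa>\<close>-saturated, strongly \<open>\<kappa>\<close>-homogeneous model of \<open>T\<close>, where the cardinal
  \<open>\<kappa>\<close> is larger than the number of formulas (which is \<open>\<bar>L\<bar> + \<aleph>\<^sub>0\<close>, since there are
  infinitely many variables). Small means of cardinality less than \<open>\<kappa>\<close>.\<close>

definition monster_model ::
  "('f, 'r) lang \<Rightarrow> ('f, 'r) fm set \<Rightarrow> 'k rel \<Rightarrow> ('f, 'r, 'a) struct \<Rightarrow> bool" where
  "monster_model L T \<kappa> C \<longleftrightarrow> models L C T \<and>
     Card_order \<kappa> \<and> |{\<phi>. wf_fm L \<phi>}| <o \<kappa> \<and> saturated L \<kappa> C \<and> strongly_homogeneous L \<kappa> C"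

definition small_model ::
  "('f, 'r) lang \<Rightarrow> 'k rel \<Rightarrow> ('f, 'r, 'a) struct \<Rightarrow> 'a set \<Rightarrow> bool" where
  "small_model L \<kappa> C M \<longleftrightarrow> elementary_substruct L M C \<and> |M| <o \<kappa>"

section \<open>The independence property, dividing, forking, and NTP2\<close>

text \<open>These are properties of a complete theory, evaluated in its monster model \<open>C\<close>.\<close>

definition has_IP :: "('f, 'r) lang \<Rightarrow> ('f, 'r, 'a) struct \<Rightarrow> bool" where
  "has_IP L C \<longleftrightarrow>
     (\<exists>n m \<phi> (a :: nat \<Rightarrow> 'a list) (b :: nat set \<Rightarrow> 'a list).
        formula L (n + m) \<phi> \<and>
        (\<forall>i. a i \<in> tuples (univ C) n) \<and> (\<forall>u. b u \<in> tuples (univ C) m) \<and>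
        (\<forall>i u. holds C \<phi> (a i @ b u) \<longleftrightarrow> i \<in> u))"

text \<open>The family \<open>\<phi>(x,s\<^sub>i)\<close> is treated as indexed: \<open>k\<close>-inconsistency concerns \<open>k\<close> distinct
  indices, even if some of the \<open>s\<^sub>i\<close> coincide.\<close>

definition k_inconsistent ::
  "('f, 'r, 'a) struct \<Rightarrow> nat \<Rightarrow> ('f, 'r) fm \<Rightarrow> nat \<Rightarrow> (nat \<Rightarrow> 'a list) \<Rightarrow> bool" where
  "k_inconsistent C n \<phi> k s \<longleftrightarrow>
     (\<forall>I. finite I \<and> card I = k \<longrightarrow> \<not> (\<exists>x\<in>tuples (univ C) n. \<forall>i\<in>I. holds C \<phi> (x @ s i)))"

definition divides_over ::
  "('f, 'r) lang \<Rightarrow> ('f, 'r, 'a) struct \<Rightarrow> nat \<Rightarrow> 'a set \<Rightarrow> ('f, 'r) fm \<times> 'a list \<Rightarrow> bool" where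
  "divides_over L C n A = (\<lambda>(\<phi>, a). \<exists>k s.
     (\<forall>i. s i \<in> tuples (univ C) (length a) \<and> tp L C (s i) A = tp L C a A) \<and>
     k_inconsistent C n \<phi> k s)"

definition forks_over ::
  "('f, 'r) lang \<Rightarrow> ('f, 'r, 'a) struct \<Rightarrow> nat \<Rightarrow> 'a set \<Rightarrow> ('f, 'r) fm \<times> 'a list \<Rightarrow> bool" where
  "forks_over L C n A = (\<lambda>(\<phi>, a).
     \<exists>\<Delta>\<subseteq>fmls_over L n (univ C). finite \<Delta> \<and> (\<forall>\<psi>\<in>\<Delta>. divides_over L C n A \<psi>) \<and>
       (\<forall>x\<in>tuples (univ C) n. holds C \<phi> (x @ a) \<longrightarrow> (\<exists>(\<psi>, b)\<in>\<Delta>. holds C \<psi> (x @ b))))"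

definition type_forks_over ::
  "('f, 'r) lang \<Rightarrow> ('f, 'r, 'a) struct \<Rightarrow> nat \<Rightarrow> 'a set \<Rightarrow> (('f, 'r) fm \<times> 'a list) set \<Rightarrow> bool" where
  "type_forks_over L C n A p \<longleftrightarrow> (\<exists>\<phi>\<in>p. forks_over L C n A \<phi>)"

definition NTP2 :: "('f, 'r) lang \<Rightarrow> ('f, 'r, 'a) struct \<Rightarrow> bool" where
  "NTP2 L C \<longleftrightarrow> \<not> (\<exists>n m \<phi> k (a :: nat \<Rightarrow> nat \<Rightarrow> 'a list).
     formula L (n + m) \<phi> \<and>
     (\<forall>j i. a j i \<in> tuples (univ C) m) \<and>
     (\<forall>j. k_inconsistent C n \<phi> k (a j)) \<and>
     (\<forall>f :: nat \<Rightarrow> nat. consistent C n (range (\<lambda>j. (\<phi>, a j (f j))))))"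

end

theory Submission
  imports Defs Complex_Main "HOL-Library.Countable"
begin

text \<open>Call a global type given by an ultrafilter on \<open>M\<close>-tuples a coheir over \<open>M\<close>; it is \<open>M\<close>-invariant.
  It is strict if moreover \<open>tp(N/Md)\<close> never divides over \<open>M\<close> when \<open>d\<close> realizes it over \<open>MN\<close>. Following
  Chernikov and Kaplan, in an \<open>NTP\<^sub>2\<close> theory dividing is witnessed along generic sequences of coheirs,
  whence the broom lemma: some finitely many conjugates of a disjunction of dividing formulas are
  jointly inconsistent.
  This gives strict coheirs of all types over \<open>M\<close>; along their Morley sequences every dividing formula
  becomes inconsistent, so that a formula which does not divide over \<open>M\<close> does not fork over \<open>M\<close>.

  Let \<open>\<phi>(a\<^sub>i,b\<^sub>u) \<longleftrightarrow> i \<in> u\<close> and let \<open>Q(y\<^sub>0,y\<^sub>1)\<close> be the limit of the types of the pairs \<open>(a\<^sub>i,a\<^sub>j)\<close>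
  along \<open>W \<otimes> W\<close>, with \<open>W\<close> a non-principal ultrafilter on the indices. Choose a small model \<open>M\<close>
  containing all \<open>a\<^sub>i\<close> over which \<open>Q\<close> is an heir as well as a coheir, hence strict. If \<open>(d\<^sub>0,d\<^sub>1)\<close> realizes
  \<open>Q\<close> over \<open>M\<close>, then \<open>d\<^sub>0\<close> and \<open>d\<^sub>1\<close> have the same type over \<open>M\<close>, and \<open>\<phi>(d\<^sub>0,x) \<and> \<not> \<phi>(d\<^sub>1,x)\<close> does not
  divide over \<open>M\<close> since it is consistent along Morley sequences of \<open>Q\<close>. A global non-forking
  type containing it is not invariant.\<close>


section \<open>Ultrafilters\<close>

text \<open>Dividing refers to arbitrary sequences of conjugates, so neither indiscernible sequences
  nor Ramsey's theorem occur; generic sequences of coheirs take their place. \<open>NTP2\<close> is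
  used through one construction only: an array grown row by row, each new row a conjugate of a
  dividing sequence whose entries are generic over all earlier rows, so that every vertical path is
  a generic sequence. If generic sequences were consistent, this array would contradict
  \<open>NTP2\<close>. Such rows are easy to get when each entry may follow its own coheir, namely
  the image of a coheir of the whole row; this suffices for the broom lemma. To compare forking with
  dividing, however, one coheir must serve all disjuncts, since a pigeonhole distributes the terms
  of one sequence among them; strictness provides rows that follow a single coheir. The independence
  property enters only at the end: as every set of indices u has its \<open>b u\<close>, finitely
  many pairs \<open>(a i, a j)\<close> in which no first index is a second index always have a
  common solution of \<phi>(a i, x) and not \<phi>(a j, x).\<close>

definition ultra :: "'b filter \<Rightarrow> bool" where
  "ultra F \<longleftrightarrow> F \<noteq> bot \<and> (\<forall>P. eventually P F \<or> eventually (\<lambda>x. \<not> P x) F)"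

lemma ultra_not: "ultra F \<Longrightarrow> eventually (\<lambda>x. \<not> P x) F \<longleftrightarrow> \<not> eventually P F"
  using eventually_conj[of P F "\<lambda>x. \<not> P x"] by (auto simp: ultra_def)

lemma ultra_ex: "ultra F \<Longrightarrow> eventually P F \<Longrightarrow> \<exists>x. P x"
  by (auto simp: ultra_def dest: eventually_happens)

lemma ultra_filtermap: "ultra F \<Longrightarrow> ultra (filtermap f F)"
  unfolding ultra_def by (auto simp: eventually_filtermap filtermap_bot_iff)

text \<open>Zorn's lemma for the reversed order on the proper filters below \<open>F\<close>. The
  infimum of a nonempty chain is proper, since every nonempty finite subset of a chain has a least
  member.\<close>

lemma ultrafilter_exists:
  assumes "F \<noteq> bot"
  obtains G where "G \<le> F" "ultra G"
proof -
  let ?A = "{G. G \<noteq> bot \<and> G \<le> F}"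
  have "\<exists>m\<in>?A. \<forall>a\<in>?A. (\<ge>) m a \<longrightarrow> a = m"
  proof (rule predicate_Zorn)
    show "partial_order_on ?A (relation_of (\<ge>) ?A)"
      by (rule partial_order_on_relation_ofI) auto
    fix C assume C: "C \<in> Chains (relation_of (\<ge>) ?A)"
    have sub: "C \<subseteq> ?A" using C by (auto simp: Chains_def relation_of_def)
    have lin: "\<And>a b. a \<in> C \<Longrightarrow> b \<in> C \<Longrightarrow> a \<le> b \<or> b \<le> a"
      using C by (auto simp: Chains_def relation_of_def)
    show "\<exists>u\<in>?A. \<forall>a\<in>C. a \<ge> u"
    proof (cases "C = {}")
      case True then show ?thesis using assms by auto
    next
      case False
      have "Inf C \<noteq> bot"
      proof (rule Inf_filter_not_bot)
        fix X assume X: "X \<subseteq> C" "finite X"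
        show "Inf X \<noteq> bot"
        proof (cases "X = {}")
          case True
          moreover have "(top :: 'a filter) \<noteq> bot" using assms top_greatest[of F] by (metis bot_unique)
          ultimately show ?thesis by simp
        next
          case False
          have "\<exists>x\<in>X. \<forall>y\<in>X. x \<le> y" using X(2) False X(1)
          proof (induction X rule: finite_ne_induct)
            case (singleton x) then show ?case by auto
          next
            case (insert x X)
            then obtain z where z: "z \<in> X" "\<forall>y\<in>X. z \<le> y" by auto
            show ?case
            proof (cases "x \<le> z")
              case True
              then show ?thesis using z by (intro bexI[of _ x]) (auto intro: order_trans)
            next
              case False
              then have "z \<le> x" using lin[of x z] insert.prems z by auto
              then show ?thesis using z by (intro bexI[of _ z]) auto
            qed
          qed
          then obtain x where x: "x \<in> X" "\<forall>y\<in>X. x \<le> y" by blast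
          then have "x \<le> Inf X" by (simp add: Inf_greatest)
          moreover have "x \<noteq> bot" using sub X(1) x(1) by auto
          ultimately show ?thesis by (auto simp: bot_unique)
        qed
      qed
      moreover have "Inf C \<le> F"
      proof -
        obtain c where "c \<in> C" using False by auto
        then show ?thesis using sub Inf_lower[of c C] by (auto intro: order_trans)
      qed
      ultimately show ?thesis by (auto intro: Inf_lower)
    qed
  qed
  then obtain G where G: "G \<noteq> bot" "G \<le> F" and max: "\<And>H. H \<noteq> bot \<Longrightarrow> H \<le> F \<Longrightarrow> H \<le> G \<Longrightarrow> H = G"
    by auto
  have "ultra G"
    unfolding ultra_def
  proof (intro conjI allI G)
    fix P
    show "eventually P G \<or> eventually (\<lambda>x. \<not> P x) G"
    proof (cases "inf G (principal {x. P x}) = bot")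
      case True
      then have "eventually (\<lambda>_. False) (inf G (principal {x. P x}))" by simp
      then show ?thesis by (simp add: eventually_inf_principal)
    next
      case False
      then have "inf G (principal {x. P x}) = G"
        using G by (intro max) (auto intro: le_infI1)
      moreover have "eventually P (inf G (principal {x. P x}))" by (simp add: eventually_inf_principal)
      ultimately show ?thesis by simp
    qed
  qed
  with G that show thesis by blast
qed

text \<open>Types are represented below by ultrafilters on tuples, and this is the compactness
  principle that produces them. The predicates are arbitrary, so that membership in
  \<open>tuples M n\<close> can be one of the requirements.\<close>

lemma ultrafilter_fip:
  assumes "\<And>X. finite X \<Longrightarrow> X \<subseteq> \<P> \<Longrightarrow> \<exists>x. \<forall>P\<in>X. P x"
  obtains G where "ultra G" "\<And>P. P \<in> \<P> \<Longrightarrow> eventually P G"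
proof -
  have *: "eventually (\<lambda>x. \<forall>P\<in>X. P x) (INF P\<in>X. principal (Collect P)) \<and>
      (INF P\<in>X. principal (Collect P)) = principal {x. \<forall>P\<in>X. P x}" if "finite X" for X :: "('a \<Rightarrow> bool) set"
  proof -
    have "(INF P\<in>X. principal (Collect P)) = principal (\<Inter>P\<in>X. Collect P)"
      using that by (rule INF_principal_finite)
    also have "(\<Inter>P\<in>X. Collect P) = {x. \<forall>P\<in>X. P x}" by auto
    finally have "(INF P\<in>X. principal (Collect P)) = principal {x. \<forall>P\<in>X. P x}" .
    then show ?thesis by (simp add: eventually_principal)
  qed
  have "(INF P\<in>\<P>. principal (Collect P)) \<noteq> bot"
  proof (rule INF_filter_not_bot)
    fix X assume "X \<subseteq> \<P>" "finite X"
    then show "(INF P\<in>X. principal (Collect P)) \<noteq> bot"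
      using assms[of X] *[of X] by (auto simp: principal_eq_bot_iff)
  qed
  then obtain G where G: "G \<le> (INF P\<in>\<P>. principal (Collect P))" "ultra G"
    by (rule ultrafilter_exists)
  have "eventually P G" if "P \<in> \<P>" for P
  proof -
    have "G \<le> principal (Collect P)" using G(1) that by (meson INF_lower order_trans)
    then show ?thesis by (simp add: le_principal)
  qed
  with G that show thesis by blast
qed

section \<open>Renaming variables and quantifying over tuples\<close>

lemma finite_fv_trm: "finite (fv_trm t)"
  by (induction t) auto

lemma finite_fv: "finite (fv \<phi>)"
  by (induction \<phi>) (auto simp: finite_fv_trm)

lemma val_cong: "(\<And>i. i \<in> fv_trm t \<Longrightarrow> e i = e' i) \<Longrightarrow> val S e t = val S e' t"
proof (induction t)
  case (App f ts)
  then have "map (val S e) ts = map (val S e') ts" by auto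
  then show ?case by (simp del: map_eq_conv)
qed auto

lemma sat_cong: "(\<And>i. i \<in> fv \<phi> \<Longrightarrow> e i = e' i) \<Longrightarrow> sat S e \<phi> \<longleftrightarrow> sat S e' \<phi>"
proof (induction \<phi> arbitrary: e e')
  case (Eq s t)
  have "val S e s = val S e' s" "val S e t = val S e' t" using Eq by (auto intro!: val_cong)
  then show ?case by simp
next
  case (Rel r ts)
  then have "map (val S e) ts = map (val S e') ts" by (auto intro!: val_cong)
  then show ?case by (simp del: map_eq_conv)
next
  case (Exi i \<phi>)
  have "sat S (e(i := a)) \<phi> \<longleftrightarrow> sat S (e'(i := a)) \<phi>" for a
    by (rule Exi.IH) (use Exi.prems in auto)
  then show ?case by simp
next
  case (Conj \<phi>1 \<phi>2)
  have "sat S e \<phi>1 = sat S e' \<phi>1" by (rule Conj.IH(1)) (use Conj.prems in auto)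
  moreover have "sat S e \<phi>2 = sat S e' \<phi>2" by (rule Conj.IH(2)) (use Conj.prems in auto)
  ultimately show ?case by simp
next
  case (Neg \<phi>)
  have "sat S e \<phi> = sat S e' \<phi>" by (rule Neg.IH) (use Neg.prems in auto)
  then show ?case by simp
qed

lemma ren_trm:
  "\<exists>t'. (wf_trm L t \<longrightarrow> wf_trm L t') \<and> fv_trm t' = f ` fv_trm t \<and> (\<forall>S e. val S e t' = val S (\<lambda>k. e (f k)) t)"
proof (intro exI conjI)
  let ?t = "map_trm id t"
  \<comment> \<open>\<open>rec_trm\<close> hands over every argument paired with its value, hence
    \<open>map snd\<close>.\<close>
  let ?g = "rec_trm (\<lambda>i. Var (f i)) (\<lambda>g ts. App g (map snd ts))"
  have v: "?g (Var i) = Var (f i)" for i by simp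
  have a: "?g (App h ts) = App h (map ?g ts)" for h ts by (simp add: comp_def)
  show "wf_trm L t \<longrightarrow> wf_trm L (?g t)" by (induction t) (auto simp: v a simp del: trm.rec)
  show "fv_trm (?g t) = f ` fv_trm t" by (induction t) (auto simp: v a simp del: trm.rec)
  show "\<forall>S e. val S e (?g t) = val S (\<lambda>k. e (f k)) t"
    by (induction t) (auto simp: v a simp del: trm.rec intro!: arg_cong[where f="fun_interp _ _"])
qed

text \<open>\<open>f\<close> may identify variables, so a bound variable is replaced by one outside
  the image of the variables of the body. The result is specified by its semantics, which spares a
  substitution calculus.\<close>

lemma ren_fm:
  "\<exists>\<phi>'. (wf_fm L \<phi> \<longrightarrow> wf_fm L \<phi>') \<and> fv \<phi>' \<subseteq> f ` fv \<phi> \<and>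
     (\<forall>(S :: ('f, 'r, 'a) struct) e. sat S e \<phi>' = sat S (\<lambda>k. e (f k)) \<phi>)"
proof (induction \<phi> arbitrary: f)
  case (Eq s t)
  obtain s' where "wf_trm L s \<longrightarrow> wf_trm L s'" "fv_trm s' = f ` fv_trm s"
      "\<forall>(S :: ('f, 'r, 'a) struct) e. val S e s' = val S (\<lambda>k. e (f k)) s"
    using ren_trm[of L s f] by auto
  moreover obtain t' where "wf_trm L t \<longrightarrow> wf_trm L t'" "fv_trm t' = f ` fv_trm t"
      "\<forall>(S :: ('f, 'r, 'a) struct) e. val S e t' = val S (\<lambda>k. e (f k)) t"
    using ren_trm[of L t f] by auto
  ultimately show ?case by (intro exI[of _ "Eq s' t'"]) auto
next
  case (Rel r ts)
  obtain g where g: "\<And>t. (wf_trm L t \<longrightarrow> wf_trm L (g t)) \<and> fv_trm (g t) = f ` fv_trm t \<and>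
      (\<forall>(S :: ('f, 'r, 'a) struct) e. val S e (g t) = val S (\<lambda>k. e (f k)) t)"
  proof -
    have "\<forall>t. \<exists>t'. (wf_trm L t \<longrightarrow> wf_trm L t') \<and> fv_trm t' = f ` fv_trm t \<and>
      (\<forall>(S :: ('f, 'r, 'a) struct) e. val S e t' = val S (\<lambda>k. e (f k)) t)"
      by (rule allI, rule ren_trm)
    from choice[OF this] show ?thesis using that by auto
  qed
  have "map (val S e) (map g ts) = map (val S (\<lambda>k. e (f k))) ts" for S :: "('f, 'r, 'a) struct" and e
    using g by simp
  then show ?case using g by (intro exI[of _ "Rel r (map g ts)"]) (auto simp del: map_map map_eq_conv)
next
  case (Neg \<phi>)
  obtain \<phi>' where "wf_fm L \<phi> \<longrightarrow> wf_fm L \<phi>'" "fv \<phi>' \<subseteq> f ` fv \<phi>"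
      "\<forall>(S :: ('f, 'r, 'a) struct) e. sat S e \<phi>' = sat S (\<lambda>k. e (f k)) \<phi>" using Neg[of f] by auto
  then show ?case by (intro exI[of _ "Neg \<phi>'"]) auto
next
  case (Conj \<phi> \<psi>)
  obtain \<phi>' where "wf_fm L \<phi> \<longrightarrow> wf_fm L \<phi>'" "fv \<phi>' \<subseteq> f ` fv \<phi>"
      "\<forall>(S :: ('f, 'r, 'a) struct) e. sat S e \<phi>' = sat S (\<lambda>k. e (f k)) \<phi>" using Conj(1)[of f] by auto
  moreover obtain \<psi>' where "wf_fm L \<psi> \<longrightarrow> wf_fm L \<psi>'" "fv \<psi>' \<subseteq> f ` fv \<psi>"
      "\<forall>(S :: ('f, 'r, 'a) struct) e. sat S e \<psi>' = sat S (\<lambda>k. e (f k)) \<psi>" using Conj(2)[of f] by auto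
  ultimately show ?case by (intro exI[of _ "Conj \<phi>' \<psi>'"]) auto
next
  case (Exi i \<phi>)
  obtain j where j: "j \<notin> f ` fv \<phi>"
    using ex_new_if_finite[OF infinite_UNIV_nat] finite_fv by blast
  obtain \<phi>' where \<phi>': "wf_fm L \<phi> \<longrightarrow> wf_fm L \<phi>'" "fv \<phi>' \<subseteq> f(i := j) ` fv \<phi>"
      "\<forall>(S :: ('f, 'r, 'a) struct) e. sat S e \<phi>' = sat S (\<lambda>k. e ((f(i := j)) k)) \<phi>" using Exi[of "f(i := j)"] by auto
  have "sat S (e(j := a)) \<phi>' = sat S ((\<lambda>k. e (f k))(i := a)) \<phi>" for S :: "('f, 'r, 'a) struct" and e a
  proof -
    have "sat S (\<lambda>k. (e(j := a)) ((f(i := j)) k)) \<phi> = sat S ((\<lambda>k. e (f k))(i := a)) \<phi>"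
      by (rule sat_cong) (use j in auto)
    then show ?thesis using \<phi>'(3) by simp
  qed
  then show ?case using \<phi>'(1,2)
    by (intro exI[of _ "Exi j \<phi>'"]) (auto split: if_splits)
qed

lemma holds_append: "formula L (length a) \<phi> \<Longrightarrow> holds S \<phi> (a @ b) \<longleftrightarrow> holds S \<phi> a"
  unfolding holds_def formula_def by (rule sat_cong) (auto simp: nth_append)

lemma formula_mono: "formula L k \<phi> \<Longrightarrow> k \<le> n \<Longrightarrow> formula L n \<phi>"
  by (auto simp: formula_def)

text \<open>Variable \<open>i\<close> becomes variable \<open>idx ! i\<close>. This one operation
  covers permuting blocks, inserting dummy variables and repeating coordinates.\<close>

lemma rename_formula:
  assumes "formula L (length idx) \<phi>" "set idx \<subseteq> {..<n}"
  obtains \<phi>' where "formula L n \<phi>'"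
    "\<And>(S :: ('f, 'r, 'a) struct) a. holds S \<phi>' a \<longleftrightarrow> holds S \<phi> (map ((!) a) idx)"
proof -
  obtain \<phi>' where \<phi>': "wf_fm L \<phi> \<longrightarrow> wf_fm L \<phi>'" "fv \<phi>' \<subseteq> (!) idx ` fv \<phi>"
     "\<forall>(S :: ('f, 'r, 'a) struct) e. sat S e \<phi>' = sat S (\<lambda>k. e (idx ! k)) \<phi>"
    using ren_fm[of L \<phi> "(!) idx"] by auto
  have "formula L n \<phi>'"
    unfolding formula_def
  proof
    show "wf_fm L \<phi>'" using assms \<phi>'(1) by (simp add: formula_def)
    have "(!) idx ` fv \<phi> \<subseteq> set idx" using assms(1) by (auto simp: formula_def)
    then show "fv \<phi>' \<subseteq> {..<n}" using \<phi>'(2) assms(2) by (blast intro: subset_trans)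
  qed
  moreover have "holds S \<phi>' a \<longleftrightarrow> holds S \<phi> (map ((!) a) idx)" for S :: "('f, 'r, 'a) struct" and a
    unfolding holds_def \<phi>'(3)[rule_format]
    by (rule sat_cong) (use assms(1) in \<open>auto simp: formula_def\<close>)
  ultimately show thesis using that by blast
qed

lemma tuples_0 [simp]: "tuples A 0 = {[]}"
  by (auto simp: tuples_def)

lemma tuples_append: "a \<in> tuples A n \<Longrightarrow> b \<in> tuples A m \<Longrightarrow> a @ b \<in> tuples A (n + m)"
  by (auto simp: tuples_def)

lemma tuples_mono: "A \<subseteq> B \<Longrightarrow> tuples A n \<subseteq> tuples B n"
  by (auto simp: tuples_def)

lemma tuples_Suc: "tuples A (Suc n) = {w @ [x] |w x. w \<in> tuples A n \<and> x \<in> A}"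
  by (auto simp: tuples_def length_Suc_conv_rev)

lemma tuples_length: "a \<in> tuples A n \<Longrightarrow> length a = n"
  by (simp add: tuples_def)

text \<open>Uniform in the structure, because \<open>M_witness\<close> reads the same formula once
  in \<open>C\<close> and once in the substructure on \<open>M\<close>.\<close>

lemma exists_formula:
  assumes "formula L (k + n) \<phi>"
  shows "\<exists>\<phi>'. formula L n \<phi>' \<and> (\<forall>(S :: ('f, 'r, 'a) struct) a. length a = n \<longrightarrow>
    (holds S \<phi>' a \<longleftrightarrow> (\<exists>w\<in>tuples (univ S) k. holds S \<phi> (w @ a))))"
  using assms
proof (induction k arbitrary: \<phi>)
  case 0
  then show ?case by (intro exI[of _ \<phi>]) simp
next
  case (Suc k)
  \<comment> \<open>Coordinate \<open>k\<close>, the last of the quantified ones, goes to the end,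
    where \<open>Exi (k + n)\<close> binds it; the induction hypothesis quantifies the rest.\<close>
  let ?idx = "[0..<k] @ [k + n] @ [k..<k + n]"
  obtain \<psi> where \<psi>: "formula L (Suc (k + n)) \<psi>"
    "\<And>(S :: ('f, 'r, 'a) struct) a. holds S \<psi> a \<longleftrightarrow> holds S \<phi> (map ((!) a) ?idx)"
  proof (rule rename_formula)
    show "formula L (length ?idx) \<phi>" using Suc.prems by (simp add: add.commute)
    show "set ?idx \<subseteq> {..<Suc (k + n)}" by auto
  qed (rule that)
  have e1: "formula L (k + n) (Exi (k + n) \<psi>)"
    using \<psi>(1) by (auto simp: formula_def)
  have e2: "holds S (Exi (k + n) \<psi>) (w @ a) \<longleftrightarrow> (\<exists>x\<in>univ S. holds S \<phi> ((w @ [x]) @ a))"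
    if "length w = k" "length a = n" for S :: "('f, 'r, 'a) struct" and w a
  proof -
    have "sat S ((\<lambda>i. (w @ a) ! i)(k + n := x)) \<psi> \<longleftrightarrow> holds S \<phi> ((w @ [x]) @ a)" for x
    proof -
      have "sat S ((\<lambda>i. (w @ a) ! i)(k + n := x)) \<psi> \<longleftrightarrow> holds S \<psi> (w @ a @ [x])"
        unfolding holds_def by (rule sat_cong) (use \<psi>(1) that in \<open>auto simp: formula_def nth_append\<close>)
      also have "map ((!) (w @ a @ [x])) ?idx = (w @ [x]) @ a"
        using that by (auto intro!: nth_equalityI simp: nth_append)
      then have "holds S \<psi> (w @ a @ [x]) \<longleftrightarrow> holds S \<phi> ((w @ [x]) @ a)"
        unfolding \<psi>(2) by simp
      finally show ?thesis .
    qed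
    then show ?thesis by (simp add: holds_def)
  qed
  obtain \<phi>' where \<phi>': "formula L n \<phi>'" "\<And>(S :: ('f, 'r, 'a) struct) a. length a = n \<Longrightarrow>
    (holds S \<phi>' a \<longleftrightarrow> (\<exists>w\<in>tuples (univ S) k. holds S (Exi (k + n) \<psi>) (w @ a)))"
    using Suc.IH[OF e1] by blast
  have "holds S \<phi>' a \<longleftrightarrow> (\<exists>w\<in>tuples (univ S) (Suc k). holds S \<phi> (w @ a))"
    if "length a = n" for S :: "('f, 'r, 'a) struct" and a
  proof -
    have "holds S \<phi>' a \<longleftrightarrow> (\<exists>w\<in>tuples (univ S) k. \<exists>x\<in>univ S. holds S \<phi> ((w @ [x]) @ a))"
      using \<phi>'(2) e2 that by (auto simp: tuples_length)
    then show ?thesis by (force simp: tuples_Suc)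
  qed
  with \<phi>'(1) show ?case by blast
qed

section \<open>Definable predicates on tuples\<close>

text \<open>Selections of coordinates, along which \<open>rename_formula\<close> pulls formulas
  back. Slices, concatenations and exchanges of blocks are instances.\<close>

definition coord_map :: "nat \<Rightarrow> nat \<Rightarrow> ('b list \<Rightarrow> 'b list) \<Rightarrow> bool" where
  "coord_map n k f \<longleftrightarrow> (\<exists>idx. length idx = k \<and> set idx \<subseteq> {..<n} \<and>
     (\<forall>a. length a = n \<longrightarrow> f a = map ((!) a) idx))"

lemma coord_map_idx: "set idx \<subseteq> {..<n} \<Longrightarrow> coord_map n (length idx) (\<lambda>a. map ((!) a) idx)"
  by (auto simp: coord_map_def)

lemma coord_map_id: "coord_map n n (\<lambda>a. a)"
  unfolding coord_map_def by (intro exI[of _ "[0..<n]"]) (auto simp: map_nth)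

lemma coord_map_take: "coord_map n k f \<Longrightarrow> j \<le> k \<Longrightarrow> coord_map n j (\<lambda>a. take j (f a))"
  unfolding coord_map_def
proof (elim exE conjE)
  fix idx assume "j \<le> k" "length idx = k" "set idx \<subseteq> {..<n}" "\<forall>a. length a = n \<longrightarrow> f a = map ((!) a) idx"
  then show "\<exists>idx. length idx = j \<and> set idx \<subseteq> {..<n} \<and> (\<forall>a. length a = n \<longrightarrow> take j (f a) = map ((!) a) idx)"
    by (intro exI[of _ "take j idx"]) (auto simp: take_map dest: in_set_takeD)
qed

lemma coord_map_drop: "coord_map n k f \<Longrightarrow> coord_map n (k - j) (\<lambda>a. drop j (f a))"
  unfolding coord_map_def
proof (elim exE conjE)
  fix idx assume "length idx = k" "set idx \<subseteq> {..<n}" "\<forall>a. length a = n \<longrightarrow> f a = map ((!) a) idx"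
  then show "\<exists>idx. length idx = k - j \<and> set idx \<subseteq> {..<n} \<and> (\<forall>a. length a = n \<longrightarrow> drop j (f a) = map ((!) a) idx)"
    by (intro exI[of _ "drop j idx"]) (auto simp: drop_map dest: in_set_dropD)
qed

lemma coord_map_append: "coord_map n k f \<Longrightarrow> coord_map n l g \<Longrightarrow> coord_map n (k + l) (\<lambda>a. f a @ g a)"
  unfolding coord_map_def
proof (elim exE conjE)
  fix idx idx' assume "length idx = k" "set idx \<subseteq> {..<n}" "\<forall>a. length a = n \<longrightarrow> f a = map ((!) a) idx"
    "length idx' = l" "set idx' \<subseteq> {..<n}" "\<forall>a. length a = n \<longrightarrow> g a = map ((!) a) idx'"
  then show "\<exists>idx. length idx = k + l \<and> set idx \<subseteq> {..<n} \<and> (\<forall>a. length a = n \<longrightarrow> f a @ g a = map ((!) a) idx)"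
    by (intro exI[of _ "idx @ idx'"]) auto
qed

lemma coord_map_slice: "coord_map n k f \<Longrightarrow> i + j \<le> k \<Longrightarrow> coord_map n j (\<lambda>a. take j (drop i (f a)))"
  by (rule coord_map_take[OF coord_map_drop]) auto

lemma coord_map_tuples: "coord_map n k f \<Longrightarrow> x \<in> tuples A n \<Longrightarrow> f x \<in> tuples A k"
  by (fastforce simp: coord_map_def tuples_def)

lemma coord_map_map: "coord_map n k f \<Longrightarrow> length x = n \<Longrightarrow> f (map g x) = map g (f x)"
  by (fastforce simp: coord_map_def subset_iff)

section \<open>Closure properties of definable predicates\<close>

locale fo_struct =
  fixes L :: "('f, 'r) lang" and C :: "('f, 'r, 'a) struct"
begin

abbreviation U :: "'a set" where "U \<equiv> univ C"

text \<open>Formulas over \<open>A\<close> up to equivalence in \<open>C\<close>: only the values on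
  \<open>tuples U n\<close> count, so later arguments handle predicates instead of syntax.\<close>

definition definable :: "'a set \<Rightarrow> nat \<Rightarrow> ('a list \<Rightarrow> bool) \<Rightarrow> bool" where
  "definable A n P \<longleftrightarrow> (\<exists>\<phi> m. set m \<subseteq> A \<and> formula L (n + length m) \<phi> \<and>
     (\<forall>x\<in>tuples U n. P x \<longleftrightarrow> holds C \<phi> (x @ m)))"

lemma definable_holds:
  "formula L (n + length m) \<phi> \<Longrightarrow> set m \<subseteq> A \<Longrightarrow> definable A n (\<lambda>x. holds C \<phi> (x @ m))"
  by (auto simp: definable_def)

lemma definable_formula: "formula L n \<phi> \<Longrightarrow> definable A n (holds C \<phi>)"
  using definable_holds[of n "[]"] by simp

lemma definable_cong:
  "definable A n P \<Longrightarrow> (\<And>x. x \<in> tuples U n \<Longrightarrow> P x \<longleftrightarrow> Q x) \<Longrightarrow> definable A n Q"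
  by (auto simp: definable_def)

lemma definable_mono: "definable A n P \<Longrightarrow> A \<subseteq> B \<Longrightarrow> definable B n P"
  unfolding definable_def by blast

lemma definable_not: "definable A n P \<Longrightarrow> definable A n (\<lambda>x. \<not> P x)"
  unfolding definable_def
proof (elim exE conjE)
  fix \<phi> m assume "set m \<subseteq> A" "formula L (n + length m) \<phi>" "\<forall>x\<in>tuples U n. P x \<longleftrightarrow> holds C \<phi> (x @ m)"
  then show "\<exists>\<phi> m. set m \<subseteq> A \<and> formula L (n + length m) \<phi> \<and> (\<forall>x\<in>tuples U n. (\<not> P x) \<longleftrightarrow> holds C \<phi> (x @ m))"
    by (intro exI[of _ "Neg \<phi>"] exI[of _ m]) (auto simp: formula_def holds_def)
qed

lemma definable_conj:
  assumes "definable A n P" "definable A n Q"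
  shows "definable A n (\<lambda>x. P x \<and> Q x)"
proof -
  obtain \<phi> m where \<phi>: "set m \<subseteq> A" "formula L (n + length m) \<phi>" "\<forall>x\<in>tuples U n. P x \<longleftrightarrow> holds C \<phi> (x @ m)"
    using assms(1) by (auto simp: definable_def)
  obtain \<psi> m' where \<psi>: "set m' \<subseteq> A" "formula L (n + length m') \<psi>" "\<forall>x\<in>tuples U n. Q x \<longleftrightarrow> holds C \<psi> (x @ m')"
    using assms(2) by (auto simp: definable_def)
  let ?idx = "[0..<n] @ [n + length m..<n + length m + length m']"
  obtain \<psi>' where \<psi>': "formula L (n + length (m @ m')) \<psi>'"
    "\<And>(S :: ('f, 'r, 'a) struct) a. holds S \<psi>' a \<longleftrightarrow> holds S \<psi> (map ((!) a) ?idx)"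
  proof (rule rename_formula)
    show "formula L (length ?idx) \<psi>" using \<psi>(2) by simp
    show "set ?idx \<subseteq> {..<n + length (m @ m')}" by auto
  qed (rule that)
  have "holds C \<psi>' (x @ m @ m') \<longleftrightarrow> Q x" if "x \<in> tuples U n" for x
  proof -
    have "map ((!) (x @ m @ m')) ?idx = x @ m'"
      using that by (auto intro!: nth_equalityI simp: nth_append tuples_length)
    then show ?thesis using \<psi>' \<psi>(3) that by simp
  qed
  moreover have "holds C \<phi> (x @ m @ m') \<longleftrightarrow> P x" if "x \<in> tuples U n" for x
    using holds_append[of L "x @ m" \<phi> C m'] \<phi>(2,3) that by (simp add: tuples_length)
  moreover have "formula L (n + length (m @ m')) (Conj \<phi> \<psi>')"
    using \<psi>'(1) formula_mono[OF \<phi>(2), of "n + length (m @ m')"] by (auto simp: formula_def)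
  moreover have "holds C (Conj \<phi> \<psi>') y \<longleftrightarrow> holds C \<phi> y \<and> holds C \<psi>' y" for y
    by (simp add: holds_def)
  ultimately show ?thesis
    unfolding definable_def using \<phi>(1) \<psi>(1) by (intro exI[of _ "Conj \<phi> \<psi>'"] exI[of _ "m @ m'"]) auto
qed

lemma definable_const: "definable A n (\<lambda>x. b)"
proof -
  let ?\<phi> = "Exi 0 (Eq (Var 0) (Var 0))"
  have \<phi>: "formula L n ?\<phi>" by (simp add: formula_def)
  have "definable A n (\<lambda>x. holds C ?\<phi> x \<and> \<not> holds C ?\<phi> x)"
    by (intro definable_conj definable_not definable_formula \<phi>)
  then have F: "definable A n (\<lambda>x. False)" by simp
  show ?thesis by (cases b) (use F definable_not[OF F] in auto)
qed

lemma definable_ball: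
  "finite I \<Longrightarrow> (\<And>i. i \<in> I \<Longrightarrow> definable A n (P i)) \<Longrightarrow> definable A n (\<lambda>x. \<forall>i\<in>I. P i x)"
  by (induction I rule: finite_induct) (auto intro: definable_const definable_conj)

lemma definable_bex:
  assumes "finite I" "\<And>i. i \<in> I \<Longrightarrow> definable A n (P i)"
  shows "definable A n (\<lambda>x. \<exists>i\<in>I. P i x)"
proof -
  have "definable A n (\<lambda>x. \<not> (\<forall>i\<in>I. \<not> P i x))"
    by (intro definable_not definable_ball assms)
  then show ?thesis by simp
qed

lemma definable_coord_map:
  assumes "definable A k P" "coord_map n k f"
  shows "definable A n (\<lambda>x. P (f x))"
proof -
  obtain \<phi> m where \<phi>: "set m \<subseteq> A" "formula L (k + length m) \<phi>" "\<forall>x\<in>tuples U k. P x \<longleftrightarrow> holds C \<phi> (x @ m)"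
    using assms(1) by (auto simp: definable_def)
  obtain idx where idx: "length idx = k" "set idx \<subseteq> {..<n}" "\<And>a. length a = n \<Longrightarrow> f a = map ((!) a) idx"
    using assms(2) by (auto simp: coord_map_def)
  let ?idx = "idx @ [n..<n + length m]"
  obtain \<phi>' where \<phi>': "formula L (n + length m) \<phi>'"
    "\<And>(S :: ('f, 'r, 'a) struct) a. holds S \<phi>' a \<longleftrightarrow> holds S \<phi> (map ((!) a) ?idx)"
  proof (rule rename_formula)
    show "formula L (length ?idx) \<phi>" using \<phi>(2) idx(1) by simp
    show "set ?idx \<subseteq> {..<n + length m}" using idx(2) by auto
  qed (rule that)
  have "holds C \<phi>' (x @ m) \<longleftrightarrow> P (f x)" if "x \<in> tuples U n" for x
  proof -
    have "map ((!) (x @ m)) [n..<n + length m] = m"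
      using that by (auto intro!: nth_equalityI simp: nth_append tuples_length)
    moreover have "map ((!) (x @ m)) idx = f x"
      using that idx by (auto simp: nth_append tuples_length subset_iff)
    ultimately have "map ((!) (x @ m)) ?idx = f x @ m" by simp
    moreover have "f x \<in> tuples U k" using assms(2) that by (rule coord_map_tuples)
    ultimately show ?thesis using \<phi>' \<phi>(3) by simp
  qed
  then show ?thesis unfolding definable_def using \<phi>(1) \<phi>'(1) by blast
qed

lemma definable_ex:
  assumes "definable A (k + n) P"
  shows "definable A n (\<lambda>x. \<exists>w\<in>tuples U k. P (w @ x))"
proof -
  obtain \<phi> m where \<phi>: "set m \<subseteq> A" "formula L (k + (n + length m)) \<phi>"
      "\<And>x. x \<in> tuples U (k + n) \<Longrightarrow> P x \<longleftrightarrow> holds C \<phi> (x @ m)"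
    using assms(1) by (auto simp: definable_def add.assoc)
  obtain \<phi>' where \<phi>': "formula L (n + length m) \<phi>'" "\<And>(S :: ('f, 'r, 'a) struct) a.
      length a = n + length m \<Longrightarrow> (holds S \<phi>' a \<longleftrightarrow> (\<exists>w\<in>tuples (univ S) k. holds S \<phi> (w @ a)))"
    using exists_formula[OF \<phi>(2)] by blast
  have "holds C \<phi>' (x @ m) \<longleftrightarrow> (\<exists>w\<in>tuples U k. P (w @ x))" if "x \<in> tuples U n" for x
    using \<phi>'(2)[of "x @ m" C] \<phi>(3)[OF tuples_append] that by (simp add: tuples_length)
  then show ?thesis unfolding definable_def using \<phi>(1) \<phi>'(1) by blast
qed

lemma definable_param:
  assumes "definable A (n + length c) P" "set c \<subseteq> A" "A \<subseteq> U"
  shows "definable A n (\<lambda>x. P (x @ c))"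
proof -
  obtain \<phi> m where \<phi>: "set m \<subseteq> A" "formula L (n + length c + length m) \<phi>"
      "\<forall>x\<in>tuples U (n + length c). P x \<longleftrightarrow> holds C \<phi> (x @ m)"
    using assms(1) by (auto simp: definable_def)
  have c: "c \<in> tuples U (length c)" using assms by (auto simp: tuples_def)
  then have "P (x @ c) \<longleftrightarrow> holds C \<phi> (x @ c @ m)" if "x \<in> tuples U n" for x
    using \<phi>(3) tuples_append[OF that c] by simp
  then show ?thesis unfolding definable_def using \<phi>(1,2) assms(2)
    by (intro exI[of _ \<phi>] exI[of _ "c @ m"]) (auto simp: add.assoc)
qed

text \<open>\<open>definable\<close> keeps its parameters at the right end, so the two blocks are
  exchanged first.\<close>

lemma definable_param_left:
  assumes "definable A (length c + n) P" "set c \<subseteq> A" "A \<subseteq> U"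
  shows "definable A n (\<lambda>x. P (c @ x))"
proof -
  have "coord_map (n + length c) (length c + n) (\<lambda>z. drop n z @ take n z)"
    using coord_map_append[OF coord_map_drop[OF coord_map_id, of "n + length c" n] coord_map_take[OF coord_map_id, of n "n + length c"]]
    by simp
  from definable_coord_map[OF assms(1) this] have "definable A (n + length c) (\<lambda>z. P (drop n z @ take n z))" .
  from definable_param[OF this assms(2,3)]
  show ?thesis by (rule definable_cong) (auto simp: tuples_length)
qed

section \<open>Types over a set in terms of definable predicates\<close>

definition eq_type :: "'a set \<Rightarrow> 'a list \<Rightarrow> 'a list \<Rightarrow> bool" where
  "eq_type A a b \<longleftrightarrow> length a = length b \<and> (\<forall>P. definable A (length a) P \<longrightarrow> P a = P b)"

lemma eq_type_refl: "eq_type A a a"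
  by (simp add: eq_type_def)

lemma eq_type_sym: "eq_type A a b \<Longrightarrow> eq_type A b a"
  unfolding eq_type_def by metis

lemma eq_type_trans: "eq_type A a b \<Longrightarrow> eq_type A b c \<Longrightarrow> eq_type A a c"
  unfolding eq_type_def by metis

lemma eq_type_length: "eq_type A a b \<Longrightarrow> length a = length b"
  by (simp add: eq_type_def)

lemma eq_typeD: "eq_type A a b \<Longrightarrow> definable A n P \<Longrightarrow> length a = n \<Longrightarrow> P a \<longleftrightarrow> P b"
  by (auto simp: eq_type_def)

lemma eq_type_coord_map: "eq_type A a b \<Longrightarrow> coord_map (length a) k f \<Longrightarrow> eq_type A (f a) (f b)"
proof -
  assume ab: "eq_type A a b" and f: "coord_map (length a) k f"
  have l: "length (f a) = k" "length (f b) = k"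
    using f eq_type_length[OF ab] by (auto simp: coord_map_def)
  show ?thesis
    unfolding eq_type_def using l eq_typeD[OF ab definable_coord_map[OF _ f]] by auto
qed

lemma tp_eq_iff:
  assumes "a \<in> tuples U n" "b \<in> tuples U n"
  shows "tp L C a A = tp L C b A \<longleftrightarrow> eq_type A a b"
proof
  assume tp: "tp L C a A = tp L C b A"
  have "P a = P b" if P: "definable A n P" for P
  proof -
    obtain \<phi> m where \<phi>: "set m \<subseteq> A" "formula L (n + length m) \<phi>"
      "\<forall>x\<in>tuples U n. P x \<longleftrightarrow> holds C \<phi> (x @ m)"
      using P by (auto simp: definable_def)
    have "(\<phi>, m) \<in> tp L C a A \<longleftrightarrow> holds C \<phi> (a @ m)" "(\<phi>, m) \<in> tp L C b A \<longleftrightarrow> holds C \<phi> (b @ m)"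
      using \<phi> assms by (auto simp: tp_def fmls_over_def tuples_length)
    then show ?thesis using tp \<phi>(3) assms by simp
  qed
  then show "eq_type A a b" using assms by (simp add: eq_type_def tuples_length)
next
  assume "eq_type A a b"
  then show "tp L C a A = tp L C b A"
    using eq_typeD[OF _ definable_holds] assms
    by (fastforce simp: tp_def fmls_over_def tuples_length)
qed

end

section \<open>Realizing types and extending partial maps\<close>

lemma map_inv_into_tuples:
  "bij_betw \<sigma> A A \<Longrightarrow> a \<in> tuples A n \<Longrightarrow> map \<sigma> (map (inv_into A \<sigma>) a) = a \<and> map (inv_into A \<sigma>) a \<in> tuples A n"
  by (auto simp: tuples_def bij_betw_def map_idI f_inv_into_f inv_into_into subset_iff intro!: map_idI)

locale monster = fo_struct L C
  for L :: "('f, 'r) lang" and C :: "('f, 'r, 'a) struct" +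
  fixes T :: "('f, 'r) fm set" and \<kappa> :: "'k rel"
  assumes monster: "monster_model L T \<kappa> C"
begin

lemma U_struct: "is_struct L C" and Card_order_\<kappa>: "Card_order \<kappa>"
  and formulas_small: "|{\<phi>. wf_fm L \<phi>}| <o \<kappa>"
  and saturated: "saturated L \<kappa> C" and homogeneous: "strongly_homogeneous L \<kappa> C"
  using monster by (auto simp: monster_model_def models_def)

lemma U_nonempty: "U \<noteq> {}"
  using U_struct by (simp add: is_struct_def)

lemma infinite_formulas: "infinite {\<phi> :: ('f, 'r) fm. wf_fm L \<phi>}"
proof
  assume "finite {\<phi> :: ('f, 'r) fm. wf_fm L \<phi>}"
  then have "finite (range (\<lambda>i. Eq (Var i) (Var i) :: ('f, 'r) fm))"
    by (rule rev_finite_subset) auto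
  moreover have "inj (\<lambda>i. Eq (Var i) (Var i) :: ('f, 'r) fm)" by (auto intro: injI)
  ultimately show False using infinite_UNIV_nat by (auto dest: finite_imageD)
qed

lemma infinite_\<kappa>: "infinite (Field \<kappa>)"
proof
  assume "finite (Field \<kappa>)"
  moreover have "|{\<phi> :: ('f, 'r) fm. wf_fm L \<phi>}| \<le>o |Field \<kappa>|"
    using formulas_small card_of_Field_ordIso[OF Card_order_\<kappa>]
    by (meson ordIso_iff_ordLeq ordLeq_transitive ordLess_imp_ordLeq)
  ultimately show False using infinite_formulas card_of_ordLeq_finite by blast
qed

lemma small_finite: "finite A \<Longrightarrow> |A| <o \<kappa>"
  by (rule finite_ordLess_infinite[OF card_of_Well_order])
    (use infinite_\<kappa> Card_order_\<kappa> in \<open>auto simp: Field_card_of card_order_on_well_order_on\<close>)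

lemma small_Un: "|A| <o \<kappa> \<Longrightarrow> |B| <o \<kappa> \<Longrightarrow> |A \<union> B| <o \<kappa>"
  by (rule card_of_Un_ordLess_infinite_Field[OF infinite_\<kappa> Card_order_\<kappa>])

text \<open>An ultrafilter \<open>R\<close> on tuples stands for the global type of the definable
  predicates belonging to it, and \<open>g\<close> realizes the restriction of that type to
  \<open>A\<close>. For an ultrafilter the implication is an equivalence, see
  \<open>realizes_iff\<close>.\<close>

definition realizes :: "'a list filter \<Rightarrow> 'a set \<Rightarrow> 'a list \<Rightarrow> bool" where
  "realizes R A g \<longleftrightarrow> (\<forall>P. definable A (length g) P \<longrightarrow> eventually P R \<longrightarrow> P g)"

lemma realizesD:
  "realizes R A g \<Longrightarrow> definable A n P \<Longrightarrow> length g = n \<Longrightarrow> eventually P R \<Longrightarrow> P g"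
  by (auto simp: realizes_def)

lemma type_of_ultra:
  assumes "ultra F" "eventually (\<lambda>x. x \<in> tuples U n) F"
    and p_def: "p = {(\<phi>, b) \<in> fmls_over L n A. eventually (\<lambda>x. holds C \<phi> (x @ b)) F}"
  shows "p \<in> types L C n A"
  unfolding types_def mem_Collect_eq
proof (intro conjI ballI)
  show "p \<subseteq> fmls_over L n A" by (auto simp: p_def)
  show "consistent C n p"
    unfolding consistent_def
  proof (intro allI impI)
    fix \<Delta> assume \<Delta>: "\<Delta> \<subseteq> p" "finite \<Delta>"
    then have "eventually (\<lambda>x. \<forall>i\<in>\<Delta>. holds C (fst i) (x @ snd i)) F"
      by (intro eventually_ball_finite) (auto simp: p_def)
    then have "eventually (\<lambda>x. x \<in> tuples U n \<and> (\<forall>i\<in>\<Delta>. holds C (fst i) (x @ snd i))) F"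
      using assms(2) by (simp add: eventually_conj)
    from ultra_ex[OF assms(1) this] show "\<exists>x\<in>tuples U n. \<forall>(\<phi>, b)\<in>\<Delta>. holds C \<phi> (x @ b)"
      by (auto simp: case_prod_beta)
  qed
  fix i assume i: "i \<in> fmls_over L n A"
  obtain \<phi> b where [simp]: "i = (\<phi>, b)" by (cases i)
  have "(Neg \<phi>, b) \<in> fmls_over L n A" using i by (auto simp: fmls_over_def formula_def)
  moreover have "holds C (Neg \<phi>) y \<longleftrightarrow> \<not> holds C \<phi> y" for y by (simp add: holds_def)
  ultimately show "case i of (\<phi>, b) \<Rightarrow> (\<phi>, b) \<in> p \<or> (Neg \<phi>, b) \<in> p"
    using i assms(1) by (auto simp: ultra_not p_def)
qed

lemma realizes_exists:
  assumes "ultra R" "eventually (\<lambda>x. x \<in> tuples U n) R" "A \<subseteq> U" "|A| <o \<kappa>"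
  obtains g where "g \<in> tuples U n" "realizes R A g"
proof -
  define p where "p = {(\<phi>, b) \<in> fmls_over L n A. eventually (\<lambda>x. holds C \<phi> (x @ b)) R}"
  have "p \<in> types L C n A" using assms(1,2) p_def by (rule type_of_ultra)
  with saturated[unfolded saturated_def, rule_format, OF assms(3,4)]
  obtain g where g: "g \<in> tuples U n" "tp L C g A = p" by blast
  have "P g" if P: "definable A n P" "eventually P R" for P
  proof -
    obtain \<phi> m where \<phi>: "set m \<subseteq> A" "formula L (n + length m) \<phi>"
      "\<forall>x\<in>tuples U n. P x \<longleftrightarrow> holds C \<phi> (x @ m)"
      using P by (auto simp: definable_def)
    have "eventually (\<lambda>x. holds C \<phi> (x @ m)) R"
      using P(2) assms(2) by eventually_elim (use \<phi>(3) in auto)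
    then have "(\<phi>, m) \<in> tp L C g A" unfolding g(2) p_def using \<phi> by (auto simp: fmls_over_def)
    then show ?thesis using \<phi>(3) g(1) by (auto simp: tp_def)
  qed
  then show thesis using that g(1) by (auto simp: realizes_def tuples_length)
qed

lemma realizes_iff:
  assumes "realizes R A g" "ultra R" "definable A n P" "length g = n"
  shows "P g \<longleftrightarrow> eventually P R"
  using assms definable_not[OF assms(3)] ultra_not[OF assms(2), of P] unfolding realizes_def by metis

lemma realizes_mono: "realizes R B g \<Longrightarrow> A \<subseteq> B \<Longrightarrow> realizes R A g"
  using definable_mono unfolding realizes_def by blast

lemma saturation:
  assumes "A \<subseteq> U" "|A| <o \<kappa>" and P: "\<And>P. P \<in> \<P> \<Longrightarrow> definable A n P"
    and fin: "\<And>X. finite X \<Longrightarrow> X \<subseteq> \<P> \<Longrightarrow> \<exists>x\<in>tuples U n. \<forall>P\<in>X. P x"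
  obtains x where "x \<in> tuples U n" "\<And>P. P \<in> \<P> \<Longrightarrow> P x"
proof -
  obtain G where G: "ultra G" "\<And>P. P \<in> insert (\<lambda>x. x \<in> tuples U n) \<P> \<Longrightarrow> eventually P G"
  proof (rule ultrafilter_fip)
    fix X :: "('a list \<Rightarrow> bool) set"
    assume "finite X" "X \<subseteq> insert (\<lambda>x. x \<in> tuples U n) \<P>"
    then show "\<exists>x. \<forall>P\<in>X. P x" using fin[of "X - {\<lambda>x. x \<in> tuples U n}"] by blast
  qed (rule that)
  obtain g where "g \<in> tuples U n" "realizes G A g"
    using realizes_exists[OF G(1) G(2) assms(1,2), of n] by auto
  moreover have "P g" if "P \<in> \<P>" for P
    using calculation G(2)[of P] P[OF that] that by (auto simp: realizes_def tuples_length)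
  ultimately show thesis using that by blast
qed

section \<open>Automorphisms over a set and homogeneity\<close>

definition Aut :: "'a set \<Rightarrow> ('a \<Rightarrow> 'a) \<Rightarrow> bool" where
  "Aut A \<sigma> \<longleftrightarrow> automorphism L C \<sigma> \<and> (\<forall>a\<in>A. \<sigma> a = a)"

lemma Aut_bij: "Aut A \<sigma> \<Longrightarrow> bij_betw \<sigma> U U"
  by (simp add: Aut_def automorphism_def)

lemma Aut_tuples: "Aut A \<sigma> \<Longrightarrow> x \<in> tuples U n \<Longrightarrow> map \<sigma> x \<in> tuples U n"
  using Aut_bij[of A \<sigma>] by (auto simp: tuples_def bij_betw_def)

lemma automorphism_val:
  assumes "automorphism L C \<sigma>" "\<And>i. e i \<in> U" "wf_trm L t"
  shows "val C (\<lambda>i. \<sigma> (e i)) t = \<sigma> (val C e t) \<and> val C e t \<in> U"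
  using assms(3)
proof (induction t)
  case (Var i)
  then show ?case using assms(2) by simp
next
  case (App f ts)
  then have IH: "map (val C (\<lambda>i. \<sigma> (e i))) ts = map \<sigma> (map (val C e) ts)"
    and t: "map (val C e) ts \<in> tuples U (fun_arity L f)" by (auto simp: tuples_def)
  have "fun_interp C f (map (val C e) ts) \<in> U" using App.prems t U_struct by (auto simp: is_struct_def)
  moreover have "fun_interp C f (map \<sigma> (map (val C e) ts)) = \<sigma> (fun_interp C f (map (val C e) ts))"
    using App.prems t assms(1) by (auto simp: automorphism_def)
  ultimately show ?case unfolding val.simps IH by simp
qed

lemma automorphism_sat:
  assumes "automorphism L C \<sigma>" "\<And>i. e i \<in> U" "wf_fm L \<phi>"
  shows "sat C (\<lambda>i. \<sigma> (e i)) \<phi> \<longleftrightarrow> sat C e \<phi>"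
  using assms(2,3)
proof (induction \<phi> arbitrary: e)
  case (Eq s t)
  have "inj_on \<sigma> U" using assms(1) by (auto simp: automorphism_def bij_betw_def)
  then show ?case using Eq automorphism_val[OF assms(1), of e] by (auto simp: inj_on_eq_iff)
next
  case (Rel r ts)
  then have IH: "map (val C (\<lambda>i. \<sigma> (e i))) ts = map \<sigma> (map (val C e) ts)"
    and t: "map (val C e) ts \<in> tuples U (rel_arity L r)"
    using automorphism_val[OF assms(1), of e] by (auto simp: tuples_def)
  then show ?case unfolding sat.simps IH
    using Rel.prems assms(1) by (auto simp: automorphism_def simp del: map_map)
next
  case (Neg \<phi>)
  have "sat C (\<lambda>i. \<sigma> (e i)) \<phi> \<longleftrightarrow> sat C e \<phi>" by (rule Neg.IH) (use Neg.prems in auto)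
  then show ?case by simp
next
  case (Conj \<phi>1 \<phi>2)
  have "sat C (\<lambda>i. \<sigma> (e i)) \<phi>1 \<longleftrightarrow> sat C e \<phi>1" by (rule Conj.IH(1)) (use Conj.prems in auto)
  moreover have "sat C (\<lambda>i. \<sigma> (e i)) \<phi>2 \<longleftrightarrow> sat C e \<phi>2" by (rule Conj.IH(2)) (use Conj.prems in auto)
  ultimately show ?case by simp
next
  case (Exi i \<phi>)
  have *: "sat C ((\<lambda>k. \<sigma> (e k))(i := \<sigma> a)) \<phi> \<longleftrightarrow> sat C (e(i := a)) \<phi>" if "a \<in> U" for a
  proof -
    have "(\<lambda>k. \<sigma> (e k))(i := \<sigma> a) = (\<lambda>k. \<sigma> ((e(i := a)) k))" by auto
    moreover have "sat C (\<lambda>k. \<sigma> ((e(i := a)) k)) \<phi> \<longleftrightarrow> sat C (e(i := a)) \<phi>"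
      by (rule Exi.IH) (use Exi.prems that in auto)
    ultimately show ?thesis by simp
  qed
  have "\<sigma> ` U = U" using assms(1) by (auto simp: automorphism_def bij_betw_def)
  then have "(\<exists>b\<in>U. sat C ((\<lambda>k. \<sigma> (e k))(i := b)) \<phi>) \<longleftrightarrow> (\<exists>a\<in>U. sat C ((\<lambda>k. \<sigma> (e k))(i := \<sigma> a)) \<phi>)"
    by (metis (mono_tags, lifting) imageE imageI)
  then show ?case using * by simp
qed

lemma automorphism_holds:
  assumes "automorphism L C \<sigma>" "x \<in> tuples U n" "formula L n \<phi>"
  shows "holds C \<phi> (map \<sigma> x) \<longleftrightarrow> holds C \<phi> x"
proof -
  obtain u where u: "u \<in> U" using U_nonempty by auto
  let ?e = "\<lambda>i. if i < n then x ! i else u"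
  have e: "\<And>i. ?e i \<in> U" using assms(2) u by (auto simp: tuples_def)
  have "holds C \<phi> (map \<sigma> x) \<longleftrightarrow> sat C (\<lambda>i. \<sigma> (?e i)) \<phi>"
    unfolding holds_def by (rule sat_cong) (use assms in \<open>auto simp: formula_def tuples_length\<close>)
  also have "\<dots> \<longleftrightarrow> sat C ?e \<phi>"
    using automorphism_sat[OF assms(1) e] assms(3) by (simp add: formula_def)
  also have "\<dots> \<longleftrightarrow> holds C \<phi> x"
    unfolding holds_def by (rule sat_cong) (use assms in \<open>auto simp: formula_def\<close>)
  finally show ?thesis .
qed

lemma Aut_fix: "Aut A \<sigma> \<Longrightarrow> set m \<subseteq> A \<Longrightarrow> map \<sigma> m = m"
  by (auto simp: Aut_def intro!: map_idI)

lemma Aut_definable: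
  assumes "Aut A \<sigma>" "definable A n P" "A \<subseteq> U" "x \<in> tuples U n"
  shows "P (map \<sigma> x) \<longleftrightarrow> P x"
proof -
  obtain \<phi> m where \<phi>: "set m \<subseteq> A" "formula L (n + length m) \<phi>"
    "\<forall>x\<in>tuples U n. P x \<longleftrightarrow> holds C \<phi> (x @ m)"
    using assms(2) by (auto simp: definable_def)
  have "x @ m \<in> tuples U (n + length m)" using assms(3,4) \<phi>(1) by (auto simp: tuples_def)
  then have "holds C \<phi> (map \<sigma> (x @ m)) \<longleftrightarrow> holds C \<phi> (x @ m)"
    using automorphism_holds \<phi>(2) assms(1) unfolding Aut_def by blast
  then show ?thesis using \<phi>(3) assms(4) Aut_tuples[OF assms(1,4)] Aut_fix[OF assms(1) \<phi>(1)] by simp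
qed

lemma Aut_eq_type: "Aut A \<sigma> \<Longrightarrow> A \<subseteq> U \<Longrightarrow> x \<in> tuples U n \<Longrightarrow> eq_type A x (map \<sigma> x)"
  unfolding eq_type_def using Aut_definable[of A \<sigma> n _ x] by (auto simp: tuples_length)

text \<open>Homogeneity is applied to the map that is the identity on \<open>M\<close> and sends
  \<open>a ! i\<close> to \<open>b ! i\<close>. It is well defined because equalities among
  coordinates, and between coordinates and elements of \<open>M\<close>, are part of the
  type.\<close>

lemma eq_type_Aut:
  assumes "M \<subseteq> U" "|M| <o \<kappa>" "a \<in> tuples U n" "b \<in> tuples U n" "eq_type M a b"
  obtains \<sigma> where "Aut M \<sigma>" "map \<sigma> a = b"
proof -
  have l: "length a = n" "length b = n" using assms(3,4) by (auto simp: tuples_length)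
  have eq: "a ! i = a ! j \<longleftrightarrow> b ! i = b ! j" if "i < n" "j < n" for i j
  proof -
    have "definable M n (holds C (Eq (Var i) (Var j)))"
      by (rule definable_formula) (use that in \<open>auto simp: formula_def\<close>)
    from eq_typeD[OF assms(5) this l(1)] show ?thesis by (simp add: holds_def)
  qed
  have eqM: "a ! i = m \<longleftrightarrow> b ! i = m" if "i < n" "m \<in> M" for i m
  proof -
    have "definable M n (\<lambda>x. holds C (Eq (Var i) (Var n)) (x @ [m]))"
      by (rule definable_holds) (use that in \<open>auto simp: formula_def\<close>)
    from eq_typeD[OF assms(5) this l(1)] show ?thesis using that l by (simp add: holds_def nth_append)
  qed
  define g where "g x = (if x \<in> M then x else b ! (SOME i. i < n \<and> a ! i = x))" for x
  have g: "g (a ! i) = b ! i" if "i < n" for i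
  proof (cases "a ! i \<in> M")
    case True
    then show ?thesis using eqM[OF that True] by (simp add: g_def)
  next
    case False
    let ?j = "SOME j. j < n \<and> a ! j = a ! i"
    have "?j < n \<and> a ! ?j = a ! i" using that by (intro someI[of "\<lambda>j. j < n \<and> a ! j = a ! i" i]) simp
    then show ?thesis using eq[of ?j i] that False by (simp add: g_def)
  qed
  have "partial_elementary L C (M \<union> set a) g"
    unfolding partial_elementary_def
  proof (intro conjI allI ballI impI)
    show "g ` (M \<union> set a) \<subseteq> U"
    proof (rule image_subsetI)
      fix x assume "x \<in> M \<union> set a"
      then consider "x \<in> M" | i where "i < n" "x = a ! i" using l by (auto simp: in_set_conv_nth)
      then show "g x \<in> U"
      proof cases
        case 1
        then show ?thesis using assms(1) by (auto simp: g_def)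
      next
        case 2
        then show ?thesis using g assms(4) l by (auto simp: tuples_def)
      qed
    qed
  next
    fix k \<phi> c assume c: "c \<in> tuples (M \<union> set a) k" and \<phi>: "formula L k \<phi>"
    \<comment> \<open>A tuple mixing elements of \<open>M\<close> and of \<open>a\<close> is read
      off from \<open>a @ ?m\<close>. For an element of \<open>M\<close> the position is taken in
      \<open>?m\<close>, where replacing \<open>a\<close> by \<open>b\<close> changes
      nothing.\<close>
    let ?m = "filter (\<lambda>x. x \<in> M) c"
    have "\<exists>i. i < n + length ?m \<and> (a @ ?m) ! i = x \<and> (x \<in> M \<longrightarrow> n \<le> i) \<and> (x \<notin> M \<longrightarrow> i < n)"
      if x: "x \<in> set c" for x
    proof (cases "x \<in> M")
      case True
      then have "x \<in> set ?m" using x by simp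
      then obtain i where "i < length ?m" "?m ! i = x" unfolding in_set_conv_nth by blast
      then show ?thesis using l True by (intro exI[of _ "n + i"]) (simp add: nth_append)
    next
      case False
      then have "x \<in> set a" using x c by (auto simp: tuples_def)
      then obtain i where "i < n" "a ! i = x" using l by (auto simp: in_set_conv_nth)
      then show ?thesis using l False by (intro exI[of _ i]) (simp add: nth_append)
    qed
    then obtain h where h: "\<And>x. x \<in> set c \<Longrightarrow> h x < n + length ?m \<and> (a @ ?m) ! h x = x \<and>
        (x \<in> M \<longrightarrow> n \<le> h x) \<and> (x \<notin> M \<longrightarrow> h x < n)"
      by metis
    define idx where "idx = map h c"
    have idx: "length idx = k" "set idx \<subseteq> {..<n + length ?m}"
      unfolding idx_def using h c by (auto simp: tuples_length)
    have c1: "map ((!) (a @ ?m)) idx = c"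
      unfolding idx_def map_map using h by (intro map_idI) simp
    have c2: "map ((!) (b @ ?m)) idx = map g c"
      unfolding idx_def map_map
    proof (rule map_cong[OF refl])
      fix x assume x: "x \<in> set c"
      show "((!) (b @ ?m) \<circ> h) x = g x"
      proof (cases "x \<in> M")
        case True
        then have "n \<le> h x" "?m ! (h x - n) = x" using h[OF x] l by (auto simp: nth_append)
        then show ?thesis using True l by (simp add: nth_append g_def)
      next
        case False
        then have "h x < n" "a ! h x = x" using h[OF x] l by (auto simp: nth_append)
        then show ?thesis using g[of "h x"] l by (simp add: nth_append)
      qed
    qed
    have m: "set ?m \<subseteq> M" by auto
    obtain \<phi>' where \<phi>': "formula L (n + length ?m) \<phi>'"
      "\<And>(S :: ('f, 'r, 'a) struct) a. holds S \<phi>' a \<longleftrightarrow> holds S \<phi> (map ((!) a) idx)"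
    proof (rule rename_formula)
      show "formula L (length idx) \<phi>" using \<phi> idx(1) by simp
      show "set idx \<subseteq> {..<n + length ?m}" by (rule idx(2))
    qed (rule that)
    have "definable M n (\<lambda>x. holds C \<phi>' (x @ ?m))" using \<phi>'(1) m by (rule definable_holds)
    from eq_typeD[OF assms(5) this l(1)] show "holds C \<phi> c \<longleftrightarrow> holds C \<phi> (map g c)"
      unfolding \<phi>'(2) c1 c2 .
  qed
  moreover have "M \<union> set a \<subseteq> U" using assms(1,3) by (auto simp: tuples_def)
  moreover have "|M \<union> set a| <o \<kappa>" by (rule small_Un[OF assms(2) small_finite]) simp
  ultimately have "\<exists>\<sigma>. automorphism L C \<sigma> \<and> (\<forall>x\<in>M \<union> set a. \<sigma> x = g x)"
    using homogeneous[unfolded strongly_homogeneous_def, rule_format, of "M \<union> set a" g] by simp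
  then obtain \<sigma> where \<sigma>: "automorphism L C \<sigma>" "\<And>x. x \<in> M \<union> set a \<Longrightarrow> \<sigma> x = g x"
    by auto
  have "Aut M \<sigma>" using \<sigma> by (auto simp: Aut_def g_def)
  moreover have "map \<sigma> a = b"
    using \<sigma>(2) g l by (intro nth_equalityI) auto
  ultimately show thesis using that by blast
qed

lemma eq_type_tp: "a \<in> tuples U n \<Longrightarrow> eq_type A a b \<Longrightarrow> b \<in> tuples U n \<Longrightarrow> tp L C b A = tp L C a A"
  using tp_eq_iff by blast

end

section \<open>Ultrafilters concentrating on a small elementary submodel\<close>

locale small_submodel = monster L C T \<kappa>
  for L :: "('f, 'r) lang" and C :: "('f, 'r, 'a) struct" and T :: "('f, 'r) fm set" and \<kappa> :: "'k rel" +
  fixes M :: "'a set"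
  assumes M_elem: "elementary_substruct L M C" and M_small: "|M| <o \<kappa>"
begin

lemma M_U: "M \<subseteq> U"
  using M_elem by (simp add: elementary_substruct_def)

text \<open>Elementarity is used twice: the existential statement goes down from \<open>C\<close> to
  \<open>M\<close>, and the formula at the witness goes back up.\<close>

lemma M_witness:
  assumes "definable M k P" "x \<in> tuples U k" "P x"
  obtains y where "y \<in> tuples M k" "P y"
proof -
  obtain \<phi> m where \<phi>: "set m \<subseteq> M" "formula L (k + length m) \<phi>"
    "\<forall>x\<in>tuples U k. P x \<longleftrightarrow> holds C \<phi> (x @ m)"
    using assms(1) by (auto simp: definable_def)
  obtain \<phi>' where \<phi>': "formula L (length m) \<phi>'" "\<And>(S :: ('f, 'r, 'a) struct) a.
      length a = length m \<Longrightarrow> (holds S \<phi>' a \<longleftrightarrow> (\<exists>w\<in>tuples (univ S) k. holds S \<phi> (w @ a)))"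
    using exists_formula[OF \<phi>(2)] by blast
  have m: "m \<in> tuples M (length m)" using \<phi>(1) by (simp add: tuples_def)
  have "holds C \<phi>' m" using \<phi>'(2) \<phi>(3) assms(2,3) by blast
  then have "holds (C\<lparr>univ := M\<rparr>) \<phi>' m"
    using M_elem m \<phi>'(1) by (auto simp: elementary_substruct_def)
  then obtain y where y: "y \<in> tuples M k" "holds (C\<lparr>univ := M\<rparr>) \<phi> (y @ m)"
    using \<phi>'(2)[of m "C\<lparr>univ := M\<rparr>"] by auto
  then have "holds C \<phi> (y @ m)"
    using M_elem tuples_append[OF y(1) m] \<phi>(2) unfolding elementary_substruct_def by blast
  moreover have "y \<in> tuples U k" using y(1) tuples_mono[OF M_U] by blast
  ultimately show thesis using that y(1) \<phi>(3) by blast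
qed

end

section \<open>The tree property of the second kind from finite arrays\<close>

text \<open>Left inverse of \<open>concat\<close> for \<open>N\<close> blocks of length
  \<open>n\<close>. Sequences of tuples are coded as one long tuple, since \<open>definable\<close>
  speaks of single tuples.\<close>

definition chop :: "nat \<Rightarrow> nat \<Rightarrow> 'b list \<Rightarrow> 'b list list" where
  "chop n N z = map (\<lambda>r. take n (drop (r * n) z)) [0..<N]"

lemma chop_concat: "(\<And>z. z \<in> set zs \<Longrightarrow> length z = n) \<Longrightarrow> chop n (length zs) (concat zs) = zs"
proof (induction zs)
  case (Cons z zs)
  have "chop n (length zs) (concat zs) = zs" using Cons by auto
  moreover have "chop n (Suc N) (z @ y) = z # chop n N y" if "length z = n" for N y
    unfolding chop_def using that
    by (simp add: upt_conv_Cons map_Suc_upt[symmetric] comp_def del: upt_Suc)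
  ultimately show ?case using Cons.prems by simp
qed (simp add: chop_def)

lemma chop_tuples: "z \<in> tuples A (N * n) \<Longrightarrow> y \<in> set (chop n N z) \<Longrightarrow> y \<in> tuples A n"
proof -
  assume z: "z \<in> tuples A (N * n)" and "y \<in> set (chop n N z)"
  then obtain r where r: "r < N" "y = take n (drop (r * n) z)" by (auto simp: chop_def)
  then have "Suc r * n \<le> N * n" by (intro mult_le_mono1) simp
  then show ?thesis using z r
    by (auto simp: tuples_def dest!: in_set_takeD in_set_dropD)
qed

context fo_struct
begin

text \<open>Consistency of the instances \<theta>(x,z). A set of tuples suffices although dividing
  concerns indexed families: repetitions do not affect satisfiability, and indices are counted in
  \<open>k_inconsistent_joint\<close>.\<close>

definition joint :: "nat \<Rightarrow> ('f, 'r) fm \<Rightarrow> 'a list set \<Rightarrow> bool" where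
  "joint k \<theta> Z \<longleftrightarrow> (\<exists>w\<in>tuples U k. \<forall>z\<in>Z. holds C \<theta> (w @ z))"

lemma joint_mono: "joint k \<theta> Z \<Longrightarrow> Y \<subseteq> Z \<Longrightarrow> joint k \<theta> Y"
  unfolding joint_def by blast

lemma definable_joint_blocks:
  assumes "formula L (k + (n + length m)) \<theta>" "set m \<subseteq> A" "G \<subseteq> {..<N}"
  shows "definable A (N * n) (\<lambda>z. joint k \<theta> ((\<lambda>z. z @ m) ` (\<lambda>r. take n (drop (r * n) z)) ` G))"
proof -
  have "definable A (k + N * n) (\<lambda>z. \<forall>r\<in>G. holds C \<theta> ((take k z @ take n (drop (k + r * n) z)) @ m))"
  proof (intro definable_ball)
    show "finite G" using assms(3) finite_subset by blast
    fix r assume "r \<in> G"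
    then have "Suc r * n \<le> N * n" using assms(3) by (intro mult_le_mono1) auto
    then have c: "coord_map (k + N * n) (k + n) (\<lambda>z. take k z @ take n (drop (k + r * n) z))"
      by (intro coord_map_append coord_map_take[OF coord_map_id] coord_map_slice[OF coord_map_id]) auto
    have "definable A (k + n) (\<lambda>x. holds C \<theta> (x @ m))"
      using assms(1,2) by (intro definable_holds) (auto simp: add.assoc)
    from definable_coord_map[OF this c]
    show "definable A (k + N * n) (\<lambda>z. holds C \<theta> ((take k z @ take n (drop (k + r * n) z)) @ m))" .
  qed
  from definable_ex[OF this] show ?thesis
    by (rule definable_cong) (simp add: joint_def tuples_length)
qed

lemma definable_joint:
  assumes "formula L (k + n) \<theta>"
  shows "definable A (N * n) (\<lambda>z. joint k \<theta> (set (chop n N z)))"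
  using definable_joint_blocks[of k n "[]" \<theta> A "{..<N}" N] assms
  by (simp add: chop_def lessThan_atLeast0)

lemma k_inconsistent_joint:
  "k_inconsistent C k \<theta> K s \<longleftrightarrow> (\<forall>I. finite I \<and> card I = K \<longrightarrow> \<not> joint k \<theta> (s ` I))"
  by (simp add: k_inconsistent_def joint_def)

end

context monster
begin

text \<open>\<open>saturated\<close> yields finite tuples only, so the sequence is built entry by
  entry. One ultrafilter \<open>W\<close> on sequences fixes in advance the type over the empty set
  of every initial segment, hence no stage gets stuck.\<close>

lemma omega_compactness:
  fixes idx :: "'i \<Rightarrow> nat list"
  assumes def: "\<And>i. i \<in> I \<Longrightarrow> definable {} (length (idx i)) (P i)"
    and fin: "\<And>X. finite X \<Longrightarrow> X \<subseteq> I \<Longrightarrow> \<exists>e. (\<forall>n. e n \<in> U) \<and> (\<forall>i\<in>X. P i (map e (idx i)))"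
  obtains e where "\<And>n. e n \<in> U" "\<And>i. i \<in> I \<Longrightarrow> P i (map e (idx i))"
proof -
  obtain W where W: "ultra W" "\<And>Q. Q \<in> insert (\<lambda>e. \<forall>n. e n \<in> U) ((\<lambda>i e. P i (map e (idx i))) ` I) \<Longrightarrow> eventually Q W"
  proof (rule ultrafilter_fip)
    fix X assume X: "finite X" "X \<subseteq> insert (\<lambda>e. \<forall>n. e n \<in> U) ((\<lambda>i e. P i (map e (idx i))) ` I)"
    then have "X - {\<lambda>e. \<forall>n. e n \<in> U} \<subseteq> (\<lambda>i e. P i (map e (idx i))) ` I" by auto
    then obtain Y where Y: "Y \<subseteq> I" "finite Y" "X - {\<lambda>e. \<forall>n. e n \<in> U} = (\<lambda>i e. P i (map e (idx i))) ` Y"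
      using X(1) by (metis (no_types, lifting) finite_Diff finite_subset_image)
    obtain e where e: "\<forall>n. e n \<in> U" "\<forall>i\<in>Y. P i (map e (idx i))" using fin[OF Y(2,1)] by auto
    have "Q e" if "Q \<in> X" for Q
    proof (cases "Q = (\<lambda>e. \<forall>n. e n \<in> U)")
      case False
      then have "Q \<in> (\<lambda>i e. P i (map e (idx i))) ` Y" using that Y(3) by auto
      then show ?thesis using e by auto
    qed (use e in auto)
    then show "\<exists>e. \<forall>Q\<in>X. Q e" by auto
  qed (rule that)
  have WU: "eventually (\<lambda>e. \<forall>n. e n \<in> U) W" using W(2) by simp
  define V where "V n = filtermap (\<lambda>e. map e [0..<n]) W" for n
  have V: "ultra (V n)" for n unfolding V_def by (rule ultra_filtermap[OF W(1)])
  define good where "good n c \<longleftrightarrow> c \<in> tuples U n \<and> realizes (V n) {} c" for n c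
  have step: "\<exists>d. good (Suc n) d \<and> (\<exists>x. d = c @ [x])" if c: "good n c" for n c
  proof -
    have cU: "c \<in> tuples U n" and cr: "realizes (V n) {} c" using c by (auto simp: good_def)
    let ?Q = "{Q. definable {} (n + 1) Q \<and> eventually Q (V (Suc n))}"
    obtain y where y: "y \<in> tuples U 1" "\<And>R. R \<in> (\<lambda>Q y. Q (c @ y)) ` ?Q \<Longrightarrow> R y"
    proof (rule saturation[of "set c" "(\<lambda>Q y. Q (c @ y)) ` ?Q" 1])
      show "set c \<subseteq> U" using cU by (simp add: tuples_def)
      show "|set c| <o \<kappa>" by (rule small_finite) simp
      show "definable (set c) 1 R" if R: "R \<in> (\<lambda>Q y. Q (c @ y)) ` ?Q" for R
      proof -
        obtain Q where Q: "definable {} (n + 1) Q" "R = (\<lambda>y. Q (c @ y))" using R by auto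
        show ?thesis unfolding Q(2)
          by (rule definable_param_left) (use cU Q(1) in \<open>auto simp: tuples_def intro: definable_mono\<close>)
      qed
      fix X assume "finite X" "X \<subseteq> (\<lambda>Q y. Q (c @ y)) ` ?Q"
      then obtain F where F: "F \<subseteq> ?Q" "finite F" "X = (\<lambda>Q y. Q (c @ y)) ` F"
        by (metis (no_types, lifting) finite_subset_image)
      \<comment> \<open>That one more entry satisfies a finite part of the next type is a property
        of the initial segment; it holds for \<open>V n\<close>-almost all tuples, hence for
        \<open>c\<close>.\<close>
      let ?R = "\<lambda>x. \<exists>w\<in>tuples U 1. \<forall>Q\<in>F. Q (x @ w)"
      have cm: "coord_map (1 + n) (n + 1) (\<lambda>z. drop 1 z @ take 1 z)"
        using coord_map_append[OF coord_map_drop[OF coord_map_id, of "1 + n" 1] coord_map_take[OF coord_map_id, of 1 "1 + n"]] by simp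
      have "definable {} (1 + n) (\<lambda>z. \<forall>Q\<in>F. Q (drop 1 z @ take 1 z))"
        using F by (intro definable_ball F(2) definable_coord_map[OF _ cm]) auto
      from definable_ex[OF this] have "definable {} n ?R"
        by (rule definable_cong) (auto simp: tuples_length)
      moreover have "eventually ?R (V n)"
      proof -
        have "eventually (\<lambda>e. \<forall>Q\<in>F. Q (map e [0..<Suc n])) W"
          using F by (intro eventually_ball_finite) (auto simp: V_def eventually_filtermap)
        then have "eventually (\<lambda>e. ?R (map e [0..<n])) W"
          using WU
        proof eventually_elim
          case (elim e)
          then show ?case by (intro bexI[of _ "[e n]"]) (auto simp: tuples_def)
        qed
        then show ?thesis by (simp add: V_def eventually_filtermap)
      qed
      ultimately have "?R c" using cr cU unfolding realizes_def by (auto simp only: tuples_length)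
      then show "\<exists>x\<in>tuples U 1. \<forall>R\<in>X. R x" using F(3) by auto
    qed (rule that)
    from y(1) obtain x where x: "y = [x]" "x \<in> U" by (auto simp: tuples_def length_Suc_conv)
    have "realizes (V (Suc n)) {} (c @ [x])"
      using y(2) x(1) cU by (auto simp: realizes_def tuples_length)
    moreover have "c @ [x] \<in> tuples U (Suc n)" using cU x(2) by (auto simp: tuples_def)
    ultimately show ?thesis by (auto simp: good_def)
  qed
  have "good 0 []"
  proof -
    have "eventually (\<lambda>x. x = []) (V 0)" by (simp add: V_def eventually_filtermap)
    then have Q: "Q []" if "eventually Q (V 0)" for Q
      using ultra_ex[OF V, of "\<lambda>x. x = [] \<and> Q x" 0] that by (auto simp: eventually_conj)
    show ?thesis unfolding good_def realizes_def
    proof (intro conjI allI impI)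
      show "[] \<in> tuples U 0" by simp
    qed (rule Q)
  qed
  then obtain f where f: "\<And>n. good n (f n)" "\<And>n. \<exists>x. f (Suc n) = f n @ [x]"
    using dependent_nat_choice[of good "\<lambda>n c d. \<exists>x. d = c @ [x]"] step by metis
  define e where "e i = f (Suc i) ! i" for i
  have len: "length (f n) = n" for n using f(1)[of n] by (auto simp: good_def tuples_length)
  have fe: "f n = map e [0..<n]" for n
  proof (induction n)
    case 0
    then show ?case using len[of 0] by simp
  next
    case (Suc n)
    obtain x where x: "f (Suc n) = f n @ [x]" using f(2) by blast
    then have "e n = x" using len[of n] by (simp add: e_def nth_append)
    then show ?case using x Suc by simp
  qed
  show thesis
  proof (rule that)
    show "e n \<in> U" for n
      using f(1)[of "Suc n"] fe[of "Suc n"] by (auto simp: good_def tuples_def)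
    fix i assume i: "i \<in> I"
    obtain n where n: "set (idx i) \<subseteq> {..<n}"
      using finite_nat_set_iff_bounded[of "set (idx i)"] by auto
    have m: "map ((!) (map g [0..<n])) (idx i) = map g (idx i)" for g :: "nat \<Rightarrow> 'a"
      using n by (auto simp: subset_iff)
    have "definable {} n (\<lambda>a. P i (map ((!) a) (idx i)))"
      using definable_coord_map[OF def[OF i] coord_map_idx[OF n]] .
    moreover have "eventually (\<lambda>a. P i (map ((!) a) (idx i))) (V n)"
      unfolding V_def eventually_filtermap m using W(2) i by auto
    ultimately have "P i (map ((!) (f n)) (idx i))"
      using realizesD[of "V n" "{}" "f n" n] f(1)[of n] len[of n] by (auto simp: good_def)
    then show "P i (map e (idx i))" unfolding fe m .
  qed
qed

text \<open>Inconsistency of \<open>K\<close> entries of a row and consistency of the beginning of a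
  path involve finitely many elements each. So \<open>omega_compactness\<close> applies, with
  coordinate \<open>c\<close> of entry \<open>(j, i)\<close> numbered
  \<open>to_nat (j, i, c)\<close>.\<close>

lemma not_NTP2_of_finite_arrays:
  assumes \<theta>: "formula L (k + n) \<theta>"
    and arr: "\<And>(J :: nat) (N :: nat). \<exists>X. (\<forall>j i. X j i \<in> tuples U n) \<and>
      (\<forall>j<J. \<forall>I\<subseteq>{..<N}. card I = K \<longrightarrow> \<not> joint k \<theta> (X j ` I)) \<and>
      (\<forall>f. (\<forall>j<J. f j < N) \<longrightarrow> joint k \<theta> ((\<lambda>j. X j (f j)) ` {..<J}))"
  shows "\<not> NTP2 L C"
proof -
  \<comment> \<open>The flag tells whether the listed positions are to be jointly satisfiable:
    \<open>False\<close> for \<open>K\<close> positions of one row, \<open>True\<close> for the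
    beginning of a path.\<close>
  let ?I = "{(False, map (Pair j) is) |(j :: nat) (is :: nat list). distinct is \<and> length is = K} \<union>
    {(True, map (\<lambda>j. (j, f j)) [0..<J]) |(f :: nat \<Rightarrow> nat) J. True}"
  define col where "col p = map (\<lambda>c. to_nat (fst p :: nat, snd p :: nat, c :: nat)) [0..<n]" for p
  define idx where "idx q = concat (map col (snd q))" for q :: "bool \<times> (nat \<times> nat) list"
  define P where "P q z \<longleftrightarrow> (joint k \<theta> (set (chop n (length (snd q)) z)) \<longleftrightarrow> fst q)"
    for q :: "bool \<times> (nat \<times> nat) list" and z
  have len: "length (idx q) = length (snd q) * n" for q
    unfolding idx_def length_concat by (simp add: col_def comp_def sum_list_triv)
  have P: "P q (map e (idx q)) \<longleftrightarrow> (joint k \<theta> ((\<lambda>p. map e (col p)) ` set (snd q)) \<longleftrightarrow> fst q)" for q e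
  proof -
    have "map e (idx q) = concat (map (\<lambda>p. map e (col p)) (snd q))"
      by (simp add: idx_def map_concat comp_def)
    moreover have "chop n (length (snd q)) (concat (map (\<lambda>p. map e (col p)) (snd q))) = map (\<lambda>p. map e (col p)) (snd q)"
    proof -
      have "length z = n" if "z \<in> set (map (\<lambda>p. map e (col p)) (snd q))" for z
        using that by (auto simp: col_def)
      from chop_concat[of "map (\<lambda>p. map e (col p)) (snd q)", OF this] show ?thesis by simp
    qed
    ultimately show ?thesis by (simp add: P_def del: map_map)
  qed
  obtain e where e: "\<And>n. e n \<in> U" "\<And>q. q \<in> ?I \<Longrightarrow> P q (map e (idx q))"
  proof (rule omega_compactness[of ?I idx P])
    fix q assume "q \<in> ?I"
    have "definable {} (length (idx q)) (\<lambda>z. joint k \<theta> (set (chop n (length (snd q)) z)))"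
      unfolding len by (rule definable_joint[OF \<theta>])
    then show "definable {} (length (idx q)) (P q)"
      unfolding P_def by (cases "fst q") (auto intro: definable_not)
  next
    fix X assume X: "finite X" "X \<subseteq> ?I"
    let ?S = "\<Union>q\<in>X. fst ` set (snd q) \<union> snd ` set (snd q)"
    have "finite ?S" using X(1) by auto
    then obtain B' where B': "\<forall>s\<in>?S. s < B'" unfolding finite_nat_set_iff_bounded ..
    \<comment> \<open>Made positive, since row 0 is consulted when \<open>K = 0\<close> and since
      paths are prolonged below by the value 0.\<close>
    define B where "B = Suc B'"
    have B: "j < B \<and> i < B" if "q \<in> X" "(j, i) \<in> set (snd q)" for q j i
    proof -
      have "j \<in> ?S" "i \<in> ?S" using that by force+
      then show ?thesis using bspec[OF B', of j] bspec[OF B', of i] by (simp add: B_def)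
    qed
    obtain Y where Y: "\<And>j i. Y j i \<in> tuples U n"
      "\<And>j I. j < B \<Longrightarrow> I \<subseteq> {..<B} \<Longrightarrow> card I = K \<Longrightarrow> \<not> joint k \<theta> (Y j ` I)"
      "\<And>f. (\<And>j. j < B \<Longrightarrow> f j < B) \<Longrightarrow> joint k \<theta> ((\<lambda>j. Y j (f j)) ` {..<B})"
      using arr[of B B] by auto
    obtain u where u: "u \<in> U" using U_nonempty by auto
    define e where "e m = (case from_nat m of (j, i, c) \<Rightarrow> if c < n then Y j i ! c else u)" for m
    have e: "e m \<in> U" for m
    proof -
      have "Y j i ! c \<in> U" if "c < n" for j i c
        using Y(1)[of j i] nth_mem[of c "Y j i"] that by (auto simp: tuples_def)
      then show ?thesis using u by (auto simp: e_def split: prod.split)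
    qed
    have col: "map e (col p) = Y (fst p) (snd p)" for p
      using tuples_length[OF Y(1)] by (intro nth_equalityI) (auto simp: col_def e_def)
    have "P q (map e (idx q))" if q: "q \<in> X" for q
    proof -
      from q X(2) consider j "is" where "q = (False, map (Pair j) is)" "distinct is" "length is = K"
        | f J where "q = (True, map (\<lambda>j. (j, f j)) [0..<J])" by auto
      then show ?thesis
      proof cases
        case 1
        have "\<not> joint k \<theta> (Y j ` set is)"
        proof (cases "is = []")
          case True
          then show ?thesis using Y(2)[of 0 "{}"] 1 by (auto simp: B_def)
        next
          case False
          have b: "\<forall>i\<in>set is. j < B \<and> i < B" using B[OF q, of j] 1(1) by auto
          moreover have "hd is \<in> set is" using False by simp
          ultimately have "j < B" "set is \<subseteq> {..<B}" by auto
          then show ?thesis using Y(2) 1 distinct_card by blast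
        qed
        then show ?thesis unfolding P col 1(1) by (simp add: image_image)
      next
        case 2
        have f: "f j < B" "j < B" if "j < J" for j using B[OF q, of j "f j"] 2 that by auto
        have "joint k \<theta> ((\<lambda>j. Y j (if j < J then f j else 0)) ` {..<B})"
          by (rule Y(3)) (use f in \<open>auto simp: B_def\<close>)
        then have "joint k \<theta> ((\<lambda>j. Y j (f j)) ` {..<J})"
          by (rule joint_mono) (use f in force)
        then show ?thesis unfolding P col 2(1) by (simp add: image_image lessThan_atLeast0)
      qed
    qed
    then show "\<exists>e. (\<forall>n. e n \<in> U) \<and> (\<forall>q\<in>X. P q (map e (idx q)))" using e by (intro exI[of _ e]) simp
  qed (rule that)
  define a where "a j i = map e (col (j, i))" for j i
  have "a j i \<in> tuples U n" for j i
    using e(1) by (auto simp: a_def col_def tuples_def)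
  moreover have "k_inconsistent C k \<theta> K (a j)" for j
    unfolding k_inconsistent_joint
  proof (intro allI impI)
    fix I :: "nat set" assume I: "finite I \<and> card I = K"
    have "(False, map (Pair j) (sorted_list_of_set I)) \<in> ?I"
      using I by (intro UnI1 CollectI exI[of _ j] exI[of _ "sorted_list_of_set I"]) simp
    from e(2)[OF this] show "\<not> joint k \<theta> (a j ` I)"
      unfolding P using I by (simp add: image_image a_def)
  qed
  moreover have "consistent C k (range (\<lambda>j. (\<theta>, a j (f j))))" for f
    unfolding consistent_def
  proof (intro allI impI)
    fix \<Delta> assume \<Delta>: "\<Delta> \<subseteq> range (\<lambda>j. (\<theta>, a j (f j)))" "finite \<Delta>"
    obtain F where F: "finite F" "\<Delta> = (\<lambda>j. (\<theta>, a j (f j))) ` F"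
      using finite_subset_image[OF \<Delta>(2,1)] by auto
    obtain J where J: "F \<subseteq> {..<J}" using F(1) finite_nat_set_iff_bounded[of F] by auto
    have "(True, map (\<lambda>j. (j, f j)) [0..<J]) \<in> ?I" by auto
    from e(2)[OF this] have "joint k \<theta> ((\<lambda>j. a j (f j)) ` {..<J})"
      unfolding P by (simp add: image_image a_def lessThan_atLeast0)
    then show "\<exists>x\<in>tuples U k. \<forall>(\<phi>, b)\<in>\<Delta>. holds C \<phi> (x @ b)"
      unfolding joint_def F(2) using J by auto
  qed
  ultimately show ?thesis unfolding NTP2_def using \<theta> by blast
qed

text \<open>Only the newest row has to be controlled: it is chosen over the finite set of all
  earlier entries so that each of its entries prolongs each good path. The two applications differ
  in the meaning of \<open>Good\<close>.\<close>

lemma not_NTP2_of_rows: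
  assumes \<theta>: "formula L (k + n) \<theta>"
    and Nil: "Good []"
    and joint: "\<And>gs. Good gs \<Longrightarrow> joint k \<theta> (set gs)"
    and row: "\<And>(N :: nat) A. finite A \<Longrightarrow> A \<subseteq> U \<Longrightarrow> \<exists>t. (\<forall>i. t i \<in> tuples U n) \<and>
      (\<forall>I\<subseteq>{..<N}. card I = K \<longrightarrow> \<not> joint k \<theta> (t ` I)) \<and>
      (\<forall>gs i. Good gs \<longrightarrow> set (concat gs) \<subseteq> A \<longrightarrow> i < N \<longrightarrow> Good (gs @ [t i]))"
  shows "\<not> NTP2 L C"
proof (rule not_NTP2_of_finite_arrays[OF \<theta>])
  fix J N :: nat
  have "\<exists>X. (\<forall>j i. X j i \<in> tuples U n) \<and>
      (\<forall>j<J. \<forall>I\<subseteq>{..<N}. card I = K \<longrightarrow> \<not> joint k \<theta> (X j ` I)) \<and>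
      (\<forall>f. (\<forall>j<J. f j < N) \<longrightarrow> Good (map (\<lambda>j. X j (f j)) [0..<J]))"
  proof (induction J)
    case 0
    have "tuples U n \<noteq> {}"
    proof -
      obtain u where "u \<in> U" using U_nonempty by auto
      then have "replicate n u \<in> tuples U n" by (auto simp: tuples_def)
      then show ?thesis by auto
    qed
    then show ?case using Nil by auto
  next
    case (Suc J)
    then obtain X where X: "\<And>j i. X j i \<in> tuples U n"
      "\<And>j I. j < J \<Longrightarrow> I \<subseteq> {..<N} \<Longrightarrow> card I = K \<Longrightarrow> \<not> joint k \<theta> (X j ` I)"
      "\<And>f. (\<And>j. j < J \<Longrightarrow> f j < N) \<Longrightarrow> Good (map (\<lambda>j. X j (f j)) [0..<J])" by auto
    let ?A = "\<Union>j<J. \<Union>i<N. set (X j i)"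
    have "finite ?A" by (intro finite_UN_I finite_lessThan finite_set)
    moreover have "?A \<subseteq> U" using X(1) by (auto simp: tuples_def)
    ultimately have "\<exists>t. (\<forall>i. t i \<in> tuples U n) \<and>
      (\<forall>I\<subseteq>{..<N}. card I = K \<longrightarrow> \<not> joint k \<theta> (t ` I)) \<and>
      (\<forall>gs i. Good gs \<longrightarrow> set (concat gs) \<subseteq> ?A \<longrightarrow> i < N \<longrightarrow> Good (gs @ [t i]))"
      by (rule row)
    then obtain t where t: "(\<forall>i. t i \<in> tuples U n) \<and>
      (\<forall>I\<subseteq>{..<N}. card I = K \<longrightarrow> \<not> joint k \<theta> (t ` I)) \<and>
      (\<forall>gs i. Good gs \<longrightarrow> set (concat gs) \<subseteq> ?A \<longrightarrow> i < N \<longrightarrow> Good (gs @ [t i]))" ..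
    note t = conjunct1[OF t] conjunct1[OF conjunct2[OF t]] conjunct2[OF conjunct2[OF t]]
    show ?case
    proof (intro exI[of _ "X(J := t)"] conjI allI impI)
      show "(X(J := t)) j i \<in> tuples U n" for j i using X(1) t(1) by simp
    next
      fix j I assume "j < Suc J" "I \<subseteq> {..<N}" "card I = K"
      then show "\<not> joint k \<theta> ((X(J := t)) j ` I)"
        using X(2)[of j I] t(2)[rule_format, of I] by (cases "j = J") auto
    next
      fix f assume f: "\<forall>j<Suc J. f j < N"
      have G: "Good (map (\<lambda>j. X j (f j)) [0..<J])" by (rule X(3)) (use f in auto)
      have "set (concat (map (\<lambda>j. X j (f j)) [0..<J])) \<subseteq> ?A" using f by fastforce
      then have "Good (map (\<lambda>j. X j (f j)) [0..<J] @ [t (f J)])"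
        using t(3)[rule_format, OF G, of "f J"] f by simp
      moreover have "map (\<lambda>j. (X(J := t)) j (f j)) [0..<Suc J] = map (\<lambda>j. X j (f j)) [0..<J] @ [t (f J)]"
        by simp
      ultimately show "Good (map (\<lambda>j. (X(J := t)) j (f j)) [0..<Suc J])" by (simp only:)
    qed
  qed
  then obtain X where X: "\<And>j i. X j i \<in> tuples U n"
      "\<And>j I. j < J \<Longrightarrow> I \<subseteq> {..<N} \<Longrightarrow> card I = K \<Longrightarrow> \<not> joint k \<theta> (X j ` I)"
      "\<And>f. (\<And>j. j < J \<Longrightarrow> f j < N) \<Longrightarrow> Good (map (\<lambda>j. X j (f j)) [0..<J])" by auto
  show "\<exists>X. (\<forall>j i. X j i \<in> tuples U n) \<and>
      (\<forall>j<J. \<forall>I\<subseteq>{..<N}. card I = K \<longrightarrow> \<not> joint k \<theta> (X j ` I)) \<and>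
      (\<forall>f. (\<forall>j<J. f j < N) \<longrightarrow> joint k \<theta> ((\<lambda>j. X j (f j)) ` {..<J}))"
  proof (intro exI[of _ X] conjI allI impI)
    fix f assume "\<forall>j<J. f j < N"
    then show "joint k \<theta> ((\<lambda>j. X j (f j)) ` {..<J})"
      using joint[OF X(3)[of f]] by (simp add: lessThan_atLeast0)
  qed (use X in auto)
qed

end

section \<open>Generic sequences for ultrafilters on a submodel\<close>

lemma subset_image_list: "set m \<subseteq> f ` A \<Longrightarrow> \<exists>m'. set m' \<subseteq> A \<and> m = map f m'"
proof (induction m)
  case (Cons x m)
  then obtain a m' where "a \<in> A" "x = f a" "set m' \<subseteq> A" "m = map f m'" by auto
  then show ?case by (intro exI[of _ "a # m'"]) auto
qed auto

context small_submodel
begin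

definition coheir :: "nat \<Rightarrow> 'a list filter \<Rightarrow> bool" where
  "coheir n R \<longleftrightarrow> ultra R \<and> eventually (\<lambda>y. y \<in> tuples M n) R"

lemma coheir_ultra: "coheir n R \<Longrightarrow> ultra R"
  by (simp add: coheir_def)

lemma coheir_U: "coheir n R \<Longrightarrow> eventually (\<lambda>y. y \<in> tuples U n) R"
  unfolding coheir_def using subsetD[OF tuples_mono[OF M_U]] by (auto elim!: eventually_mono)

lemma small_M_finite: "finite A \<Longrightarrow> |M \<union> A| <o \<kappa>"
  by (rule small_Un[OF M_small small_finite])

lemma coheir_realizes:
  assumes "coheir n R" "finite A" "A \<subseteq> U"
  obtains g where "g \<in> tuples U n" "realizes R (M \<union> A) g"
  using realizes_exists[OF coheir_ultra[OF assms(1)] coheir_U[OF assms(1)], of "M \<union> A"]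
    assms M_U small_M_finite by auto

text \<open>A Morley sequence in which every entry may follow a coheir of its own. The mixed form is
  needed in \<open>dividing_generic\<close>; from \<open>strict_generic\<close> on, all members of
  \<open>rs\<close> are equal.\<close>

inductive generic :: "nat \<Rightarrow> 'a list filter list \<Rightarrow> 'a list list \<Rightarrow> bool" for n where
  Nil: "generic n [] []"
| snoc: "generic n rs gs \<Longrightarrow> coheir n r \<Longrightarrow> g \<in> tuples U n \<Longrightarrow> realizes r (M \<union> set (concat gs)) g \<Longrightarrow>
    generic n (rs @ [r]) (gs @ [g])"

lemma generic_length: "generic n rs gs \<Longrightarrow> length gs = length rs"
  by (induction rule: generic.induct) auto

lemma generic_tuples: "generic n rs gs \<Longrightarrow> set gs \<subseteq> tuples U n"
  by (induction rule: generic.induct) auto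

lemma generic_concat: "generic n rs gs \<Longrightarrow> concat gs \<in> tuples U (length rs * n)"
  by (induction rule: generic.induct) (auto simp: tuples_def)

lemma generic_set: "generic n rs gs \<Longrightarrow> set (concat gs) \<subseteq> U"
  using generic_concat by (auto simp: tuples_def)

lemma generic_snocE:
  assumes "generic n (rs @ [r]) gs"
  obtains gs' g where "gs = gs' @ [g]" "generic n rs gs'" "coheir n r" "g \<in> tuples U n"
    "realizes r (M \<union> set (concat gs')) g"
  using assms by (cases rule: generic.cases) auto

lemma generic_exists:
  assumes "\<forall>r\<in>set rs. coheir n r"
  obtains gs where "generic n rs gs"
proof -
  have "\<exists>gs. generic n rs gs" using assms
  proof (induction rs rule: rev_induct)
    case Nil
    then show ?case using generic.Nil by auto
  next
    case (snoc r rs)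
    then obtain gs where gs: "generic n rs gs" by auto
    obtain g where "g \<in> tuples U n" "realizes r (M \<union> set (concat gs)) g"
      using coheir_realizes[of n r "set (concat gs)"] snoc.prems generic_set[OF gs] by auto
    then show ?case using generic.snoc[OF gs] snoc.prems by auto
  qed
  then show thesis using that by blast
qed

lemma realizes_append:
  assumes "realizes r (M \<union> set c) g" "coheir n r" "g \<in> tuples U n" "set c \<subseteq> U" "definable M (length c + n) P"
  shows "P (c @ g) \<longleftrightarrow> eventually (\<lambda>y. P (c @ y)) r"
proof -
  have "definable (M \<union> set c) n (\<lambda>y. P (c @ y))"
    by (rule definable_param_left) (use assms M_U in \<open>auto intro: definable_mono\<close>)
  then show ?thesis
    using realizes_iff[OF assms(1) coheir_ultra[OF assms(2)]] assms(3) by (simp add: tuples_length)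
qed

lemma definable_M_append:
  assumes "definable M (k + n) P" "y \<in> tuples M n"
  shows "definable M k (\<lambda>x. P (x @ y))"
  by (rule definable_param) (use assms M_U in \<open>auto simp: tuples_def\<close>)

text \<open>An ultrafilter on \<open>M\<close>-tuples yields an \<open>M\<close>-invariant global type.\<close>

lemma realizes_eq_type:
  assumes "eq_type M c c'" "coheir n r" "g \<in> tuples U n" "g' \<in> tuples U n" "set c \<subseteq> U" "set c' \<subseteq> U"
    "realizes r (M \<union> set c) g" "realizes r (M \<union> set c') g'"
  shows "eq_type M (c @ g) (c' @ g')"
proof -
  have l: "length c' = length c" "length g = n" "length g' = n"
    using assms by (auto simp: eq_type_length tuples_length)
  have "P (c @ g) \<longleftrightarrow> P (c' @ g')" if P: "definable M (length c + n) P" for P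
  proof -
    have "eventually (\<lambda>y. P (c @ y) \<longleftrightarrow> P (c' @ y)) r"
      using assms(2) unfolding coheir_def
      by (auto elim!: eventually_mono intro!: eq_typeD[OF assms(1) definable_M_append[OF P]])
    then have "eventually (\<lambda>y. P (c @ y)) r \<longleftrightarrow> eventually (\<lambda>y. P (c' @ y)) r"
      by (auto elim: eventually_elim2)
    then show ?thesis
      using realizes_append[OF assms(7,2,3,5) P] realizes_append[OF assms(8,2,4,6)] P l by simp
  qed
  then show ?thesis using l by (simp add: eq_type_def)
qed

text \<open>Invariance of each coheir over \<open>M\<close>, applied along the sequence.\<close>

lemma generic_unique: "generic n rs gs \<Longrightarrow> generic n rs gs' \<Longrightarrow> eq_type M (concat gs) (concat gs')"
proof (induction arbitrary: gs' rule: generic.induct)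
  case Nil
  then show ?case using generic_length[of n "[]" gs'] by (simp add: eq_type_refl)
next
  case (snoc rs gs r g)
  obtain hs h where h: "gs' = hs @ [h]" "generic n rs hs" "h \<in> tuples U n" "realizes r (M \<union> set (concat hs)) h"
    using generic_snocE[OF snoc.prems] by blast
  have "eq_type M (concat gs @ g) (concat hs @ h)"
    by (rule realizes_eq_type[OF snoc.IH[OF h(2)] snoc.hyps(2,3) h(3)])
      (use generic_set[OF snoc.hyps(1)] generic_set[OF h(2)] snoc.hyps(4) h(4) in auto)
  then show ?case using h(1) by simp
qed

text \<open>The ultrafilter concentrates on tuples of \<open>M\<close>, which \<sigma> fixes; so
  \<sigma> moves the parameters but not the type.\<close>

lemma realizes_Aut:
  assumes "Aut M \<sigma>" "coheir n r" "A \<subseteq> U" "g \<in> tuples U n" "realizes r (M \<union> A) g"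
  shows "realizes r (M \<union> \<sigma> ` A) (map \<sigma> g)"
  unfolding realizes_def
proof (intro allI impI)
  fix P assume P: "definable (M \<union> \<sigma> ` A) (length (map \<sigma> g)) P" "eventually P r"
  have "\<sigma> ` M = M" using assms(1) by (force simp: Aut_def)
  then have img: "M \<union> \<sigma> ` A = \<sigma> ` (M \<union> A)" by (simp add: image_Un)
  obtain \<phi> m' where m': "set m' \<subseteq> \<sigma> ` (M \<union> A)" "formula L (n + length m') \<phi>"
    "\<forall>x\<in>tuples U n. P x \<longleftrightarrow> holds C \<phi> (x @ m')"
    using P(1) tuples_length[OF assms(4)] unfolding img by (auto simp: definable_def)
  obtain m where m: "set m \<subseteq> M \<union> A" "m' = map \<sigma> m" using subset_image_list[OF m'(1)] by auto
  have \<phi>: "set m \<subseteq> M \<union> A" "formula L (n + length m) \<phi>"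
    "\<And>x. x \<in> tuples U n \<Longrightarrow> P x \<longleftrightarrow> holds C \<phi> (x @ map \<sigma> m)"
    using m m' by auto
  have m: "m \<in> tuples U (length m)" using \<phi>(1) assms(3) M_U by (auto simp: tuples_def)
  have \<sigma>: "automorphism L C \<sigma>" using assms(1) by (simp add: Aut_def)
  have move: "holds C \<phi> (map \<sigma> y @ map \<sigma> m) \<longleftrightarrow> holds C \<phi> (y @ m)" if "y \<in> tuples U n" for y
    using automorphism_holds[OF \<sigma> tuples_append[OF that m] \<phi>(2)] by simp
  have "eventually (\<lambda>y. holds C \<phi> (y @ m)) r"
    using P(2) assms(2)[unfolded coheir_def, THEN conjunct2]
  proof eventually_elim
    case (elim y)
    have y: "y \<in> tuples U n" "map \<sigma> y = y"
      using elim(2) M_U Aut_fix[OF assms(1), of y] by (auto simp: tuples_def)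
    then show ?case using elim(1) \<phi>(3)[OF y(1)] move[OF y(1)] by simp
  qed
  moreover have "definable (M \<union> A) n (\<lambda>y. holds C \<phi> (y @ m))"
    using \<phi>(2,1) by (rule definable_holds)
  ultimately have "holds C \<phi> (g @ m)"
    using realizesD[OF assms(5)] assms(4) by (auto simp: tuples_length)
  then show "P (map \<sigma> g)" using move[OF assms(4)] \<phi>(3) Aut_tuples[OF assms(1,4)] by simp
qed

lemma generic_Aut: "generic n rs gs \<Longrightarrow> Aut M \<sigma> \<Longrightarrow> generic n rs (map (map \<sigma>) gs)"
proof (induction rule: generic.induct)
  case Nil
  then show ?case by (simp add: generic.Nil)
next
  case (snoc rs gs r g)
  have "realizes r (M \<union> \<sigma> ` set (concat gs)) (map \<sigma> g)"
    by (rule realizes_Aut[OF snoc.prems snoc.hyps(2) generic_set[OF snoc.hyps(1)] snoc.hyps(3,4)])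
  moreover have "\<sigma> ` set (concat gs) = set (concat (map (map \<sigma>) gs))" by auto
  ultimately have "generic n (rs @ [r]) (map (map \<sigma>) gs @ [map \<sigma> g])"
    using snoc Aut_tuples by (intro generic.snoc) auto
  then show ?case by simp
qed

section \<open>Coheirs of the type of a given tuple\<close>

definition extends_tp :: "'a list \<Rightarrow> 'a list filter \<Rightarrow> bool" where
  "extends_tp a R \<longleftrightarrow> coheir (length a) R \<and> (\<forall>P. definable M (length a) P \<longrightarrow> P a \<longrightarrow> eventually P R)"

text \<open>By \<open>M_witness\<close> the type of \<open>a\<close> over \<open>M\<close> is
  finitely satisfiable in \<open>M\<close>.\<close>

lemma coheir_extension:
  assumes "a \<in> tuples U n"
  obtains R where "extends_tp a R"
proof -
  have len: "length a = n" using assms by (simp add: tuples_length)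
  let ?\<P> = "insert (\<lambda>y. y \<in> tuples M n) {P. definable M n P \<and> P a}"
  obtain R where R: "ultra R" "\<And>P. P \<in> ?\<P> \<Longrightarrow> eventually P R"
  proof (rule ultrafilter_fip)
    fix X assume X: "finite X" "X \<subseteq> ?\<P>"
    let ?Y = "X - {\<lambda>y. y \<in> tuples M n}"
    have "definable M n (\<lambda>y. \<forall>P\<in>?Y. P y)" by (intro definable_ball) (use X in auto)
    moreover have "\<forall>P\<in>?Y. P a" using X by auto
    ultimately obtain y where "y \<in> tuples M n" "\<forall>P\<in>?Y. P y"
      by (rule M_witness[OF _ assms])
    then show "\<exists>y. \<forall>P\<in>X. P y" by (intro exI[of _ y]) auto
  qed (rule that)
  have "extends_tp a R" using R len by (auto simp: extends_tp_def coheir_def)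
  then show thesis by (rule that)
qed

lemma realizes_extends_tp:
  assumes "extends_tp a R" "g \<in> tuples U (length a)" "realizes R (M \<union> A) g"
  shows "eq_type M a g"
proof -
  have R: "coheir (length a) R" "\<And>P. definable M (length a) P \<Longrightarrow> P a \<Longrightarrow> eventually P R"
    using assms(1) by (auto simp: extends_tp_def)
  have g: "realizes R M g" using assms(3) by (rule realizes_mono) simp
  have "P a = P g" if P: "definable M (length a) P" for P
    using R(2)[OF P] R(2)[OF definable_not[OF P]] ultra_not[OF coheir_ultra[OF R(1)], of P]
      realizes_iff[OF g coheir_ultra[OF R(1)] P] assms(2) by (auto simp: tuples_length)
  then show ?thesis using assms(2) by (simp add: eq_type_def tuples_length)
qed

lemma generic_extends_tp:
  assumes "generic (length a) rs gs" "\<forall>r\<in>set rs. extends_tp a r" "g \<in> set gs"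
  shows "eq_type M a g"
  using assms by (induction rule: generic.induct) (auto intro: realizes_extends_tp)

text \<open>A coheir of a long tuple thus induces coheirs of its blocks, which is how
  \<open>dividing_generic\<close> obtains its rows.\<close>

lemma coheir_filtermap:
  assumes "coheir n R" "coord_map n k f"
  shows "coheir k (filtermap f R)"
  using assms coord_map_tuples[OF assms(2)] unfolding coheir_def
  by (auto simp: eventually_filtermap ultra_filtermap elim: eventually_mono)

lemma realizes_filtermap:
  assumes "coheir n R" "coord_map n k f" "g \<in> tuples U n" "realizes R A g"
  shows "realizes (filtermap f R) A (f g)"
  unfolding realizes_def
proof (intro allI impI)
  fix P assume P: "definable A (length (f g)) P" "eventually P (filtermap f R)"
  have "length (f g) = k" using coord_map_tuples[OF assms(2,3)] by (simp add: tuples_length)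
  then have "definable A n (\<lambda>x. P (f x))" using P(1) assms(2) by (auto intro: definable_coord_map)
  then show "P (f g)"
    using realizesD[OF assms(4)] P(2) assms(3) by (auto simp: eventually_filtermap tuples_length)
qed

lemma extends_tp_filtermap:
  assumes "extends_tp a R" "coord_map (length a) k f"
  shows "extends_tp (f a) (filtermap f R)"
proof -
  have l: "length (f a) = k" using assms(2) by (auto simp: coord_map_def)
  show ?thesis
    using assms coheir_filtermap[OF _ assms(2)] definable_coord_map[OF _ assms(2)] l
    by (auto simp: extends_tp_def eventually_filtermap)
qed

lemma extends_tp_eq_type: "extends_tp a R \<Longrightarrow> eq_type M a b \<Longrightarrow> extends_tp b R"
  unfolding extends_tp_def eq_type_def by metis

end

section \<open>Dividing in NTP2 theories\<close>

context small_submodel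
begin

lemma M_tuples_U: "y \<in> tuples M n \<Longrightarrow> y \<in> tuples U n"
  using tuples_mono[OF M_U] by auto

lemma set_M_tuples: "set m \<subseteq> M \<Longrightarrow> m \<in> tuples U (length m)"
  using M_U by (auto simp: tuples_def)

lemma Aut_holds:
  assumes "Aut M \<sigma>" "formula L (k + (n + length m)) \<theta>" "w \<in> tuples U k" "z \<in> tuples U n" "set m \<subseteq> M"
  shows "holds C \<theta> (map \<sigma> w @ map \<sigma> z @ m) \<longleftrightarrow> holds C \<theta> (w @ z @ m)"
proof -
  have "holds C \<theta> (map \<sigma> (w @ z @ m)) \<longleftrightarrow> holds C \<theta> (w @ z @ m)"
    by (rule automorphism_holds[of \<sigma> _ "k + (n + length m)"])
      (use assms set_M_tuples[OF assms(5)] in \<open>auto simp: Aut_def intro!: tuples_append\<close>)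
  then show ?thesis using Aut_fix[OF assms(1,5)] by simp
qed

text \<open>The common solution is pulled back through the inverse bijection, so that only \<sigma>
  itself has to be an automorphism.\<close>

lemma joint_Aut:
  assumes "Aut M \<sigma>" "formula L (k + (n + length m)) \<theta>" "Z \<subseteq> tuples U n" "set m \<subseteq> M"
    "joint k \<theta> ((\<lambda>z. z @ m) ` map \<sigma> ` Z)"
  shows "joint k \<theta> ((\<lambda>z. z @ m) ` Z)"
proof -
  obtain w where w: "w \<in> tuples U k" "\<forall>z\<in>Z. holds C \<theta> (w @ map \<sigma> z @ m)"
    using assms(5) by (auto simp: joint_def)
  let ?w = "map (inv_into U \<sigma>) w"
  have w': "map \<sigma> ?w = w" "?w \<in> tuples U k"
    using map_inv_into_tuples[OF Aut_bij[OF assms(1)] w(1)] by auto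
  have "holds C \<theta> (?w @ z @ m)" if "z \<in> Z" for z
    using Aut_holds[OF assms(1,2) w'(2) _ assms(4), of z] w(2) w'(1) that assms(3) by auto
  then show ?thesis using w'(2) by (auto simp: joint_def)
qed

lemma generic_move:
  assumes "generic n rs gs" "generic n rs gs'"
  obtains \<sigma> where "Aut M \<sigma>" "gs' = map (map \<sigma>) gs"
proof -
  have U: "concat gs \<in> tuples U (length rs * n)" "concat gs' \<in> tuples U (length rs * n)"
    using assms generic_concat by auto
  obtain \<sigma> where \<sigma>: "Aut M \<sigma>" "map \<sigma> (concat gs) = concat gs'"
    using eq_type_Aut[OF M_U M_small U generic_unique[OF assms]] by auto
  have l: "length gs = length rs" "length gs' = length rs" using assms generic_length by auto
  have n: "\<And>g. g \<in> set gs \<Longrightarrow> length g = n" "\<And>g. g \<in> set gs' \<Longrightarrow> length g = n"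
    using generic_tuples[OF assms(1)] generic_tuples[OF assms(2)] by (auto simp: tuples_def)
  have "map (map \<sigma>) gs = chop n (length (map (map \<sigma>) gs)) (concat (map (map \<sigma>) gs))"
    by (rule chop_concat[symmetric]) (use n in auto)
  also have "\<dots> = chop n (length gs') (concat gs')"
    using \<sigma>(2) l by (simp add: map_concat)
  also have "\<dots> = gs'" by (rule chop_concat) (use n in auto)
  finally show thesis using that \<sigma>(1) by auto
qed

text \<open>Generic sequences for the same coheirs are conjugate over \<open>M\<close>, so
  consistency along them depends on \<open>rs\<close> alone.\<close>

lemma joint_generic:
  assumes "generic n rs gs" "generic n rs gs'" "formula L (k + (n + length m)) \<theta>" "set m \<subseteq> M"
    "joint k \<theta> ((\<lambda>z. z @ m) ` set gs)"
  shows "joint k \<theta> ((\<lambda>z. z @ m) ` set gs')"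
proof -
  obtain \<sigma> where \<sigma>: "Aut M \<sigma>" "gs = map (map \<sigma>) gs'" using generic_move[OF assms(2,1)] by auto
  show ?thesis
    by (rule joint_Aut[OF \<sigma>(1) assms(3) generic_tuples[OF assms(2)] assms(4)]) (use assms(5) \<sigma>(2) in simp)
qed

lemma eq_type_append_M:
  assumes "eq_type M a b" "set m \<subseteq> M"
  shows "eq_type M (a @ m) (b @ m)"
proof -
  have "P (a @ m) \<longleftrightarrow> P (b @ m)" if "definable M (length a + length m) P" for P
    using eq_typeD[OF assms(1) definable_param[OF that assms(2) M_U]] by simp
  then show ?thesis using eq_type_length[OF assms(1)] by (auto simp: eq_type_def)
qed

lemma eq_type_append_ME:
  assumes "eq_type M (a @ m) s" "set m \<subseteq> M" "s \<in> tuples U (n + length m)" "a \<in> tuples U n"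
  obtains t where "s = t @ m" "t \<in> tuples U n" "eq_type M a t"
proof -
  have am: "a @ m \<in> tuples U (n + length m)" using assms(4) set_M_tuples[OF assms(2)] by (rule tuples_append)
  obtain \<sigma> where \<sigma>: "Aut M \<sigma>" "map \<sigma> (a @ m) = s"
    using eq_type_Aut[OF M_U M_small am assms(3,1)] by auto
  show thesis
    by (rule that[of "map \<sigma> a"])
      (use \<sigma> Aut_fix[OF \<sigma>(1) assms(2)] Aut_tuples[OF \<sigma>(1) assms(4)] Aut_eq_type[OF \<sigma>(1) M_U assms(4)] in auto)
qed

text \<open>Otherwise all generic sequences of coheirs of tp(a/M) are consistent and can serve as
  the paths of an array. The first \<open>N\<close> terms of a dividing sequence are taken as one
  tuple, and a coheir of it is realized over the earlier rows: every block of the realization then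
  realizes a coheir of tp(a/M) over them. These coheirs vary with the block, whence the arbitrary
  list \<open>rs\<close>.\<close>

lemma dividing_generic:
  assumes NTP2: "NTP2 L C" and a: "a \<in> tuples U n" and m: "set m \<subseteq> M"
    and \<theta>: "formula L (k + (n + length m)) \<theta>" and div: "divides_over L C k M (\<theta>, a @ m)"
  shows "\<exists>rs gs. (\<forall>r\<in>set rs. extends_tp a r) \<and> generic n rs gs \<and> \<not> joint k \<theta> ((\<lambda>z. z @ m) ` set gs)"
proof (rule ccontr)
  assume neg: "\<not> ?thesis"
  have all_joint: "joint k \<theta> ((\<lambda>z. z @ m) ` set gs)"
    if "\<forall>r\<in>set rs. extends_tp a r" "generic n rs gs" for rs gs
    using neg that by blast
  have la: "length a = n" using a by (simp add: tuples_length)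
  obtain K s where s: "\<And>i. s i \<in> tuples U (length (a @ m))" "\<And>i. tp L C (s i) M = tp L C (a @ m) M"
    "k_inconsistent C k \<theta> K s"
    using div by (auto simp: divides_over_def)
  have am: "a @ m \<in> tuples U (n + length m)" using a set_M_tuples[OF m] by (rule tuples_append)
  have "\<exists>t. s i = t @ m \<and> t \<in> tuples U n \<and> eq_type M a t" for i
  proof -
    have si: "s i \<in> tuples U (n + length m)" using s(1)[of i] la by simp
    have "eq_type M (a @ m) (s i)" using tp_eq_iff[OF am si, of M] s(2) by auto
    from eq_type_append_ME[OF this m si a] show ?thesis by blast
  qed
  then obtain t where t: "\<And>i. s i = t i @ m" "\<And>i. t i \<in> tuples U n" "\<And>i. eq_type M a (t i)" by metis
  define Good where "Good gs \<longleftrightarrow> (\<exists>rs hs. gs = map (\<lambda>h. h @ m) hs \<and> (\<forall>r\<in>set rs. extends_tp a r) \<and> generic n rs hs)" for gs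
  have "\<not> NTP2 L C"
  proof (rule not_NTP2_of_rows[of k "n + length m" \<theta> Good K])
    show "formula L (k + (n + length m)) \<theta>" by (rule \<theta>)
    show "Good []" unfolding Good_def by (intro exI[of _ "[]"]) (auto intro: generic.Nil)
    show "joint k \<theta> (set gs)" if "Good gs" for gs
      using that all_joint by (auto simp: Good_def)
  next
    fix N :: nat and A assume A: "finite A" "A \<subseteq> U"
    define blk where "blk i x = take n (drop (i * n) x)" for i and x :: "'a list"
    let ?z = "concat (map t [0..<N])"
    have zl: "length ?z = N * n"
      using tuples_length[OF t(2)] by (simp add: length_concat comp_def sum_list_triv)
    then have z: "?z \<in> tuples U (N * n)" using t(2) by (auto simp: tuples_def)
    have cm: "coord_map (N * n) n (blk i)" if "i < N" for i
    proof -
      have "Suc i * n \<le> N * n" using that by (intro mult_le_mono1) simp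
      then show ?thesis unfolding blk_def by (intro coord_map_slice[OF coord_map_id]) simp
    qed
    have zt: "blk i ?z = t i" if "i < N" for i
    proof -
      have "chop n (length (map t [0..<N])) ?z = map t [0..<N]"
        by (rule chop_concat) (use tuples_length[OF t(2)] in auto)
      then have "chop n N ?z ! i = t i" using that by simp
      then show ?thesis using that by (simp add: chop_def blk_def)
    qed
    obtain R where R: "extends_tp ?z R" using coheir_extension[OF z] by auto
    then have cR: "coheir (N * n) R" using zl by (simp add: extends_tp_def)
    obtain x where x: "x \<in> tuples U (N * n)" "realizes R (M \<union> A) x"
      using coheir_realizes[OF cR A] by auto
    \<comment> \<open>The realization is conjugate over \<open>M\<close> to the original terms,
      hence equally inconsistent.\<close>
    have "eq_type M ?z x" using realizes_extends_tp[OF R _ x(2)] x(1) zl by simp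
    then obtain \<sigma> where \<sigma>: "Aut M \<sigma>" "map \<sigma> ?z = x" using eq_type_Aut[OF M_U M_small z x(1)] by auto
    have xt: "blk i x = map \<sigma> (t i)" if "i < N" for i
      using coord_map_map[OF cm[OF that], of ?z \<sigma>] zl zt[OF that] \<sigma>(2) by simp
    define ts where "ts i = map \<sigma> (t i) @ m" for i
    have ts: "ts i \<in> tuples U (n + length m)" for i
      unfolding ts_def using Aut_tuples[OF \<sigma>(1) t(2)] set_M_tuples[OF m] by (rule tuples_append)
    moreover have "\<not> joint k \<theta> (ts ` I)" if I: "I \<subseteq> {..<N}" "card I = K" for I
    proof
      assume "joint k \<theta> (ts ` I)"
      then have "joint k \<theta> ((\<lambda>z. z @ m) ` map \<sigma> ` t ` I)" by (simp add: image_image ts_def)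
      then have "joint k \<theta> ((\<lambda>z. z @ m) ` t ` I)"
        by (rule joint_Aut[OF \<sigma>(1) \<theta> _ m, rotated]) (use t(2) in auto)
      moreover have "(\<lambda>z. z @ m) ` t ` I = s ` I" by (simp add: image_image t(1))
      moreover have "finite I" using I(1) finite_subset by blast
      ultimately show False using s(3) I(2) unfolding k_inconsistent_joint by auto
    qed
    moreover have "Good (gs @ [ts i])" if gs: "Good gs" "set (concat gs) \<subseteq> A" "i < N" for gs i
    proof -
      obtain rs hs where hs: "gs = map (\<lambda>h. h @ m) hs" "\<forall>r\<in>set rs. extends_tp a r" "generic n rs hs"
        using gs(1) by (auto simp: Good_def)
      let ?r = "filtermap (blk i) R"
      have "set (concat hs) \<subseteq> A" using gs(2) hs(1) by (cases "hs = []") auto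
      then have "realizes ?r (M \<union> set (concat hs)) (blk i x)"
        using realizes_filtermap[OF cR cm[OF gs(3)] x] by (auto intro: realizes_mono)
      then have "generic n (rs @ [?r]) (hs @ [blk i x])"
        using hs(3) coheir_filtermap[OF cR cm[OF gs(3)]] coord_map_tuples[OF cm[OF gs(3)] x(1)]
        by (intro generic.snoc)
      moreover have "extends_tp a ?r"
        using extends_tp_filtermap[OF R, of n "blk i"] cm[OF gs(3)] zl zt[OF gs(3)] t(3)
        by (auto intro: extends_tp_eq_type eq_type_sym)
      moreover have "gs @ [ts i] = map (\<lambda>h. h @ m) (hs @ [blk i x])"
        using hs(1) xt[OF gs(3)] by (simp add: ts_def)
      ultimately show ?thesis unfolding Good_def using hs(2)
        by (intro exI[of _ "rs @ [?r]"] exI[of _ "hs @ [blk i x]"]) simp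
    qed
    ultimately show "\<exists>t. (\<forall>i. t i \<in> tuples U (n + length m)) \<and>
      (\<forall>I\<subseteq>{..<N}. card I = K \<longrightarrow> \<not> joint k \<theta> (t ` I)) \<and>
      (\<forall>gs i. Good gs \<longrightarrow> set (concat gs) \<subseteq> A \<longrightarrow> i < N \<longrightarrow> Good (gs @ [t i]))"
      by (intro exI[of _ ts]) simp
  qed
  with NTP2 show False by simp
qed

section \<open>The broom lemma\<close>

text \<open>For finite \<open>F\<close>, this is the consistency of the conjunction over \<open>g \<in> F\<close> of the disjunctions
  \<open>\<theta>\<^sub>1(w\<^sub>1,g,m\<^sub>1) \<or> \<dots> \<or> \<theta>\<^sub>t(w\<^sub>t,g,m\<^sub>t)\<close>, each \<open>\<theta>\<^sub>i\<close> having its own tuple \<open>w\<^sub>i\<close> of \<open>k\<^sub>i\<close> variables.\<close>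

fun covered :: "(('f, 'r) fm \<times> nat \<times> 'a list) list \<Rightarrow> 'a list set \<Rightarrow> bool" where
  "covered [] F \<longleftrightarrow> F = {}"
| "covered ((\<theta>, k, m) # \<Theta>) F \<longleftrightarrow> (\<exists>G\<subseteq>F. joint k \<theta> ((\<lambda>z. z @ m) ` G) \<and> covered \<Theta> (F - G))"

lemma covered_mono: "covered \<Theta> F \<Longrightarrow> F' \<subseteq> F \<Longrightarrow> covered \<Theta> F'"
proof (induction \<Theta> arbitrary: F F')
  case (Cons q \<Theta>)
  obtain \<theta> k m where q: "q = (\<theta>, k, m)" by (cases q)
  obtain G where G: "G \<subseteq> F" "joint k \<theta> ((\<lambda>z. z @ m) ` G)" "covered \<Theta> (F - G)"
    using Cons.prems(1) by (auto simp: q)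
  have "joint k \<theta> ((\<lambda>z. z @ m) ` (G \<inter> F'))" using G(2) by (rule joint_mono) auto
  moreover have "covered \<Theta> (F' - G \<inter> F')"
    by (rule Cons.IH[OF G(3)]) (use Cons.prems(2) in auto)
  ultimately show ?case unfolding q covered.simps by (intro exI[of _ "G \<inter> F'"]) simp
qed auto

definition params :: "nat \<Rightarrow> (('f, 'r) fm \<times> nat \<times> 'a list) list \<Rightarrow> bool" where
  "params n \<Theta> \<longleftrightarrow> (\<forall>(\<theta>, k, m)\<in>set \<Theta>. set m \<subseteq> M \<and> formula L (k + (n + length m)) \<theta>)"

lemma covered_Aut:
  "Aut M \<sigma> \<Longrightarrow> params n \<Theta> \<Longrightarrow> F \<subseteq> tuples U n \<Longrightarrow> covered \<Theta> (map \<sigma> ` F) \<Longrightarrow> covered \<Theta> F"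
proof (induction \<Theta> arbitrary: F)
  case (Cons q \<Theta>)
  obtain \<theta> k m where q: "q = (\<theta>, k, m)" by (cases q)
  have p: "set m \<subseteq> M" "formula L (k + (n + length m)) \<theta>" "params n \<Theta>"
    using Cons.prems(2) by (auto simp: params_def q)
  obtain G where G: "G \<subseteq> map \<sigma> ` F" "joint k \<theta> ((\<lambda>z. z @ m) ` G)" "covered \<Theta> (map \<sigma> ` F - G)"
    using Cons.prems(4) by (auto simp: q)
  let ?G = "{z \<in> F. map \<sigma> z \<in> G}"
  have "(\<lambda>z. z @ m) ` map \<sigma> ` ?G \<subseteq> (\<lambda>z. z @ m) ` G" by auto
  then have "joint k \<theta> ((\<lambda>z. z @ m) ` map \<sigma> ` ?G)" by (rule joint_mono[OF G(2)])
  then have "joint k \<theta> ((\<lambda>z. z @ m) ` ?G)"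
    by (rule joint_Aut[OF Cons.prems(1) p(2) _ p(1), rotated]) (use Cons.prems(3) in auto)
  moreover have "covered \<Theta> (map \<sigma> ` (F - ?G))" by (rule covered_mono[OF G(3)]) auto
  then have "covered \<Theta> (F - ?G)" by (rule Cons.IH[OF Cons.prems(1) p(3), rotated]) (use Cons.prems(3) in auto)
  ultimately show ?case unfolding q covered.simps by (intro exI[of _ ?G]) simp
qed auto

text \<open>Induction on the list. Let \<open>F\<close> be uncovered by the tail, and let the head
  \<theta> be inconsistent along generic sequences for \<open>rs\<close>. A finite set of conjugates
  is grown with this property: if one tuple satisfies \<theta> at all of \<open>H\<close> and the
  tail covers the rest, then \<open>H\<close> contains a generic sequence for an initial part of
  \<open>rs\<close>. For the whole of \<open>rs\<close> this is absurd.\<close>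

lemma broom:
  assumes NTP2: "NTP2 L C" and a: "a \<in> tuples U n"
  shows "params n \<Theta> \<Longrightarrow> (\<forall>(\<theta>, k, m)\<in>set \<Theta>. divides_over L C k M (\<theta>, a @ m)) \<Longrightarrow>
    \<exists>F. finite F \<and> F \<subseteq> {g \<in> tuples U n. eq_type M a g} \<and> \<not> covered \<Theta> F"
proof (induction \<Theta>)
  case Nil
  then show ?case using a by (intro exI[of _ "{a}"]) (auto simp: eq_type_refl)
next
  case (Cons q \<Theta>)
  obtain \<theta> k m where q: "q = (\<theta>, k, m)" by (cases q)
  have m: "set m \<subseteq> M" and \<theta>: "formula L (k + (n + length m)) \<theta>" and \<Theta>: "params n \<Theta>"
    and div: "divides_over L C k M (\<theta>, a @ m)"
    using Cons.prems by (auto simp: params_def q)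
  have "\<forall>(\<theta>, k, m)\<in>set \<Theta>. divides_over L C k M (\<theta>, a @ m)" using Cons.prems(2) by auto
  then obtain F where F: "finite F" "F \<subseteq> {g \<in> tuples U n. eq_type M a g}" "\<not> covered \<Theta> F"
    using Cons.IH[OF \<Theta>] by auto
  obtain rs gs0 where rs: "\<forall>r\<in>set rs. extends_tp a r" "generic n rs gs0"
    "\<not> joint k \<theta> ((\<lambda>z. z @ m) ` set gs0)"
    using dividing_generic[OF NTP2 a m \<theta> div] by auto
  have la: "length a = n" using a by (simp add: tuples_length)
  define good where "good l G \<longleftrightarrow> finite G \<and> G \<subseteq> {g \<in> tuples U n. eq_type M a g} \<and>
      (\<forall>w\<in>tuples U k. \<forall>H\<subseteq>G. (\<forall>z\<in>H. holds C \<theta> (w @ z @ m)) \<longrightarrow> covered \<Theta> (G - H) \<longrightarrow>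
        (\<exists>gs. set gs \<subseteq> H \<and> generic n (take l rs) gs))" for l G
  have goodD: "\<exists>gs. set gs \<subseteq> H \<and> generic n (take l rs) gs"
    if "good l G" "w \<in> tuples U k" "H \<subseteq> G" "\<forall>z\<in>H. holds C \<theta> (w @ z @ m)" "covered \<Theta> (G - H)" for l G w H
    using that(1)[unfolded good_def, THEN conjunct2, THEN conjunct2, rule_format, OF that(2,3)] that(4,5)
    by simp
  have "\<exists>G. good l G" if "l \<le> length rs" for l
    using that
  proof (induction l)
    case 0
    have "good 0 {}" unfolding good_def
      by (auto intro!: exI[of _ "[]"] generic.Nil)
    then show ?case ..
  next
    case (Suc l)
    then have "\<exists>G. good l G" by simp
    then obtain G where good: "good l G" ..
    then have G: "finite G" "G \<subseteq> {g \<in> tuples U n. eq_type M a g}" by (auto simp: good_def)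
    define r where "r = rs ! l"
    have r: "extends_tp a r" "take (Suc l) rs = take l rs @ [r]"
      using rs(1) Suc.prems by (auto simp: r_def take_Suc_conv_app_nth)
    then have cr: "coheir n r" by (simp add: extends_tp_def la)
    let ?A = "\<Union>z\<in>G. set z"
    have "finite ?A" "?A \<subseteq> U" using G(1,2) by (auto simp: tuples_def)
    then obtain g where g: "g \<in> tuples U n" "realizes r (M \<union> ?A) g"
      by (rule coheir_realizes[OF cr])
    have ag: "eq_type M a g" using realizes_extends_tp[OF r(1) _ g(2)] g(1) la by simp
    have "\<exists>\<sigma>. Aut M \<sigma> \<and> map \<sigma> g = j" if "j \<in> F" for j
    proof -
      have j: "j \<in> tuples U n" "eq_type M a j" using F(2) that by auto
      show ?thesis using eq_type_Aut[OF M_U M_small g(1) j(1) eq_type_trans[OF eq_type_sym[OF ag] j(2)]] by blast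
    qed
    then obtain \<sigma> where \<sigma>: "\<And>j. j \<in> F \<Longrightarrow> Aut M (\<sigma> j)" "\<And>j. j \<in> F \<Longrightarrow> map (\<sigma> j) g = j" by metis
    \<comment> \<open>For each \<open>j\<close> in \<open>F\<close>, a copy of the previous set
      together with a new generic element \<open>g\<close>, moved so that \<open>g\<close> becomes
      \<open>j\<close>.\<close>
    define G' where "G' = (\<Union>j\<in>F. map (\<sigma> j) ` insert g G)"
    have fin: "finite G'" using F(1) G(1) by (simp add: G'_def)
    have sub: "G' \<subseteq> {g \<in> tuples U n. eq_type M a g}"
    proof
      fix y assume "y \<in> G'"
      then obtain j z where jz: "j \<in> F" "z \<in> insert g G" "y = map (\<sigma> j) z" by (auto simp: G'_def)
      have z: "z \<in> tuples U n" "eq_type M a z" using jz(2) G(2) g(1) ag by auto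
      show "y \<in> {g \<in> tuples U n. eq_type M a g}"
        using Aut_tuples[OF \<sigma>(1)[OF jz(1)] z(1)] eq_type_trans[OF z(2) Aut_eq_type[OF \<sigma>(1)[OF jz(1)] M_U z(1)]]
        by (simp add: jz(3))
    qed
    have path: "\<exists>gs. set gs \<subseteq> H \<and> generic n (take (Suc l) rs) gs"
      if w: "w \<in> tuples U k" and H: "H \<subseteq> G'" "\<forall>z\<in>H. holds C \<theta> (w @ z @ m)" "covered \<Theta> (G' - H)" for w H
    proof -
      \<comment> \<open>The tail cannot cover \<open>F\<close>, so some \<open>j\<close> in
        \<open>F\<close> is left to \<theta>; the argument continues in the copy belonging to that
        \<open>j\<close>.\<close>
      have "\<not> F \<subseteq> G' - H" using covered_mono[OF H(3)] F(3) by blast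
      moreover have "F \<subseteq> G'"
      proof
        fix j assume "j \<in> F"
        then show "j \<in> G'" using \<sigma>(2)[of j] by (auto simp: G'_def intro!: bexI[of _ j])
      qed
      ultimately obtain j where j: "j \<in> F" "j \<in> H" by auto
      let ?\<tau> = "\<sigma> j"
      let ?w = "map (inv_into U ?\<tau>) w"
      have \<tau>: "Aut M ?\<tau>" using \<sigma>(1) j(1) .
      have w': "map ?\<tau> ?w = w" "?w \<in> tuples U k"
        using map_inv_into_tuples[OF Aut_bij[OF \<tau>] w] by auto
      let ?H = "{z \<in> G. map ?\<tau> z \<in> H}"
      have "holds C \<theta> (?w @ z @ m)" if "z \<in> ?H" for z
        using Aut_holds[OF \<tau> \<theta> w'(2) _ m, of z] H(2) w'(1) that G(2) by auto
      moreover have "covered \<Theta> (map ?\<tau> ` (G - ?H))"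
        by (rule covered_mono[OF H(3)]) (use j(1) in \<open>auto simp: G'_def\<close>)
      then have "covered \<Theta> (G - ?H)"
        by (rule covered_Aut[OF \<tau> \<Theta>, rotated]) (use G(2) in auto)
      ultimately obtain gs where gs: "set gs \<subseteq> ?H" "generic n (take l rs) gs"
        using goodD[OF good w'(2), of ?H] by auto
      \<comment> \<open>\<open>g\<close> was chosen generic over all of \<open>G\<close>, hence over
        whichever sequence \<open>gs\<close> the copy yields.\<close>
      have "set (concat gs) \<subseteq> ?A" using gs(1) by auto
      then have "realizes r (M \<union> set (concat gs)) g"
        by (intro realizes_mono[OF g(2)]) auto
      then have "generic n (take (Suc l) rs) (gs @ [g])"
        unfolding r(2) using gs(2) cr g(1) by (intro generic.snoc)
      then have "generic n (take (Suc l) rs) (map (map ?\<tau>) (gs @ [g]))" using \<tau> by (rule generic_Aut)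
      moreover have "set (map (map ?\<tau>) (gs @ [g])) \<subseteq> H" using gs(1) \<sigma>(2)[OF j(1)] j(2) by auto
      ultimately show ?thesis by blast
    qed
    have "good (Suc l) G'" unfolding good_def
    proof (intro conjI ballI allI impI)
      fix w H assume "w \<in> tuples U k" "H \<subseteq> G'" "\<forall>z\<in>H. holds C \<theta> (w @ z @ m)" "covered \<Theta> (G' - H)"
      then show "\<exists>gs. set gs \<subseteq> H \<and> generic n (take (Suc l) rs) gs" by (rule path)
    qed (rule fin, rule sub)
    then show ?case ..
  qed
  from this[OF order_refl] obtain G where good: "good (length rs) G" ..
  then have G: "finite G" "G \<subseteq> {g \<in> tuples U n. eq_type M a g}" by (auto simp: good_def)
  have "\<not> covered (q # \<Theta>) G"
  proof
    assume "covered (q # \<Theta>) G"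
    then obtain H where H: "H \<subseteq> G" "joint k \<theta> ((\<lambda>z. z @ m) ` H)" "covered \<Theta> (G - H)" by (auto simp: q)
    then obtain w where w: "w \<in> tuples U k" "\<forall>z\<in>H. holds C \<theta> (w @ z @ m)" by (auto simp: joint_def)
    obtain gs where gs: "set gs \<subseteq> H" "generic n rs gs"
      using goodD[OF good w(1) H(1) w(2) H(3)] by auto
    have "joint k \<theta> ((\<lambda>z. z @ m) ` set gs)" by (rule joint_mono[OF H(2)]) (use gs in auto)
    then show False using joint_generic[OF gs(2) rs(2) \<theta> m] rs(3) by simp
  qed
  then show ?case using G by blast
qed

end

section \<open>Strict coheirs, and forking against dividing\<close>

lemma take_drop_concat:
  "x \<in> set xs \<Longrightarrow> \<exists>i. i + length x \<le> length (concat xs) \<and> take (length x) (drop i (concat xs)) = x"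
proof -
  assume "x \<in> set xs"
  then obtain ys zs where "xs = ys @ x # zs" by (auto dest: split_list)
  then show ?thesis by (intro exI[of _ "length (concat ys)"]) simp
qed

context small_submodel
begin

text \<open>Blocks may coincide, so the set of blocks varies with \<open>z\<close>; the definition
  therefore splits the fixed index set \<open>J\<close>. Monotonicity of \<open>covered\<close>
  reconciles the two kinds of splitting.\<close>

lemma definable_covered:
  "params n \<Theta> \<Longrightarrow> J \<subseteq> {..<N} \<Longrightarrow>
    definable M (N * n) (\<lambda>z. covered \<Theta> ((\<lambda>r. take n (drop (r * n) z)) ` J))"
proof (induction \<Theta> arbitrary: J)
  case Nil
  then show ?case using definable_const[of M "N * n" "J = {}"] by simp
next
  case (Cons q \<Theta>)
  obtain \<theta> k m where q: "q = (\<theta>, k, m)" by (cases q)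
  have p: "set m \<subseteq> M" "formula L (k + (n + length m)) \<theta>" "params n \<Theta>"
    using Cons.prems(1) by (auto simp: params_def q)
  let ?b = "\<lambda>z r. take n (drop (r * n) z)"
  have fin: "finite (Pow J)" using Cons.prems(2) finite_subset by auto
  have "definable M (N * n) (\<lambda>z. \<exists>G\<in>Pow J. joint k \<theta> ((\<lambda>z. z @ m) ` ?b z ` G) \<and> covered \<Theta> (?b z ` (J - G)))"
  proof (rule definable_bex[OF fin], rule definable_conj)
    fix G assume G: "G \<in> Pow J"
    show "definable M (N * n) (\<lambda>z. joint k \<theta> ((\<lambda>z. z @ m) ` ?b z ` G))"
      by (rule definable_joint_blocks[OF p(2,1)]) (use G Cons.prems(2) in auto)
    show "definable M (N * n) (\<lambda>z. covered \<Theta> (?b z ` (J - G)))"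
      by (rule Cons.IH[OF p(3)]) (use Cons.prems(2) in auto)
  qed
  then show ?case
  proof (rule definable_cong)
    fix z
    show "(\<exists>G\<in>Pow J. joint k \<theta> ((\<lambda>z. z @ m) ` ?b z ` G) \<and> covered \<Theta> (?b z ` (J - G)))
        \<longleftrightarrow> covered (q # \<Theta>) (?b z ` J)" (is "?l \<longleftrightarrow> ?r")
    proof
      assume ?l
      then obtain G where G: "G \<subseteq> J" "joint k \<theta> ((\<lambda>z. z @ m) ` ?b z ` G)" "covered \<Theta> (?b z ` (J - G))"
        by auto
      have "covered \<Theta> (?b z ` J - ?b z ` G)" by (rule covered_mono[OF G(3)]) auto
      then show ?r unfolding q covered.simps using G(1,2)
        by (intro exI[of _ "?b z ` G"] conjI image_mono)
    next
      assume ?r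
      then obtain H where H: "H \<subseteq> ?b z ` J" "joint k \<theta> ((\<lambda>z. z @ m) ` H)" "covered \<Theta> (?b z ` J - H)"
        by (auto simp: q)
      let ?G = "{r \<in> J. ?b z r \<in> H}"
      have "joint k \<theta> ((\<lambda>z. z @ m) ` ?b z ` ?G)" by (rule joint_mono[OF H(2)]) auto
      moreover have "covered \<Theta> (?b z ` (J - ?G))" by (rule covered_mono[OF H(3)]) auto
      ultimately show ?l by (intro bexI[of _ ?G]) auto
    qed
  qed
qed

text \<open>Stated for \<open>R\<close> instead of its realizations: if d realizes \<open>R\<close>
  over \<open>M\<close> and \<open>c\<close>, then no formula of tp(c/Md) divides over
  \<open>M\<close>. The tuple \<open>a\<close> may represent d, as both have the same type over
  \<open>M\<close>.\<close>

definition strict :: "'a list \<Rightarrow> 'a list filter \<Rightarrow> bool" where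
  "strict a R \<longleftrightarrow> extends_tp a R \<and> (\<forall>\<theta> k m c. set m \<subseteq> M \<longrightarrow> c \<in> tuples U k \<longrightarrow>
     formula L (k + (length a + length m)) \<theta> \<longrightarrow> divides_over L C k M (\<theta>, a @ m) \<longrightarrow>
     eventually (\<lambda>y. \<not> holds C \<theta> (c @ y @ m)) R)"

text \<open>Each \<open>z\<close> is given to the first formula of the list that holds at
  \<open>z\<close> with its fixed \<open>c\<close>, so that this \<open>c\<close> serves the whole
  part.\<close>

lemma coveredI:
  assumes "\<And>z. z \<in> F \<Longrightarrow> \<exists>(\<theta>, k, m, c)\<in>set ds. holds C \<theta> (c @ z @ m)"
    "\<forall>(\<theta>, k, m, c)\<in>set ds. c \<in> tuples U k"
  shows "covered (map (\<lambda>(\<theta>, k, m, c). (\<theta>, k, m)) ds) F"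
  using assms
proof (induction ds arbitrary: F)
  case (Cons d ds)
  obtain \<theta> k m c where d: "d = (\<theta>, k, m, c)" by (cases d)
  let ?G = "{z \<in> F. holds C \<theta> (c @ z @ m)}"
  have "joint k \<theta> ((\<lambda>z. z @ m) ` ?G)" using Cons.prems(2) by (auto simp: joint_def d)
  moreover have "covered (map (\<lambda>(\<theta>, k, m, c). (\<theta>, k, m)) ds) (F - ?G)"
  proof (rule Cons.IH)
    fix z assume z: "z \<in> F - ?G"
    then obtain q where q: "q \<in> set (d # ds)" "case q of (\<theta>, k, m, c) \<Rightarrow> holds C \<theta> (c @ z @ m)"
      using Cons.prems(1)[of z] by auto
    then have "q \<noteq> d" using z by (auto simp: d)
    then show "\<exists>(\<theta>, k, m, c)\<in>set ds. holds C \<theta> (c @ z @ m)" using q by (intro bexI[of _ q]) auto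
  qed (use Cons.prems(2) in auto)
  ultimately show ?case
    by (simp add: d) (intro exI[of _ ?G], simp)
qed auto

text \<open>The tuples \<open>c\<close> may lie outside \<open>M\<close>, so the finitely many
  conditions at hand need not be definable over \<open>M\<close>. \<open>broom\<close> gives
  finitely many conjugates of \<open>a\<close> such that every choice of the tuples \<open>c\<close>
  fails at one of them. With these tuples quantified away in \<open>covered\<close>, this is a
  condition over \<open>M\<close> and passes to tuples in \<open>M\<close>.\<close>

lemma strict_exists:
  assumes NTP2: "NTP2 L C" and a: "a \<in> tuples U n"
  obtains R where "strict a R"
proof -
  have la: "length a = n" using a by (simp add: tuples_length)
  define D where "D = {(\<theta>, k, m, c). set m \<subseteq> M \<and> c \<in> tuples U k \<and>
     formula L (k + (n + length m)) \<theta> \<and> divides_over L C k M (\<theta>, a @ m)}"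
  define f :: "('f, 'r) fm \<times> nat \<times> 'a list \<times> 'a list \<Rightarrow> 'a list \<Rightarrow> bool"
    where "f = (\<lambda>(\<theta>, k, m, c) y. \<not> holds C \<theta> (c @ y @ m))"
  let ?\<P> = "insert (\<lambda>y. y \<in> tuples M n) ({P. definable M n P \<and> P a} \<union> f ` D)"
  obtain R where R: "ultra R" "\<And>P. P \<in> ?\<P> \<Longrightarrow> eventually P R"
  proof (rule ultrafilter_fip)
    fix X assume X: "finite X" "X \<subseteq> ?\<P>"
    define Y where "Y = {P \<in> X. definable M n P \<and> P a}"
    have Y: "finite Y" "\<And>P. P \<in> Y \<Longrightarrow> definable M n P \<and> P a" using X(1) by (auto simp: Y_def)
    have "finite (X \<inter> f ` D)" "X \<inter> f ` D \<subseteq> f ` D" using X(1) by auto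
    then obtain D0 where D0: "D0 \<subseteq> D" "finite D0" "X \<inter> f ` D = f ` D0"
      by (metis finite_subset_image)
    obtain ds where ds: "set ds = D0" using D0(2) finite_list by auto
    let ?\<Theta> = "map (\<lambda>(\<theta>, k, m, c). (\<theta>, k, m)) ds"
    have par: "params n ?\<Theta>" "\<forall>(\<theta>, k, m)\<in>set ?\<Theta>. divides_over L C k M (\<theta>, a @ m)"
      using ds D0(1) by (auto simp: params_def D_def)
    obtain F where F: "finite F" "F \<subseteq> {g \<in> tuples U n. eq_type M a g}" "\<not> covered ?\<Theta> F"
      using broom[OF NTP2 a par] by auto
    obtain fs where fs: "set fs = F" using F(1) finite_list by auto
    let ?N = "length fs"
    let ?b = "\<lambda>z r. take n (drop (r * n) z)"
    have fsn: "\<And>z. z \<in> set fs \<Longrightarrow> length z = n" using fs F(2) by (auto simp: tuples_def)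
    have fsz: "map (?b (concat fs)) [0..<?N] = fs" using chop_concat[of fs n] fsn by (simp add: chop_def)
    have "length (concat fs) = ?N * n" using fsn by (induction fs) auto
    then have U: "concat fs \<in> tuples U (?N * n)" using fs F(2) by (auto simp: tuples_def)
    \<comment> \<open>All blocks also satisfy the finite part \<open>Y\<close> of the type of
      \<open>a\<close>, so any block missed by the dividing formulas will do.\<close>
    let ?Q = "\<lambda>z. (\<forall>r\<in>{..<?N}. \<forall>P\<in>Y. P (?b z r)) \<and> \<not> covered ?\<Theta> (?b z ` {..<?N})"
    have "definable M (?N * n) ?Q"
    proof (intro definable_conj definable_not definable_ball finite_lessThan Y(1) definable_covered par(1) subset_refl)
      fix r P assume r: "r \<in> {..<?N}" and P: "P \<in> Y"
      have "Suc r * n \<le> ?N * n" using r by (intro mult_le_mono1) auto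
      then have c: "coord_map (?N * n) n (\<lambda>z. ?b z r)" by (intro coord_map_slice[OF coord_map_id]) simp
      have "definable M n P" using Y(2)[OF P] by simp
      from definable_coord_map[OF this c] show "definable M (?N * n) (\<lambda>z. P (?b z r))" .
    qed
    moreover have "?Q (concat fs)"
    proof (intro conjI ballI)
      fix r P assume r: "r \<in> {..<?N}" and P: "P \<in> Y"
      have "map (?b (concat fs)) [0..<?N] ! r = fs ! r" using fsz by simp
      then have "?b (concat fs) r \<in> set fs" using r by auto
      then have "eq_type M a (?b (concat fs) r)" using fs F(2) by auto
      then show "P (?b (concat fs) r)" using eq_typeD[of M a _ n P] Y(2)[OF P] la by auto
    next
      have "?b (concat fs) ` {..<?N} = set (map (?b (concat fs)) [0..<?N])" by (simp add: lessThan_atLeast0)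
      then show "\<not> covered ?\<Theta> (?b (concat fs) ` {..<?N})" using fsz fs F(3) by simp
    qed
    ultimately obtain z where z: "z \<in> tuples M (?N * n)" "?Q z" by (rule M_witness[OF _ U])
    have "\<exists>r<?N. \<forall>(\<theta>, k, m, c)\<in>set ds. \<not> holds C \<theta> (c @ ?b z r @ m)"
    proof (rule ccontr)
      assume neg: "\<not> ?thesis"
      have "covered ?\<Theta> (?b z ` {..<?N})"
      proof (rule coveredI)
        show "\<forall>(\<theta>, k, m, c)\<in>set ds. c \<in> tuples U k" using ds D0(1) by (auto simp: D_def)
        fix y assume "y \<in> ?b z ` {..<?N}"
        then obtain r where r: "r < ?N" "y = ?b z r" by auto
        have "\<not> (\<forall>(\<theta>, k, m, c)\<in>set ds. \<not> holds C \<theta> (c @ ?b z r @ m))" using neg r(1) by simp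
        then show "\<exists>(\<theta>, k, m, c)\<in>set ds. holds C \<theta> (c @ y @ m)" unfolding r(2) by force
      qed
      then show False using z(2) by simp
    qed
    then obtain r where r: "r < ?N" "\<forall>(\<theta>, k, m, c)\<in>set ds. \<not> holds C \<theta> (c @ ?b z r @ m)" by auto
    have y1: "?b z r \<in> set (chop n ?N z)" using r(1) by (auto simp: chop_def)
    have y1: "?b z r \<in> tuples M n" using chop_tuples[OF z(1) y1] .
    have y2: "P (?b z r)" if "P \<in> Y" for P using z(2) r(1) that by auto
    have y3: "P (?b z r)" if "P \<in> f ` D0" for P
    proof -
      obtain q where q: "q \<in> set ds" "P = f q" using \<open>P \<in> f ` D0\<close> ds by auto
      from bspec[OF r(2) q(1)] show ?thesis unfolding q(2) f_def by (cases q) simp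
    qed
    have "P (?b z r)" if "P \<in> X" for P
    proof -
      have "P = (\<lambda>y. y \<in> tuples M n) \<or> P \<in> Y \<or> P \<in> f ` D0"
        using that X(2) D0(3) unfolding Y_def by auto
      then show ?thesis using y1 y2 y3 by (elim disjE) simp_all
    qed
    then show "\<exists>x. \<forall>P\<in>X. P x" by (intro exI[of _ "?b z r"] ballI)
  qed (rule that)
  have "strict a R"
    unfolding strict_def extends_tp_def la coheir_def
  proof (intro conjI allI impI)
    fix \<theta> k m c assume "set m \<subseteq> M" "c \<in> tuples U k" "formula L (k + (n + length m)) \<theta>"
      "divides_over L C k M (\<theta>, a @ m)"
    then have "(\<theta>, k, m, c) \<in> D" by (simp add: D_def)
    then have "f (\<theta>, k, m, c) \<in> ?\<P>" by blast
    from R(2)[OF this] show "eventually (\<lambda>y. \<not> holds C \<theta> (c @ y @ m)) R" by (simp add: f_def)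
  qed (use R in auto)
  then show thesis by (rule that)
qed

text \<open>Strictness says that \<open>tp(z/Md)\<close> does not divide over \<open>M\<close>, so a dividing sequence of \<open>\<theta>(x,d)\<close>
  can be moved so that all its terms realize the same type as \<open>d\<close> over \<open>Mz\<close>.\<close>

lemma strict_row:
  assumes R: "strict a R" and a: "a \<in> tuples U n" and A: "finite A" "A \<subseteq> U"
    and \<theta>: "formula L (k + n) \<theta>"
    and s: "\<And>i. s i \<in> tuples U n" "\<And>i. eq_type M a (s i)" "k_inconsistent C k \<theta> K s"
    and N: "0 < (N :: nat)"
  obtains t where "\<And>i. t i \<in> tuples U n" "\<And>i. i < N \<Longrightarrow> realizes R (M \<union> A) (t i)"
    "\<And>I. I \<subseteq> {..<N} \<Longrightarrow> card I = K \<Longrightarrow> \<not> joint k \<theta> (t ` I)"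
proof -
  have la: "length a = n" using a by (simp add: tuples_length)
  have R': "extends_tp a R" "coheir n R" using R la by (auto simp: strict_def extends_tp_def)
  obtain z where zA: "set z = A" using A(1) finite_list by auto
  define l where "l = length z"
  have z: "z \<in> tuples U l" using A(2) zA by (auto simp: tuples_def l_def)
  obtain d where d: "d \<in> tuples U n" "realizes R (M \<union> A) d" using coheir_realizes[OF R'(2) A] by auto
  define b where "b i x = take n (drop (l + i * n) x)" for i and x :: "'a list"
  have cb: "coord_map (l + N * n) n (b i)" if "i < N" for i
  proof -
    have "Suc i * n \<le> N * n" using that by (intro mult_le_mono1) simp
    then show ?thesis unfolding b_def by (intro coord_map_slice[OF coord_map_id]) simp
  qed
  have cl: "coord_map (l + N * n) l (take l)" by (rule coord_map_take[OF coord_map_id]) simp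
  \<comment> \<open>The tuple sought consists of a copy of \<open>z\<close> and \<open>N\<close>
    blocks: the copy with any block realizes tp(zd/M), and the blocks are
    \<open>K\<close>-inconsistent.\<close>
  let ?T = "{P. definable M (l + n) P \<and> P (z @ d)}"
  let ?I = "{I. I \<subseteq> {..<N} \<and> card I = K}"
  define f where "f = (\<lambda>(P, i) x. P (take l x @ b i x) :: bool)"
  define g where "g I x \<longleftrightarrow> \<not> joint k \<theta> ((\<lambda>i. b i x) ` I)" for I x
  obtain x where x: "x \<in> tuples U (l + N * n)" "\<And>P. P \<in> f ` (?T \<times> {..<N}) \<union> g ` ?I \<Longrightarrow> P x"
  proof (rule saturation[OF M_U M_small])
    fix P assume "P \<in> f ` (?T \<times> {..<N}) \<union> g ` ?I"
    then consider Q i where "definable M (l + n) Q" "i < N" "P = (\<lambda>x. Q (take l x @ b i x))"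
      | I where "I \<subseteq> {..<N}" "P = g I" by (auto simp: f_def)
    then show "definable M (l + N * n) P"
    proof cases
      case 1
      show ?thesis unfolding 1(3)
        by (rule definable_coord_map[OF 1(1)]) (use coord_map_append[OF cl cb[OF 1(2)]] in simp)
    next
      case 2
      have c: "coord_map (l + N * n) (N * n) (drop l)"
        using coord_map_drop[OF coord_map_id, of "l + N * n" l] by simp
      have "definable M (l + N * n) (\<lambda>x. joint k \<theta> ((\<lambda>z. z @ []) ` (\<lambda>r. take n (drop (r * n) (drop l x))) ` I))"
        by (rule definable_coord_map[OF definable_joint_blocks c]) (use \<theta> 2(1) in auto)
      from definable_not[OF this] show ?thesis
        unfolding 2(2) g_def b_def by (simp add: add.commute)
    qed
  next
    fix X assume X: "finite X" "X \<subseteq> f ` (?T \<times> {..<N}) \<union> g ` ?I"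
    obtain Y where Y: "Y \<subseteq> ?T \<times> {..<N}" "finite Y" "X \<inter> f ` (?T \<times> {..<N}) = f ` Y"
    proof -
      have "finite (X \<inter> f ` (?T \<times> {..<N}))" using X(1) by simp
      from finite_subset_image[OF this Int_lower2] show ?thesis using that by (elim exE conjE)
    qed
    let ?P = "\<lambda>y. \<forall>P\<in>fst ` Y. P y"
    have "definable M (l + n) ?P" using Y by (intro definable_ball) auto
    then obtain \<phi> m where \<phi>: "set m \<subseteq> M" "formula L (l + n + length m) \<phi>"
      "\<forall>y\<in>tuples U (l + n). ?P y \<longleftrightarrow> holds C \<phi> (y @ m)" unfolding definable_def by auto
    have "?P (z @ d)" using Y(1) by auto
    then have zd: "holds C \<phi> (z @ d @ m)" using \<phi>(3) tuples_append[OF z d(1)] by simp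
    \<comment> \<open>\<phi>(z,d,m) holds and \<open>d\<close> realizes \<open>R\<close> over
      \<open>M\<close> and \<open>z\<close>, so strictness excludes dividing. Hence the instances
      along \<open>s\<close> are not \<open>N\<close>-inconsistent, and a single \<open>y\<close>
      works for \<open>N\<close> terms of \<open>s\<close>.\<close>
    have "\<not> divides_over L C l M (\<phi>, a @ m)"
    proof
      assume "divides_over L C l M (\<phi>, a @ m)"
      then have ev: "eventually (\<lambda>y. \<not> holds C \<phi> (z @ y @ m)) R"
        using R \<phi>(1,2) z la by (simp add: strict_def add.assoc)
      have "definable (M \<union> A) (l + n) (\<lambda>y. \<not> holds C \<phi> (y @ m))"
        using \<phi> by (intro definable_not definable_holds) auto
      from definable_param_left[of "M \<union> A" z n, OF this[unfolded l_def]] zA M_U A(2)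
      have "definable (M \<union> A) n (\<lambda>y. \<not> holds C \<phi> (z @ y @ m))" by simp
      from realizesD[OF d(2) this tuples_length[OF d(1)] ev] zd show False by simp
    qed
    then have nd: "\<not> k_inconsistent C l \<phi> N (\<lambda>i. s i @ m)"
    proof (rule contrapos_nn)
      assume k: "k_inconsistent C l \<phi> N (\<lambda>i. s i @ m)"
      have "s i @ m \<in> tuples U (n + length m)" for i using s(1) set_M_tuples[OF \<phi>(1)] by (rule tuples_append)
      moreover have "a @ m \<in> tuples U (n + length m)" using a set_M_tuples[OF \<phi>(1)] by (rule tuples_append)
      ultimately have "tp L C (s i @ m) M = tp L C (a @ m) M" for i
        using eq_type_tp eq_type_append_M[OF s(2) \<phi>(1)] by blast
      then show "divides_over L C l M (\<phi>, a @ m)"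
        using k \<open>\<And>i. s i @ m \<in> tuples U (n + length m)\<close> la
        unfolding divides_over_def prod.case by (intro exI[of _ N] exI[of _ "\<lambda>i. s i @ m"]) simp
    qed
    obtain I y where I: "finite I" "card I = N" and y: "y \<in> tuples U l" "\<forall>i\<in>I. holds C \<phi> (y @ s i @ m)"
      using nd by (auto simp: k_inconsistent_def)
    define e where "e j = sorted_list_of_set I ! j" for j
    have le: "length (sorted_list_of_set I) = N" using I by simp
    have eI: "e j \<in> I" if "j < N" for j
      using nth_mem[of j "sorted_list_of_set I"] le that I(1) by (simp add: e_def)
    have einj: "inj_on e {..<N}"
      using I(1) le by (auto simp: inj_on_def e_def nth_eq_iff_index_eq)
    let ?w = "concat (map (\<lambda>j. s (e j)) [0..<N])"
    let ?x = "y @ ?w"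
    have ly: "length y = l" using y(1) by (simp add: tuples_length)
    have bx: "b j ?x = s (e j)" if "j < N" for j
    proof -
      have "chop n (length (map (\<lambda>j. s (e j)) [0..<N])) ?w = map (\<lambda>j. s (e j)) [0..<N]"
        by (rule chop_concat) (use tuples_length[OF s(1)] in auto)
      then have "chop n N ?w ! j = s (e j)" using that by simp
      then show ?thesis using that ly by (simp add: chop_def b_def)
    qed
    have "length ?w = N * n"
      using tuples_length[OF s(1)] by (simp add: length_concat comp_def sum_list_triv)
    then have w: "?w \<in> tuples U (N * n)" using s(1) by (auto simp: tuples_def)
    have xU: "?x \<in> tuples U (l + N * n)" using y(1) w by (rule tuples_append)
    moreover have "Q ?x" if "Q \<in> X" for Q
    proof (cases "Q \<in> f ` (?T \<times> {..<N})")
      case True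
      then have "Q \<in> f ` Y" using that Y(3) by auto
      then obtain P i where P: "(P, i) \<in> Y" "Q = (\<lambda>x. P (take l x @ b i x))" by (auto simp: f_def)
      have i: "i < N" using P(1) Y(1) by auto
      have "?P (y @ s (e i))"
        using \<phi>(3) tuples_append[OF y(1) s(1)] y(2) eI[OF i] by simp
      then have "P (y @ s (e i))" using P(1) by force
      then show ?thesis unfolding P(2) using bx[OF i] ly by simp
    next
      case False
      then have "Q \<in> g ` ?I" using X(2) that by (meson UnE subsetD)
      then obtain J where J: "J \<subseteq> {..<N}" "card J = K" "Q = g J" by auto
      have "(\<lambda>i. b i ?x) ` J = s ` e ` J"
        unfolding image_image using J(1) bx by (intro image_cong) auto
      moreover have "finite (e ` J)" using J(1) finite_subset by blast
      moreover have "card (e ` J) = K" using card_image[OF inj_on_subset[OF einj J(1)]] J(2) by simp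
      ultimately show ?thesis unfolding J(3) g_def using s(3) by (simp add: k_inconsistent_joint)
    qed
    ultimately show "\<exists>x\<in>tuples U (l + N * n). \<forall>Q\<in>X. Q x" by (intro bexI[of _ ?x]) auto
  qed (rule that)
  have zx: "eq_type M (z @ d) (take l x @ b i x)" if "i < N" for i
  proof -
    have len: "length (take l x @ b i x) = l + n" "length (z @ d) = l + n"
      using tuples_length[OF tuples_append[OF coord_map_tuples[OF cl x(1)] coord_map_tuples[OF cb[OF that] x(1)]]]
        tuples_length[OF tuples_append[OF z d(1)]] by simp_all
    have *: "P (take l x @ b i x)" if P: "definable M (l + n) P" "P (z @ d)" for P
    proof -
      have "f (P, i) \<in> f ` (?T \<times> {..<N}) \<union> g ` ?I" using P \<open>i < N\<close> by auto
      from x(2)[OF this] show ?thesis by (simp add: f_def)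
    qed
    have "P (z @ d) = P (take l x @ b i x)" if P: "definable M (l + n) P" for P
      using *[OF P] *[OF definable_not[OF P]] by auto
    then show ?thesis using len by (simp add: eq_type_def)
  qed
  have zU: "take l x \<in> tuples U l" using coord_map_tuples[OF cl x(1)] .
  have "coord_map (length (z @ d)) l (take l)" by (rule coord_map_take[OF coord_map_id]) (simp add: l_def)
  \<comment> \<open>Block 0 exists because \<open>N\<close> is positive; through it the copy of
    \<open>z\<close> is seen to have the type of \<open>z\<close> over \<open>M\<close>.\<close>
  from eq_type_coord_map[OF zx[OF N] this] have "eq_type M (take l (z @ d)) (take l (take l x @ b 0 x))" .
  moreover have "take l (z @ d) = z" by (simp add: l_def)
  moreover have "take l (take l x @ b 0 x) = take l x" using tuples_length[OF zU] by simp
  ultimately have "eq_type M z (take l x)" by (simp only:)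
  then obtain \<sigma> where \<sigma>: "Aut M \<sigma>" "map \<sigma> (take l x) = z" using eq_type_Aut[OF M_U M_small zU z] eq_type_sym by metis
  define t where "t i = (if i < N then map \<sigma> (b i x) else a)" for i
  show thesis
  proof (rule that)
    show tU: "t i \<in> tuples U n" for i
      using a Aut_tuples[OF \<sigma>(1) coord_map_tuples[OF cb x(1)]] by (simp add: t_def)
    show "realizes R (M \<union> A) (t i)" if i: "i < N" for i
    proof -
      have "take l x @ b i x \<in> tuples U (l + n)" using zU coord_map_tuples[OF cb[OF i] x(1)] by (rule tuples_append)
      from Aut_eq_type[OF \<sigma>(1) M_U this] have "eq_type M (take l x @ b i x) (z @ t i)"
        using \<sigma>(2) i by (simp add: t_def)
      then have e: "eq_type M (z @ d) (z @ t i)" using zx[OF i] by (rule eq_type_trans[rotated])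
      \<comment> \<open>An automorphism fixing \<open>M\<close> and \<open>z\<close>, hence
        \<open>A\<close>, and sending \<open>d\<close> to \<open>t i\<close>; so \<open>t i\<close>
        realizes \<open>R\<close> over \<open>M \<union> A\<close> because \<open>d\<close>
        does.\<close>
      obtain \<tau> where \<tau>: "Aut M \<tau>" "map \<tau> (z @ d) = z @ t i"
        using eq_type_Aut[OF M_U M_small tuples_append[OF z d(1)] tuples_append[OF z tU] e] by auto
      then have "map \<tau> z = z" "map \<tau> d = t i" by auto
      then have "Aut (M \<union> A) \<tau>" using \<tau>(1) zA by (auto simp: Aut_def map_eq_conv[of _ _ "\<lambda>x. x", simplified])
      then show ?thesis
        using d \<open>map \<tau> d = t i\<close> Aut_definable[of "M \<union> A" \<tau> n _ d] M_U A(2) tuples_length[OF tU]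
        unfolding realizes_def tuples_length[OF d(1)] by auto
    qed
    show "\<not> joint k \<theta> (t ` I)" if I: "I \<subseteq> {..<N}" "card I = K" for I
    proof
      assume j: "joint k \<theta> (t ` I)"
      have "t ` I = map \<sigma> ` (\<lambda>i. b i x) ` I" using I(1) by (auto simp: t_def image_image)
      then have "joint k \<theta> ((\<lambda>z. z @ []) ` map \<sigma> ` (\<lambda>i. b i x) ` I)" using j by simp
      moreover have "(\<lambda>i. b i x) ` I \<subseteq> tuples U n" using I(1) coord_map_tuples[OF cb x(1)] by auto
      ultimately have "joint k \<theta> ((\<lambda>z. z @ []) ` (\<lambda>i. b i x) ` I)"
        using joint_Aut[OF \<sigma>(1), of k n "[]" \<theta>] \<theta> by simp
      moreover have "g I \<in> f ` (?T \<times> {..<N}) \<union> g ` ?I" using I by auto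
      from x(2)[OF this] have "\<not> joint k \<theta> ((\<lambda>i. b i x) ` I)" by (simp add: g_def)
      ultimately show False by simp
    qed
  qed
qed

text \<open>The array argument of \<open>dividing_generic\<close> with one coheir throughout:
  \<open>strict_row\<close> supplies rows all of whose entries realize \<open>R\<close> over the
  earlier rows. Generic sequences of equal length are conjugate, so one consistent sequence of each
  length makes all of them consistent.\<close>

lemma strict_generic:
  assumes NTP2: "NTP2 L C" and R: "strict a R" and a: "a \<in> tuples U n"
    and \<theta>: "formula L (k + n) \<theta>" and div: "divides_over L C k M (\<theta>, a)"
  shows "\<exists>l. \<forall>gs. generic n (replicate l R) gs \<longrightarrow> \<not> joint k \<theta> (set gs)"
proof (rule ccontr)
  assume neg: "\<not> ?thesis"
  have la: "length a = n" using a by (simp add: tuples_length)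
  have R': "coheir n R" using R la by (auto simp: strict_def extends_tp_def)
  have all: "joint k \<theta> (set gs)" if gs: "generic n (replicate l R) gs" for l gs
  proof -
    obtain hs where hs: "generic n (replicate l R) hs" "joint k \<theta> (set hs)" using neg by auto
    show ?thesis using joint_generic[OF hs(1) gs, of k "[]" \<theta>] \<theta> hs(2) by simp
  qed
  obtain K s where s: "\<And>i. s i \<in> tuples U n" "\<And>i. tp L C (s i) M = tp L C a M"
    "k_inconsistent C k \<theta> K s"
    using div la by (auto simp: divides_over_def)
  have s2: "eq_type M a (s i)" for i using tp_eq_iff[OF a s(1), of M] s(2) by auto
  have "\<not> NTP2 L C"
  proof (rule not_NTP2_of_rows[OF \<theta>, of "\<lambda>gs. generic n (replicate (length gs) R) gs" K])
    show "generic n (replicate (length []) R) []" by (simp add: generic.Nil)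
    show "joint k \<theta> (set gs)" if "generic n (replicate (length gs) R) gs" for gs
      using that by (rule all)
  next
    fix N :: nat and A assume A: "finite A" "A \<subseteq> U"
    \<comment> \<open>\<open>Suc N\<close> because \<open>strict_row\<close> asks for a positive
      length.\<close>
    obtain t where t: "\<And>i. t i \<in> tuples U n" "\<And>i. i < Suc N \<Longrightarrow> realizes R (M \<union> A) (t i)"
      "\<And>I. I \<subseteq> {..<Suc N} \<Longrightarrow> card I = K \<Longrightarrow> \<not> joint k \<theta> (t ` I)"
      by (rule strict_row[OF R a A \<theta> s(1) s2 s(3) zero_less_Suc[of N]]) (rule that)
    show "\<exists>t. (\<forall>i. t i \<in> tuples U n) \<and> (\<forall>I\<subseteq>{..<N}. card I = K \<longrightarrow> \<not> joint k \<theta> (t ` I)) \<and>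
      (\<forall>gs i. generic n (replicate (length gs) R) gs \<longrightarrow> set (concat gs) \<subseteq> A \<longrightarrow> i < N \<longrightarrow>
        generic n (replicate (length (gs @ [t i])) R) (gs @ [t i]))"
    proof (intro exI[of _ t] conjI allI impI)
      fix I assume I: "I \<subseteq> {..<N}" "card I = K"
      have "I \<subseteq> {..<Suc N}" using I(1) by auto
      then show "\<not> joint k \<theta> (t ` I)" using I(2) by (rule t(3))
    next
      fix gs i assume gs: "generic n (replicate (length gs) R) gs" "set (concat gs) \<subseteq> A" "i < N"
      have "realizes R (M \<union> set (concat gs)) (t i)"
        by (rule realizes_mono[OF t(2)]) (use gs in auto)
      from generic.snoc[OF gs(1) R' t(1) this]
      show "generic n (replicate (length (gs @ [t i])) R) (gs @ [t i])"
        by (simp add: replicate_append_same)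
    qed (rule t(1))
  qed
  with NTP2 show False by simp
qed

section \<open>Forking compared with dividing\<close>

lemma divides_coord_map:
  assumes a: "a \<in> tuples U n" and f: "coord_map n l f" and div: "divides_over L C k M (\<phi>, f a)"
    and \<phi>': "\<And>w y. w \<in> tuples U k \<Longrightarrow> y \<in> tuples U n \<Longrightarrow> holds C \<phi>' (w @ y) \<longleftrightarrow> holds C \<phi> (w @ f y)"
  shows "divides_over L C k M (\<phi>', a)"
proof -
  have fa: "f a \<in> tuples U l" using coord_map_tuples[OF f a] .
  obtain K s where s: "\<And>i. s i \<in> tuples U l" "\<And>i. tp L C (s i) M = tp L C (f a) M"
    "k_inconsistent C k \<phi> K s"
    using div fa by (auto simp: divides_over_def tuples_length)
  \<comment> \<open>The automorphism carrying \<open>f a\<close> to \<open>s i\<close> carries the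
    whole of \<open>a\<close> along and thereby supplies the additional coordinates.\<close>
  have "\<exists>\<sigma>. Aut M \<sigma> \<and> map \<sigma> (f a) = s i" for i
  proof -
    have "eq_type M (f a) (s i)" using tp_eq_iff[OF fa s(1), of M] s(2) by auto
    then show ?thesis using eq_type_Aut[OF M_U M_small fa s(1)] by metis
  qed
  then obtain \<sigma> where \<sigma>: "\<And>i. Aut M (\<sigma> i)" "\<And>i. map (\<sigma> i) (f a) = s i" by metis
  define t where "t i = map (\<sigma> i) a" for i
  have t: "t i \<in> tuples U n" for i unfolding t_def by (rule Aut_tuples[OF \<sigma>(1) a])
  have "f (t i) = s i" for i
    unfolding t_def using coord_map_map[OF f tuples_length[OF a]] \<sigma>(2) by simp
  then have "k_inconsistent C k \<phi>' K t" using s(3) \<phi>'[OF _ t] by (simp add: k_inconsistent_def)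
  moreover have "tp L C (t i) M = tp L C a M" for i
    using eq_type_tp[OF a Aut_eq_type[OF \<sigma>(1) M_U a] Aut_tuples[OF \<sigma>(1) a]] by (simp add: t_def)
  ultimately show ?thesis using t tuples_length[OF a] unfolding divides_over_def prod.case
    by (intro exI[of _ K] exI[of _ t]) simp
qed

text \<open>Each entry realizes \<open>R\<close> over all earlier ones, hence over any selection of
  them; so genericity passes to subsequences, as the pigeonhole argument below requires.\<close>

lemma generic_sequence:
  assumes R: "coheir n R"
  obtains g where "\<And>j. g j \<in> tuples U n" "\<And>xs :: nat list. sorted_wrt (<) xs \<Longrightarrow> generic n (replicate (length xs) R) (map g xs)"
proof -
  define P where "P j h \<longleftrightarrow> generic n (replicate j R) h" for j h
  have step: "\<exists>h'. P (Suc j) h' \<and> (\<exists>x. h' = h @ [x])" if h: "P j h" for j h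
  proof -
    have gh: "generic n (replicate j R) h" using h by (simp add: P_def)
    obtain x where x: "x \<in> tuples U n" "realizes R (M \<union> set (concat h)) x"
      using coheir_realizes[OF R _ generic_set[OF gh]] by auto
    have "generic n (replicate j R @ [R]) (h @ [x])" using gh R x by (rule generic.snoc)
    then show ?thesis by (auto simp: P_def replicate_append_same)
  qed
  have "P 0 []" by (simp add: P_def generic.Nil)
  then obtain h where h: "\<And>j. P j (h j)" "\<And>j. \<exists>x. h (Suc j) = h j @ [x]"
    using dependent_nat_choice[of P "\<lambda>j c d. \<exists>x. d = c @ [x]"] step by metis
  define g where "g j = h (Suc j) ! j" for j
  have len: "length (h j) = j" for j using generic_length[of n "replicate j R" "h j"] h(1)[of j] by (simp add: P_def)
  have hS: "h (Suc j) = h j @ [g j]" for j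
  proof -
    obtain x where x: "h (Suc j) = h j @ [x]" using h(2) by blast
    then have "g j = x" using len[of j] by (simp add: g_def nth_append)
    then show ?thesis using x by simp
  qed
  have hg: "h j = map g [0..<j]" for j
    by (induction j) (use len[of 0] hS in auto)
  have g: "g j \<in> tuples U n" "realizes R (M \<union> set (concat (map g [0..<j]))) (g j)" for j
  proof -
    have "generic n (replicate j R @ [R]) (h (Suc j))" using h(1)[of "Suc j"] by (simp add: P_def replicate_append_same)
    then show "g j \<in> tuples U n" "realizes R (M \<union> set (concat (map g [0..<j]))) (g j)"
      unfolding hS hg by (auto elim!: generic_snocE)
  qed
  have seq: "generic n (replicate (length xs) R) (map g xs)" if "sorted_wrt (<) xs" for xs :: "nat list"
    using that
  proof (induction xs rule: rev_induct)
    case Nil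
    then show ?case by (simp add: generic.Nil)
  next
    case (snoc x xs)
    have "set (concat (map g xs)) \<subseteq> set (concat (map g [0..<x]))"
      using snoc.prems by (fastforce simp: sorted_wrt_append)
    then have "realizes R (M \<union> set (concat (map g xs))) (g x)"
      by (intro realizes_mono[OF g(2)]) auto
    then have "generic n (replicate (length xs) R @ [R]) (map g xs @ [g x])"
      using snoc R g(1) by (intro generic.snoc) (auto simp: sorted_wrt_append)
    then show ?case by (simp add: replicate_append_same)
  qed
  show thesis using g(1) seq by (rule that)
qed

text \<open>Let \<open>a\<close> collect \<open>d\<close> and all parameters of \<Delta>, and take a
  generic sequence for a strict coheir of tp(a/M). Some \<open>x\<close> satisfies \<psi> at
  \<open>?K\<close> of its terms. If \<psi>(x,d) implied the disjunction of \<Delta>, each of these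
  terms would satisfy a member of \<Delta> by conjugacy, and some member \<open>q\<close> would hold
  at \<open>l q\<close> terms, a number at which it is inconsistent along generic sequences.\<close>

lemma not_forks_of_not_divides:
  assumes NTP2: "NTP2 L C" and d: "d \<in> tuples U nd" and \<psi>: "formula L (k + nd) \<psi>"
    and nd: "\<not> divides_over L C k M (\<psi>, d)"
    and \<Delta>: "finite \<Delta>" "\<Delta> \<subseteq> fmls_over L k U" "\<forall>q\<in>\<Delta>. divides_over L C k M q"
  shows "\<exists>x\<in>tuples U k. holds C \<psi> (x @ d) \<and> (\<forall>(\<chi>, e)\<in>\<Delta>. \<not> holds C \<chi> (x @ e))"
proof (rule ccontr)
  assume neg: "\<not> ?thesis"
  obtain qs where qs: "set qs = \<Delta>" using \<Delta>(1) finite_list by auto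
  define a where "a = concat (d # map snd qs)"
  define n where "n = length a"
  have e: "set e \<subseteq> U" "formula L (k + length e) \<chi>" if "(\<chi>, e) \<in> \<Delta>" for \<chi> e
    using that \<Delta>(2) by (auto simp: fmls_over_def)
  have a: "a \<in> tuples U n"
    using d e(1) qs by (fastforce simp: a_def n_def tuples_def)
  have ld: "length d = nd" using d by (simp add: tuples_length)
  have "\<forall>q. \<exists>i. q \<in> \<Delta> \<longrightarrow> i + length (snd q) \<le> n \<and> take (length (snd q)) (drop i a) = snd q"
    using take_drop_concat[of _ "d # map snd qs"] qs unfolding a_def n_def by (metis imageI list.set_map list.set_intros(2))
  then obtain pos where pos: "\<And>q. q \<in> \<Delta> \<Longrightarrow> pos q + length (snd q) \<le> n"
    "\<And>q. q \<in> \<Delta> \<Longrightarrow> take (length (snd q)) (drop (pos q) a) = snd q" by metis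
  define f where "f q y = take (length (snd q)) (drop (pos q) y)" for q :: "('f, 'r) fm \<times> 'a list" and y :: "'a list"
  have cf: "coord_map n (length (snd q)) (f q)" if "q \<in> \<Delta>" for q
    unfolding f_def using pos(1)[OF that] by (rule coord_map_slice[OF coord_map_id])
  have fa: "f q a = snd q" if "q \<in> \<Delta>" for q using pos(2)[OF that] by (simp add: f_def)
  have cd: "coord_map n nd (take nd)" by (rule coord_map_take[OF coord_map_id]) (simp add: n_def a_def ld)
  have da: "take nd a = d" by (simp add: a_def ld)
  obtain R where R: "strict a R" using strict_exists[OF NTP2 a] by auto
  have R': "extends_tp a R" "coheir n R" using R by (auto simp: strict_def extends_tp_def n_def)
  have "\<exists>\<chi>'. formula L (k + n) \<chi>' \<and> (\<forall>w\<in>tuples U k. \<forall>y\<in>tuples U n. holds C \<chi>' (w @ y) \<longleftrightarrow> holds C (fst q) (w @ f q y))"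
    if q: "q \<in> \<Delta>" for q
  proof -
    have c: "coord_map (k + n) (k + length (snd q)) (\<lambda>x. take k x @ take (length (snd q)) (drop (k + pos q) x))"
      using pos(1)[OF q] by (intro coord_map_append coord_map_take[OF coord_map_id] coord_map_slice[OF coord_map_id]) auto
    obtain idx where idx: "length idx = k + length (snd q)" "set idx \<subseteq> {..<k + n}"
      "\<And>x :: 'a list. length x = k + n \<Longrightarrow> take k x @ take (length (snd q)) (drop (k + pos q) x) = map ((!) x) idx"
      using c by (auto simp: coord_map_def)
    obtain \<chi>' where \<chi>': "formula L (k + n) \<chi>'"
      "\<And>(S :: ('f, 'r, 'a) struct) x. holds S \<chi>' x \<longleftrightarrow> holds S (fst q) (map ((!) x) idx)"
    proof (rule rename_formula)
      show "formula L (length idx) (fst q)" using e(2)[of "fst q" "snd q"] q idx(1) by simp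
      show "set idx \<subseteq> {..<k + n}" by (rule idx(2))
    qed (rule that)
    have "holds C \<chi>' (w @ y) \<longleftrightarrow> holds C (fst q) (w @ f q y)" if "w \<in> tuples U k" "y \<in> tuples U n" for w y
      using \<chi>'(2)[of C "w @ y"] idx(3)[of "w @ y"] that by (simp add: tuples_length f_def)
    then show ?thesis using \<chi>'(1) by blast
  qed
  then have "\<exists>\<chi>'. \<forall>q\<in>\<Delta>. formula L (k + n) (\<chi>' q) \<and>
      (\<forall>w\<in>tuples U k. \<forall>y\<in>tuples U n. holds C (\<chi>' q) (w @ y) \<longleftrightarrow> holds C (fst q) (w @ f q y))"
    by (intro bchoice) auto
  then obtain \<chi>' where \<chi>': "\<And>q. q \<in> \<Delta> \<Longrightarrow> formula L (k + n) (\<chi>' q)"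
    "\<And>q w y. q \<in> \<Delta> \<Longrightarrow> w \<in> tuples U k \<Longrightarrow> y \<in> tuples U n \<Longrightarrow> holds C (\<chi>' q) (w @ y) \<longleftrightarrow> holds C (fst q) (w @ f q y)"
    by auto
  have "\<exists>l. \<forall>gs. generic n (replicate l R) gs \<longrightarrow> \<not> joint k (\<chi>' q) (set gs)" if q: "q \<in> \<Delta>" for q
  proof (rule strict_generic[OF NTP2 R a \<chi>'(1)[OF q]])
    show "divides_over L C k M (\<chi>' q, a)"
      by (rule divides_coord_map[OF a cf[OF q], of k "fst q"]) (use \<Delta>(3) q fa[OF q] \<chi>'(2)[OF q] in auto)
  qed
  then have "\<exists>l. \<forall>q\<in>\<Delta>. \<forall>gs. generic n (replicate (l q) R) gs \<longrightarrow> \<not> joint k (\<chi>' q) (set gs)"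
    by (intro bchoice) auto
  then obtain l where l: "\<And>q gs. q \<in> \<Delta> \<Longrightarrow> generic n (replicate (l q) R) gs \<Longrightarrow> \<not> joint k (\<chi>' q) (set gs)"
    by auto
  obtain g where g: "\<And>j. g j \<in> tuples U n"
    "\<And>xs :: nat list. sorted_wrt (<) xs \<Longrightarrow> generic n (replicate (length xs) R) (map g xs)"
    by (rule generic_sequence[OF R'(2)]) (rule that)
  have ag: "eq_type M a (g j)" for j
    using generic_extends_tp[of a "[R]" "map g [j]" "g j"] g(2)[of "[j]"] R'(1) by (simp add: n_def)
  \<comment> \<open>One more than the sum of the lengths \<open>l q\<close>, for the pigeonhole.
    Non-dividing gives a common solution for some \<open>?K\<close> terms, not for terms chosen in
    advance.\<close>
  let ?K = "Suc (\<Sum>q\<in>\<Delta>. l q)"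
  have "\<not> k_inconsistent C k \<psi> ?K (\<lambda>j. take nd (g j))"
  proof
    assume k: "k_inconsistent C k \<psi> ?K (\<lambda>j. take nd (g j))"
    have U: "take nd (g j) \<in> tuples U nd" for j using coord_map_tuples[OF cd g(1)] .
    have "eq_type M d (take nd (g j))" for j using eq_type_coord_map[OF ag] cd da unfolding n_def by metis
    then have "tp L C (take nd (g j)) M = tp L C d M" for j using eq_type_tp[OF d _ U] by blast
    then have "divides_over L C k M (\<psi>, d)"
      unfolding divides_over_def prod.case using U ld k
      by (intro exI[of _ ?K] exI[of _ "\<lambda>j. take nd (g j)"]) simp
    then show False using nd by simp
  qed
  then obtain I x where I: "finite I" "card I = ?K" and x: "x \<in> tuples U k" "\<And>i. i \<in> I \<Longrightarrow> holds C \<psi> (x @ take nd (g i))"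
    by (auto simp: k_inconsistent_def)
  \<comment> \<open>The assumed implication is about \<open>a\<close>; conjugation transfers it to
    \<open>g i\<close>.\<close>
  have cov: "\<exists>q\<in>\<Delta>. holds C (\<chi>' q) (x @ g i)" if i: "i \<in> I" for i
  proof -
    obtain \<sigma> where \<sigma>: "Aut M \<sigma>" "map \<sigma> a = g i" using eq_type_Aut[OF M_U M_small a g(1) ag] by auto
    let ?x = "map (inv_into U \<sigma>) x"
    have x': "map \<sigma> ?x = x" "?x \<in> tuples U k"
      using map_inv_into_tuples[OF Aut_bij[OF \<sigma>(1)] x(1)] by auto
    have \<sigma>': "automorphism L C \<sigma>" using \<sigma>(1) by (simp add: Aut_def)
    have "map \<sigma> (?x @ d) = x @ take nd (g i)" using x'(1) \<sigma>(2) da by (metis map_append take_map)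
    then have "holds C \<psi> (?x @ d)"
      using automorphism_holds[OF \<sigma>' tuples_append[OF x'(2) d] \<psi>] x(2)[OF i] by simp
    then obtain q where q: "q \<in> \<Delta>" "holds C (fst q) (?x @ snd q)" using neg x'(2) by fastforce
    have "holds C (\<chi>' q) (?x @ a)" using \<chi>'(2)[OF q(1) x'(2) a] q(2) fa[OF q(1)] by simp
    moreover have "map \<sigma> (?x @ a) = x @ g i" using x'(1) \<sigma>(2) by (metis map_append)
    ultimately have "holds C (\<chi>' q) (x @ g i)"
      using automorphism_holds[OF \<sigma>' tuples_append[OF x'(2) a] \<chi>'(1)[OF q(1)]] by simp
    then show ?thesis using q(1) by blast
  qed
  let ?J = "\<lambda>q. {i \<in> I. holds C (\<chi>' q) (x @ g i)}"
  have "\<exists>q\<in>\<Delta>. l q \<le> card (?J q)"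
  proof (rule ccontr)
    assume "\<not> ?thesis"
    then have "(\<Sum>q\<in>\<Delta>. card (?J q)) \<le> (\<Sum>q\<in>\<Delta>. l q)" by (intro sum_mono) auto
    moreover have "I = (\<Union>q\<in>\<Delta>. ?J q)" using cov by auto
    then have "card I \<le> (\<Sum>q\<in>\<Delta>. card (?J q))" using card_UN_le[OF \<Delta>(1), of ?J] by simp
    ultimately show False using I(2) by simp
  qed
  then obtain q where q: "q \<in> \<Delta>" "l q \<le> card (?J q)" by auto
  obtain S where S: "S \<subseteq> ?J q" "card S = l q" "finite S"
    using obtain_subset_with_card_n[OF q(2)] by auto
  have "generic n (replicate (length (sorted_list_of_set S)) R) (map g (sorted_list_of_set S))"
    by (rule g(2)) simp
  then have "generic n (replicate (l q) R) (map g (sorted_list_of_set S))"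
    using S(2) by simp
  from l[OF q(1) this] have "\<not> joint k (\<chi>' q) (g ` S)" using S(3) by simp
  moreover have "joint k (\<chi>' q) (g ` S)" using x(1) S(1) by (auto simp: joint_def)
  ultimately show False by simp
qed

end

section \<open>Elementary submodels closed under heirs\<close>

lemma val_univ_update: "val (S\<lparr>univ := A\<rparr>) e t = val S e t"
proof (induction t)
  case (App f ts)
  then have "map (val (S\<lparr>univ := A\<rparr>) e) ts = map (val S e) ts" by simp
  then show ?case by (simp del: map_eq_conv)
qed simp

context fo_struct
begin

text \<open>Applied to the formulas x = x and x = f(a), the test also shows that \<open>M\<close> is
  nonempty and closed under the functions.\<close>

lemma tarski_vaught:
  assumes "is_struct L C" "M \<subseteq> U"
    and TV: "\<And>\<phi> m. set m \<subseteq> M \<Longrightarrow> formula L (Suc (length m)) \<phi> \<Longrightarrow> \<exists>x\<in>U. holds C \<phi> (x # m) \<Longrightarrow>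
      \<exists>x\<in>M. holds C \<phi> (x # m)"
  shows "elementary_substruct L M C"
proof -
  have "M \<noteq> {}"
  proof -
    have "\<exists>x\<in>M. holds C (Eq (Var 0) (Var 0)) [x]"
      by (rule TV) (use assms(1) in \<open>auto simp: formula_def holds_def is_struct_def\<close>)
    then show ?thesis by auto
  qed
  then obtain u where u: "u \<in> M" by auto
  have funs: "fun_interp C f a \<in> M" if f: "f \<in> funs L" "a \<in> tuples M (fun_arity L f)" for f a
  proof -
    let ?\<phi> = "Eq (Var 0) (App f (map Var [1..<Suc (length a)]))"
    have l: "length a = fun_arity L f" using f(2) by (simp add: tuples_def)
    have h: "holds C ?\<phi> (x # a) \<longleftrightarrow> x = fun_interp C f a" for x
    proof -
      have "map (val C ((!) (x # a))) (map Var [1..<Suc (length a)]) = a"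
        by (intro nth_equalityI) (auto simp del: upt_Suc)
      then show ?thesis by (simp add: holds_def del: map_map upt_Suc)
    qed
    have "\<exists>x\<in>M. holds C ?\<phi> (x # a)"
    proof (rule TV)
      show "set a \<subseteq> M" using f(2) by (simp add: tuples_def)
      show "formula L (Suc (length a)) ?\<phi>" using f(1) l by (auto simp: formula_def)
      have "a \<in> tuples U (fun_arity L f)" using f(2) tuples_mono[OF assms(2)] by auto
      then have "fun_interp C f a \<in> U" using assms(1) f(1) by (auto simp: is_struct_def)
      then show "\<exists>x\<in>U. holds C ?\<phi> (x # a)" unfolding h by blast
    qed
    then show ?thesis unfolding h by blast
  qed
  have sat: "sat (C\<lparr>univ := M\<rparr>) e \<phi> \<longleftrightarrow> sat C e \<phi>" if "wf_fm L \<phi>" "\<And>i. e i \<in> M" for \<phi> e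
    using that
  proof (induction \<phi> arbitrary: e)
    case (Eq s t)
    then show ?case by (simp add: val_univ_update)
  next
    case (Rel r ts)
    have "val (C\<lparr>univ := M\<rparr>) e = val C e" by (simp add: val_univ_update fun_eq_iff)
    then show ?case by simp
  next
    case (Neg \<phi>)
    have "sat (C\<lparr>univ := M\<rparr>) e \<phi> \<longleftrightarrow> sat C e \<phi>" by (rule Neg.IH) (use Neg.prems in auto)
    then show ?case by simp
  next
    case (Conj \<phi>1 \<phi>2)
    have "sat (C\<lparr>univ := M\<rparr>) e \<phi>1 \<longleftrightarrow> sat C e \<phi>1" by (rule Conj.IH(1)) (use Conj.prems in auto)
    moreover have "sat (C\<lparr>univ := M\<rparr>) e \<phi>2 \<longleftrightarrow> sat C e \<phi>2" by (rule Conj.IH(2)) (use Conj.prems in auto)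
    ultimately show ?case by simp
  next
    case (Exi i \<phi>)
    have IH: "sat (C\<lparr>univ := M\<rparr>) (e(i := x)) \<phi> \<longleftrightarrow> sat C (e(i := x)) \<phi>" if "x \<in> M" for x
      by (rule Exi.IH) (use Exi.prems that in auto)
    obtain N where N: "fv \<phi> \<subseteq> {..<N}"
      using finite_fv[of \<phi>] finite_nat_set_iff_bounded[of "fv \<phi>"] by auto
    \<comment> \<open>The bound variable \<open>i\<close> reads the new first coordinate, every
      other variable its value under \<open>e\<close>.\<close>
    let ?idx = "map (\<lambda>j. if j = i then 0 else Suc j) [0..<N]"
    let ?m = "map e [0..<N]"
    obtain \<phi>' where \<phi>': "formula L (Suc N) \<phi>'"
      "\<And>(S :: ('f, 'r, 'a) struct) a. holds S \<phi>' a \<longleftrightarrow> holds S \<phi> (map ((!) a) ?idx)"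
    proof (rule rename_formula)
      show "formula L (length ?idx) \<phi>" using N Exi.prems(1) by (simp add: formula_def)
      show "set ?idx \<subseteq> {..<Suc N}" by auto
    qed (rule that)
    have h: "holds C \<phi>' (x # ?m) \<longleftrightarrow> sat C (e(i := x)) \<phi>" for x
    proof -
      have "holds C \<phi>' (x # ?m) \<longleftrightarrow> holds C \<phi> (map ((!) (x # ?m)) ?idx)" by (rule \<phi>'(2))
      also have "\<dots> \<longleftrightarrow> sat C (e(i := x)) \<phi>"
        unfolding holds_def by (rule sat_cong) (use N in auto)
      finally show ?thesis .
    qed
    have "(\<exists>x\<in>U. sat C (e(i := x)) \<phi>) \<Longrightarrow> \<exists>x\<in>M. sat C (e(i := x)) \<phi>"
      using TV[of ?m \<phi>'] Exi.prems(2) \<phi>'(1) unfolding h by auto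
    then show ?case using IH assms(2) by auto
  qed
  have "holds (C\<lparr>univ := M\<rparr>) \<phi> a \<longleftrightarrow> holds C \<phi> a" if "a \<in> tuples M n" "formula L n \<phi>" for n \<phi> a
  proof -
    let ?e = "\<lambda>i. if i < n then a ! i else u"
    have e: "?e i \<in> M" for i using that(1) u by (auto simp: tuples_def)
    have "holds S \<phi> a \<longleftrightarrow> sat S ?e \<phi>" for S :: "('f, 'r, 'a) struct"
      unfolding holds_def by (rule sat_cong) (use that(2) in \<open>auto simp: formula_def\<close>)
    then show ?thesis using sat[of \<phi> ?e] e that(2) by (simp add: formula_def)
  qed
  then show ?thesis
    using assms(2) funs \<open>M \<noteq> {}\<close> by (auto simp: elementary_substruct_def is_struct_def)
qed

end

section \<open>Cardinality bounds and the closure of a set under heir witnesses\<close>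

lemma card_tuples:
  fixes A :: "'a set" and B :: "'b set"
  assumes "infinite B" "|A| \<le>o |B|"
  shows "|tuples A l| \<le>o |B|"
proof (induction l)
  case 0
  have "|{[] :: 'a list}| <o |B|"
    using finite_ordLess_infinite[OF card_of_Well_order card_of_Well_order, of "{[] :: 'a list}" B] assms(1)
    by (simp add: Field_card_of)
  then show ?case by (simp add: ordLess_imp_ordLeq)
next
  case (Suc l)
  have "tuples A (Suc l) = (\<lambda>(w, x). w @ [x]) ` (tuples A l \<times> A)" by (force simp: tuples_Suc)
  then have "|tuples A (Suc l)| \<le>o |tuples A l \<times> A|" by (simp add: card_of_image)
  also have "|tuples A l \<times> A| \<le>o |B|"
    by (rule card_of_Times_ordLeq_infinite_Field[OF _ Suc assms(2) card_of_Card_order])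
      (simp add: Field_card_of assms(1))
  finally (ordLeq_transitive) show ?case .
qed

context monster
begin

lemma finite_le_formulas:
  fixes A :: "'b set"
  assumes "finite A"
  shows "|A| \<le>o |{\<phi> :: ('f, 'r) fm. wf_fm L \<phi>}|"
proof -
  have "|A| <o |{\<phi> :: ('f, 'r) fm. wf_fm L \<phi>}|"
    by (rule finite_ordLess_infinite[OF card_of_Well_order card_of_Well_order])
      (use assms infinite_formulas in \<open>simp_all add: Field_card_of\<close>)
  then show ?thesis by (rule ordLess_imp_ordLeq)
qed

lemma nat_le_formulas: "|UNIV :: nat set| \<le>o |{\<phi> :: ('f, 'r) fm. wf_fm L \<phi>}|"
  using infinite_formulas by (simp add: infinite_iff_card_of_nat)

text \<open>The last property makes the global type given by \<open>Q\<close> an heir of its restriction to \<open>M\<close>.\<close>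

lemma heir_submodel:
  fixes B :: "'a set"
  assumes B: "B \<subseteq> U" "|B| \<le>o |{\<phi>. wf_fm L \<phi>}|" and Q: "ultra Q" "eventually (\<lambda>y. y \<in> tuples U q) Q"
  obtains M where "B \<subseteq> M" "small_submodel L C T \<kappa> M"
    "\<And>\<theta> k m c. set m \<subseteq> M \<Longrightarrow> formula L (k + (q + length m)) \<theta> \<Longrightarrow> c \<in> tuples U k \<Longrightarrow>
      eventually (\<lambda>y. holds C \<theta> (c @ y @ m)) Q \<Longrightarrow>
      \<exists>c'\<in>tuples M k. eventually (\<lambda>y. holds C \<theta> (c' @ y @ m)) Q"
proof -
  let ?F = "{\<phi> :: ('f, 'r) fm. wf_fm L \<phi>}"
  define S where "S \<theta> k m = {c \<in> tuples U k. eventually (\<lambda>y. holds C \<theta> (c @ y @ m)) Q}" for \<theta> k m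
  obtain u where u: "u \<in> U" using U_nonempty by auto
  \<comment> \<open>A Skolem function for \<theta> in the limit along \<open>Q\<close>;
    \<open>M\<close> will be the closure of \<open>B\<close> under it. The default value keeps the
    result in \<open>tuples U k\<close>.\<close>
  define h where "h \<theta> k m = (if S \<theta> k m = {} then replicate k u else SOME c. c \<in> S \<theta> k m)" for \<theta> k m
  have hS: "h \<theta> k m \<in> S \<theta> k m" if "S \<theta> k m \<noteq> {}" for \<theta> k m
    using that some_in_eq[of "S \<theta> k m"] by (simp add: h_def)
  have hU: "h \<theta> k m \<in> tuples U k" for \<theta> k m
  proof (cases "S \<theta> k m = {}")
    case True
    then show ?thesis using u by (auto simp: h_def tuples_def)
  next
    case False
    then show ?thesis using hS by (auto simp: S_def)
  qed
  define step where "step A = A \<union> (\<Union>\<theta>\<in>?F. \<Union>k. \<Union>l. \<Union>m\<in>tuples A l. set (h \<theta> k m))" for A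
  define N where "N i = (step ^^ i) B" for i
  have N_Suc: "N (Suc i) = step (N i)" for i by (simp add: N_def)
  define M where "M = (\<Union>i. N i)"
  have stepF: "|step A| \<le>o |?F|" if A: "|A| \<le>o |?F|" for A
  proof -
    have t: "|tuples A l| \<le>o |?F|" for l using infinite_formulas A by (rule card_tuples)
    have "|\<Union>m\<in>tuples A l. set (h \<theta> k m)| \<le>o |?F|" for \<theta> k l
      using infinite_formulas t finite_le_formulas by (intro card_of_UNION_ordLeq_infinite) auto
    then have "|\<Union>l. \<Union>m\<in>tuples A l. set (h \<theta> k m)| \<le>o |?F|" for \<theta> k
      using infinite_formulas nat_le_formulas by (intro card_of_UNION_ordLeq_infinite) auto
    then have "|\<Union>k. \<Union>l. \<Union>m\<in>tuples A l. set (h \<theta> k m)| \<le>o |?F|" for \<theta>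
      using infinite_formulas nat_le_formulas by (intro card_of_UNION_ordLeq_infinite) auto
    then have "|\<Union>\<theta>\<in>?F. \<Union>k. \<Union>l. \<Union>m\<in>tuples A l. set (h \<theta> k m)| \<le>o |?F|"
      using infinite_formulas by (intro card_of_UNION_ordLeq_infinite) (auto simp: card_of_refl ordIso_imp_ordLeq)
    then show ?thesis unfolding step_def using infinite_formulas A
      by (intro card_of_Un_ordLeq_infinite_Field[OF _ A _ card_of_Card_order]) (simp_all add: Field_card_of)
  qed
  have "|N i| \<le>o |?F|" for i
  proof (induction i)
    case 0
    then show ?case using B(2) by (simp add: N_def)
  next
    case (Suc i)
    then show ?case unfolding N_Suc by (rule stepF)
  qed
  then have "|M| \<le>o |?F|"
    unfolding M_def using infinite_formulas nat_le_formulas by (intro card_of_UNION_ordLeq_infinite) auto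
  then have small: "|M| <o \<kappa>" using formulas_small by (rule ordLeq_ordLess_trans)
  have "N i \<subseteq> U" for i
  proof (induction i)
    case 0
    then show ?case using B(1) by (simp add: N_def)
  next
    case (Suc i)
    have "set (h \<theta> k m) \<subseteq> U" for \<theta> k m using hU by (auto simp: tuples_def)
    then show ?case using Suc unfolding N_Suc step_def by auto
  qed
  then have MU: "M \<subseteq> U" by (auto simp: M_def)
  have BM: "B \<subseteq> M" 
  proof -
    have "N 0 = B" by (simp add: N_def)
    then show ?thesis unfolding M_def by blast
  qed
  have mono: "N i \<subseteq> N j" if "i \<le> j" for i j
    using that by (induction rule: dec_induct) (auto simp: N_Suc step_def)
  have closed: "set (h \<theta> k m) \<subseteq> M" if m: "set m \<subseteq> M" and \<theta>: "wf_fm L \<theta>" for \<theta> k m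
  proof -
    have "\<exists>i. set m \<subseteq> N i" using m
    proof (induction m)
      case (Cons x m)
      then obtain i j where "set m \<subseteq> N i" "x \<in> N j" by (auto simp: M_def)
      then have "set (x # m) \<subseteq> N (max i j)" using mono[of i "max i j"] mono[of j "max i j"] by auto
      then show ?case ..
    qed simp
    then obtain i where "m \<in> tuples (N i) (length m)" by (auto simp: tuples_def)
    then have "set (h \<theta> k m) \<subseteq> N (Suc i)" unfolding N_Suc step_def using \<theta> by blast
    then show ?thesis by (auto simp: M_def)
  qed
  have heir: "\<exists>c'\<in>tuples M k. eventually (\<lambda>y. holds C \<theta> (c' @ y @ m)) Q"
    if "set m \<subseteq> M" "formula L (k + (q + length m)) \<theta>" "c \<in> tuples U k"
      "eventually (\<lambda>y. holds C \<theta> (c @ y @ m)) Q" for \<theta> k m c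
  proof -
    have "S \<theta> k m \<noteq> {}" using that(3,4) by (auto simp: S_def)
    from hS[OF this] have "h \<theta> k m \<in> tuples U k" "eventually (\<lambda>y. holds C \<theta> (h \<theta> k m @ y @ m)) Q"
      by (auto simp: S_def)
    moreover have "set (h \<theta> k m) \<subseteq> M" using closed that(1,2) by (simp add: formula_def)
    ultimately show ?thesis by (intro bexI[of _ "h \<theta> k m"]) (auto simp: tuples_def)
  qed
  \<comment> \<open>The Tarski-Vaught test is the case of the heir property in which the formula
    does not mention y: in the limit it holds iff it holds. Accordingly \<open>?idx\<close> leaves
    out the block y.\<close>
  have "elementary_substruct L M C"
  proof (rule tarski_vaught[OF U_struct MU])
    fix \<phi> m assume m: "set m \<subseteq> M" and \<phi>: "formula L (Suc (length m)) \<phi>" and "\<exists>x\<in>U. holds C \<phi> (x # m)"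
    then obtain x where x: "x \<in> U" "holds C \<phi> (x # m)" by auto
    let ?idx = "0 # [Suc q..<Suc q + length m]"
    obtain \<phi>' where \<phi>': "formula L (1 + (q + length m)) \<phi>'"
      "\<And>(S :: ('f, 'r, 'a) struct) a. holds S \<phi>' a \<longleftrightarrow> holds S \<phi> (map ((!) a) ?idx)"
    proof (rule rename_formula)
      have "length ?idx = Suc (length m)" by (simp del: upt_Suc)
      then show "formula L (length ?idx) \<phi>" using \<phi> by (simp only:)
      show "set ?idx \<subseteq> {..<1 + (q + length m)}" by auto
    qed (rule that)
    have h: "holds C \<phi>' ([x] @ y @ m) \<longleftrightarrow> holds C \<phi> (x # m)" if "y \<in> tuples U q" for x y
    proof -
      have "map ((!) ([x] @ y @ m)) ?idx = x # m"
        using that by (intro nth_equalityI) (auto simp: nth_append nth_Cons' tuples_length simp del: upt_Suc)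
      then show ?thesis unfolding \<phi>'(2) by simp
    qed
    have "eventually (\<lambda>y. holds C \<phi>' ([x] @ y @ m)) Q"
      using Q(2) by eventually_elim (use h x(2) in blast)
    then obtain c where c: "c \<in> tuples M 1" "eventually (\<lambda>y. holds C \<phi>' (c @ y @ m)) Q"
      using heir[OF m \<phi>'(1), of "[x]"] x(1) by (auto simp: tuples_def)
    then obtain x' where x': "c = [x']" "x' \<in> M" by (auto simp: tuples_def length_Suc_conv)
    have "eventually (\<lambda>y. holds C \<phi>' (c @ y @ m) \<and> y \<in> tuples U q) Q" using c(2) Q(2) by (rule eventually_conj)
    from ultra_ex[OF Q(1) this] show "\<exists>x\<in>M. holds C \<phi> (x # m)" using h x' by blast
  qed
  then have "small_submodel L C T \<kappa> M" using small by unfold_locales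
  then show thesis using BM heir by (intro that)
qed

end

section \<open>A non-forking type that is not invariant\<close>

context small_submodel
begin

text \<open>The limits are resolved from the last entry backwards, since an entry of a generic
  sequence is generic over the earlier ones. \<open>Z\<close> collects the indices already used,
  which \<open>W\<close>-almost all indices avoid.\<close>

lemma pick_pairs:
  assumes Q: "\<And>P. eventually P Q \<longleftrightarrow> eventually (\<lambda>i :: nat. eventually (\<lambda>j. P (a i @ a j)) W) W"
    and W: "ultra W" "\<And>i. eventually (\<lambda>j. j \<noteq> i) W"
    and a: "\<And>i. a i \<in> tuples M n"
  shows "generic (n + n) (replicate l Q) gs \<Longrightarrow> definable M (l * (n + n)) P \<Longrightarrow> P (concat gs) \<Longrightarrow> finite Z \<Longrightarrow>
    \<exists>ps. length ps = l \<and> fst ` set ps \<inter> Z = {} \<and> snd ` set ps \<inter> Z = {} \<and> fst ` set ps \<inter> snd ` set ps = {} \<and>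
      P (concat (map (\<lambda>(i, j). a i @ a j) ps))"
proof (induction l arbitrary: gs P Z)
  case 0
  then show ?case using generic_length[OF 0(1)] by auto
next
  case (Suc l)
  have "generic (n + n) (replicate l Q @ [Q]) gs" using Suc.prems(1) by (simp add: replicate_append_same)
  then obtain gs' g where g: "gs = gs' @ [g]" "generic (n + n) (replicate l Q) gs'" "coheir (n + n) Q"
    "g \<in> tuples U (n + n)" "realizes Q (M \<union> set (concat gs')) g"
    by (rule generic_snocE)
  have l: "length (concat gs') = l * (n + n)" using generic_concat[OF g(2)] by (simp add: tuples_length)
  have def: "definable M (l * (n + n) + (n + n)) P" using Suc.prems(2) by (simp add: algebra_simps)
  have avoid: "eventually (\<lambda>i. i \<notin> Z) W" if "finite Z" for Z
  proof -
    have "eventually (\<lambda>i. \<forall>z\<in>Z. i \<noteq> z) W" using that W(2) by (intro eventually_ball_finite) auto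
    then show ?thesis by eventually_elim auto
  qed
  have "eventually (\<lambda>y. P (concat gs' @ y)) Q"
    using realizes_append[OF g(5,3,4) generic_set[OF g(2)], of P] def l Suc.prems(3) g(1) by simp
  then have "eventually (\<lambda>i. eventually (\<lambda>j. P (concat gs' @ a i @ a j)) W) W" unfolding Q .
  then obtain i where i: "i \<notin> Z" "eventually (\<lambda>j. P (concat gs' @ a i @ a j)) W"
    using ultra_ex[OF W(1) eventually_conj[OF avoid[OF Suc.prems(4)]]] by blast
  obtain j where j: "j \<notin> insert i Z" "P (concat gs' @ a i @ a j)"
    using ultra_ex[OF W(1) eventually_conj[OF avoid[of "insert i Z"] i(2)]] Suc.prems(4) by blast
  have "definable M (l * (n + n)) (\<lambda>x. P (x @ a i @ a j))"
    using definable_M_append[OF def tuples_append[OF a a]] .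
  from Suc.IH[OF g(2) this j(2), of "insert i (insert j Z)"] Suc.prems(4)
  obtain ps where ps: "length ps = l" "fst ` set ps \<inter> insert i (insert j Z) = {}"
    "snd ` set ps \<inter> insert i (insert j Z) = {}" "fst ` set ps \<inter> snd ` set ps = {}"
    "P (concat (map (\<lambda>(i, j). a i @ a j) ps) @ a i @ a j)" by auto
  show ?case using ps i(1) j(1) by (intro exI[of _ "ps @ [(i, j)]"]) auto
qed

text \<open>If \<theta>(c,y,m) held for \<open>Q\<close>-almost all y, the heir property would
  replace \<open>c\<close> by some \<open>c'\<close> in \<open>M\<close>. Then \<theta>(c',d,m) is
  part of the type of \<open>d @ m\<close> over \<open>M\<close>, so \<open>c'\<close> solves all
  instances along a dividing sequence at once.\<close>

lemma strict_of_heir: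
  assumes Q: "coheir n Q" and d: "d \<in> tuples U n" "realizes Q M d"
    and heir: "\<And>\<theta> k m c. set m \<subseteq> M \<Longrightarrow> formula L (k + (n + length m)) \<theta> \<Longrightarrow> c \<in> tuples U k \<Longrightarrow>
      eventually (\<lambda>y. holds C \<theta> (c @ y @ m)) Q \<Longrightarrow>
      \<exists>c'\<in>tuples M k. eventually (\<lambda>y. holds C \<theta> (c' @ y @ m)) Q"
  shows "strict d Q"
  unfolding strict_def
proof (intro conjI allI impI)
  have ld: "length d = n" using d(1) by (simp add: tuples_length)
  show "extends_tp d Q"
    unfolding extends_tp_def ld using Q realizes_iff[OF d(2) coheir_ultra[OF Q] _ ld] by auto
  fix \<theta> k m c assume m: "set m \<subseteq> M" and c: "c \<in> tuples U k" and \<theta>': "formula L (k + (length d + length m)) \<theta>"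
    and div: "divides_over L C k M (\<theta>, d @ m)"
  have \<theta>: "formula L (k + (n + length m)) \<theta>" using \<theta>' ld by simp
  show "eventually (\<lambda>y. \<not> holds C \<theta> (c @ y @ m)) Q"
  proof (rule ccontr)
    assume "\<not> ?thesis"
    then have "eventually (\<lambda>y. holds C \<theta> (c @ y @ m)) Q" using ultra_not[OF coheir_ultra[OF Q]] by auto
    from heir[OF m \<theta> c this] obtain c' where c': "c' \<in> tuples M k"
      "eventually (\<lambda>y. holds C \<theta> (c' @ y @ m)) Q" by auto
    have "set c' \<subseteq> M" "length c' = k" using c'(1) by (auto simp: tuples_def)
    then have def: "definable M (n + length m) (\<lambda>x. holds C \<theta> (c' @ x))"
      using definable_param_left[OF definable_formula _ M_U, of c' "n + length m" \<theta>] \<theta> by simp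
    have "definable M n (\<lambda>y. holds C \<theta> (c' @ y @ m))"
      using definable_param[OF def m M_U] .
    from realizesD[OF d(2) this ld c'(2)] have hd: "holds C \<theta> (c' @ d @ m)" .
    obtain K s where s: "\<And>i. s i \<in> tuples U (length (d @ m))" "\<And>i. tp L C (s i) M = tp L C (d @ m) M"
      "k_inconsistent C k \<theta> K s"
      using div by (auto simp: divides_over_def)
    have dm: "d @ m \<in> tuples U (n + length m)" using d(1) set_M_tuples[OF m] by (rule tuples_append)
    have "holds C \<theta> (c' @ s i)" for i
    proof -
      have "s i \<in> tuples U (n + length m)" using s(1)[of i] ld by simp
      then have "eq_type M (d @ m) (s i)" using tp_eq_iff[OF dm, of "s i" M] s(2) by auto
      from eq_typeD[OF this def] show ?thesis using hd ld by simp
    qed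
    moreover have "c' \<in> tuples U k" using c'(1) by (rule M_tuples_U)
    ultimately show False using s(3)[unfolded k_inconsistent_def, rule_format, of "{..<K}"] by auto
  qed
qed

text \<open>By \<open>not_forks_of_not_divides\<close>, \<psi>(x,d) is consistent with the negations
  of any finitely many dividing formulas; a global type containing all these negations contains no
  forking formula.\<close>

lemma nonforking_extension:
  assumes NTP2: "NTP2 L C" and d: "d \<in> tuples U nd" and \<psi>: "formula L (k + nd) \<psi>"
    and nd: "\<not> divides_over L C k M (\<psi>, d)"
  obtains p where "p \<in> types L C k U" "\<not> type_forks_over L C k M p" "(\<psi>, d) \<in> p"
proof -
  let ?D = "{q \<in> fmls_over L k U. divides_over L C k M q}"
  let ?f = "\<lambda>q x. \<not> holds C (fst q) (x @ snd q)"
  let ?\<P> = "{\<lambda>x. x \<in> tuples U k, \<lambda>x. holds C \<psi> (x @ d)} \<union> ?f ` ?D"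
  obtain G where G: "ultra G" "\<And>P. P \<in> ?\<P> \<Longrightarrow> eventually P G"
  proof (rule ultrafilter_fip)
    fix X assume X: "finite X" "X \<subseteq> ?\<P>"
    obtain \<Delta> where \<Delta>: "\<Delta> \<subseteq> ?D" "finite \<Delta>" "X \<inter> ?f ` ?D = ?f ` \<Delta>"
    proof -
      have "finite (X \<inter> ?f ` ?D)" using X(1) by simp
      from finite_subset_image[OF this Int_lower2] show ?thesis using that by (elim exE conjE)
    qed
    obtain x where x: "x \<in> tuples U k" "holds C \<psi> (x @ d)" "\<forall>(\<chi>, e)\<in>\<Delta>. \<not> holds C \<chi> (x @ e)"
      using not_forks_of_not_divides[OF NTP2 d \<psi> nd \<Delta>(2)] \<Delta>(1) by auto
    have "P x" if "P \<in> X" for P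
    proof -
      have "P = (\<lambda>x. x \<in> tuples U k) \<or> P = (\<lambda>x. holds C \<psi> (x @ d)) \<or> P \<in> ?f ` \<Delta>"
        using that X(2) \<Delta>(3) by auto
      moreover have "P x" if "P \<in> ?f ` \<Delta>" using that x(3) by auto
      ultimately show ?thesis using x(1,2) by (elim disjE) simp_all
    qed
    then show "\<exists>x. \<forall>P\<in>X. P x" by (intro exI[of _ x] ballI)
  qed (rule that)
  define p where "p = {(\<phi>, b) \<in> fmls_over L k U. eventually (\<lambda>x. holds C \<phi> (x @ b)) G}"
  have GU: "eventually (\<lambda>x. x \<in> tuples U k) G" by (rule G(2)) simp
  have "p \<in> types L C k U" using G(1) GU p_def by (rule type_of_ultra)
  moreover have "\<not> type_forks_over L C k M p"
  proof
    assume "type_forks_over L C k M p"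
    then obtain \<chi> e where \<chi>: "(\<chi>, e) \<in> p" "forks_over L C k M (\<chi>, e)" by (auto simp: type_forks_over_def)
    obtain \<Delta> where \<Delta>: "\<Delta> \<subseteq> fmls_over L k U" "finite \<Delta>" "\<forall>\<psi>\<in>\<Delta>. divides_over L C k M \<psi>"
      "\<forall>x\<in>tuples U k. holds C \<chi> (x @ e) \<longrightarrow> (\<exists>(\<psi>, b)\<in>\<Delta>. holds C \<psi> (x @ b))"
      using \<chi>(2) by (auto simp: forks_over_def)
    have "eventually (\<lambda>x. \<forall>q\<in>\<Delta>. ?f q x) G"
    proof (rule eventually_ball_finite[OF \<Delta>(2)], rule ballI)
      fix q assume "q \<in> \<Delta>"
      then have "q \<in> ?D" using \<Delta>(1,3) by auto
      then show "eventually (?f q) G" by (intro G(2) UnI2 imageI)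
    qed
    moreover have "eventually (\<lambda>x. holds C \<chi> (x @ e)) G" using \<chi>(1) by (simp add: p_def)
    ultimately have "eventually (\<lambda>x. False) G"
      using GU by eventually_elim (use \<Delta>(4) in fastforce)
    then show False using G(1) by (simp add: ultra_def)
  qed
  moreover have "eventually (\<lambda>x. holds C \<psi> (x @ d)) G" by (rule G(2)) simp
  then have "(\<psi>, d) \<in> p" using d \<psi> by (auto simp: p_def fmls_over_def tuples_def)
  ultimately show thesis by (rule that)
qed

end

lemma (in monster) nonforking_noninvariant:
  assumes NTP2: "NTP2 L C" and \<phi>: "formula L (n + m) \<phi>"
    and a: "\<And>i :: nat. a i \<in> tuples U n" and b: "\<And>u. b u \<in> tuples U m"
    and ab: "\<And>i u. holds C \<phi> (a i @ b u) \<longleftrightarrow> i \<in> u"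
  shows "\<exists>M p. small_model L \<kappa> C M \<and> p \<in> types L C m U \<and>
    \<not> type_forks_over L C m M p \<and> \<not> invariant_over L C M p"
proof -
  obtain W where W: "ultra W" "\<And>P. P \<in> range (\<lambda>i j :: nat. j \<noteq> i) \<Longrightarrow> eventually P W"
  proof (rule ultrafilter_fip)
    fix X :: "(nat \<Rightarrow> bool) set" assume "finite X" "X \<subseteq> range (\<lambda>i j. j \<noteq> i)"
    then obtain F where F: "finite F" "X = (\<lambda>i j. j \<noteq> i) ` F" by (auto dest: finite_subset_image)
    obtain j where "j \<notin> F" using ex_new_if_finite[OF infinite_UNIV_nat F(1)] by auto
    then show "\<exists>j. \<forall>P\<in>X. P j" unfolding F(2) by (intro exI[of _ j]) auto
  qed (rule that)
  have W2: "eventually (\<lambda>j. j \<noteq> i) W" for i by (rule W(2)) simp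
  \<comment> \<open>The image of W \<otimes> W as an iterated limit, the inner one over the index
    \<open>j\<close> of the second half.\<close>
  define Q where "Q = Abs_filter (\<lambda>P. eventually (\<lambda>i. eventually (\<lambda>j. P (a i @ a j)) W) W)"
  have Q: "eventually P Q \<longleftrightarrow> eventually (\<lambda>i. eventually (\<lambda>j. P (a i @ a j)) W) W" for P
    unfolding Q_def
  proof (rule eventually_Abs_filter, rule is_filter.intro)
    fix P P' assume "eventually (\<lambda>i. eventually (\<lambda>j. P (a i @ a j)) W) W"
      "eventually (\<lambda>i. eventually (\<lambda>j. P' (a i @ a j)) W) W"
    then show "eventually (\<lambda>i. eventually (\<lambda>j. P (a i @ a j) \<and> P' (a i @ a j)) W) W"
      by (simp add: eventually_conj_iff)
  next
    fix P P' :: "'a list \<Rightarrow> bool"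
    assume P: "\<forall>x. P x \<longrightarrow> P' x" and "eventually (\<lambda>i. eventually (\<lambda>j. P (a i @ a j)) W) W"
    from this(2) show "eventually (\<lambda>i. eventually (\<lambda>j. P' (a i @ a j)) W) W"
      by eventually_elim (use P in \<open>auto elim: eventually_mono\<close>)
  qed simp
  have ultraQ: "ultra Q"
    unfolding ultra_def
  proof (intro conjI allI)
    show "Q \<noteq> bot"
    proof
      assume "Q = bot"
      then have "eventually (\<lambda>_. False) Q" by simp
      then show False unfolding Q using W(1) by (simp add: ultra_def)
    qed
    show "eventually P Q \<or> eventually (\<lambda>x. \<not> P x) Q" for P
      unfolding Q by (simp add: ultra_not[OF W(1)])
  qed
  have QU: "eventually (\<lambda>y. y \<in> tuples U (n + n)) Q" unfolding Q using tuples_append[OF a a] by simp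
  let ?B = "\<Union>i. set (a i)"
  have "|?B| \<le>o |{\<phi>. wf_fm L \<phi>}|"
  proof (rule card_of_UNION_ordLeq_infinite[OF infinite_formulas])
    show "|UNIV :: nat set| \<le>o |{\<phi> :: ('f, 'r) fm. wf_fm L \<phi>}|" by (rule nat_le_formulas)
  qed (simp add: finite_le_formulas)
  moreover have "?B \<subseteq> U" using a by (auto simp: tuples_def)
  ultimately obtain M where M: "?B \<subseteq> M" "small_submodel L C T \<kappa> M"
    and heir: "\<And>\<theta> k m c. set m \<subseteq> M \<Longrightarrow> formula L (k + ((n + n) + length m)) \<theta> \<Longrightarrow> c \<in> tuples U k \<Longrightarrow>
      eventually (\<lambda>y. holds C \<theta> (c @ y @ m)) Q \<Longrightarrow>
      \<exists>c'\<in>tuples M k. eventually (\<lambda>y. holds C \<theta> (c' @ y @ m)) Q"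
    using heir_submodel[OF _ _ ultraQ QU, of ?B] by blast
  interpret small_submodel L C T \<kappa> M by (rule M(2))
  have aM: "a i \<in> tuples M n" for i using a M(1) by (simp add: tuples_def UN_subset_iff)
  have cQ: "coheir (n + n) Q" unfolding coheir_def Q using ultraQ tuples_append[OF aM aM] by simp
  obtain d where d: "d \<in> tuples U (n + n)" "realizes Q M d"
    using coheir_realizes[OF cQ, of "{}"] by auto
  have ld: "length d = n + n" using d(1) by (simp add: tuples_length)
  define d0 d1 where "d0 = take n d" and "d1 = drop n d"
  have d01: "d0 \<in> tuples U n" "d1 \<in> tuples U n" "d = d0 @ d1"
    using d(1) by (auto simp: d0_def d1_def tuples_def dest: in_set_takeD in_set_dropD)
  have la: "length (a i) = n" for i by (rule tuples_length[OF a])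
  \<comment> \<open>Each half realizes over \<open>M\<close> the limit along \<open>W\<close> of the
    types of the \<open>a i\<close>: the limit over the other index has no effect.\<close>
  have eq: "eq_type M d0 d1"
  proof -
    have "P d0 \<longleftrightarrow> P d1" if P: "definable M n P" for P
    proof -
      have "definable M (n + n) (\<lambda>y. P (take n y))" "definable M (n + n) (\<lambda>y. P (drop n y))"
        using coord_map_take[OF coord_map_id, of n "n + n"] coord_map_drop[OF coord_map_id, of "n + n" n]
        by (auto intro!: definable_coord_map[OF P])
      then have "P d0 \<longleftrightarrow> eventually (\<lambda>y. P (take n y)) Q" "P d1 \<longleftrightarrow> eventually (\<lambda>y. P (drop n y)) Q"
        using realizes_iff[OF d(2) ultraQ _ ld] by (auto simp: d0_def d1_def)
      then show ?thesis unfolding Q using la W(1) by (simp add: ultra_def)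
    qed
    then show ?thesis using d01 by (simp add: eq_type_def tuples_length)
  qed
  \<comment> \<open>In \<phi> the a-block comes first, but a type in x, the block of
    \<open>b\<close>, needs x in front. \<open>?idx1\<close> reads the second of two
    a-blocks.\<close>
  let ?idx = "[m..<m + n] @ [0..<m]" and ?idx1 = "[m + n..<m + (n + n)] @ [0..<m]"
  obtain \<phi>s where \<phi>s: "formula L (m + n) \<phi>s"
    "\<And>(S :: ('f, 'r, 'a) struct) x. holds S \<phi>s x \<longleftrightarrow> holds S \<phi> (map ((!) x) ?idx)"
  proof (rule rename_formula)
    show "formula L (length ?idx) \<phi>" using \<phi> by simp
    show "set ?idx \<subseteq> {..<m + n}" by auto
  qed (rule that)
  obtain \<phi>1 where \<phi>1: "formula L (m + (n + n)) \<phi>1"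
    "\<And>(S :: ('f, 'r, 'a) struct) x. holds S \<phi>1 x \<longleftrightarrow> holds S \<phi> (map ((!) x) ?idx1)"
  proof (rule rename_formula)
    show "formula L (length ?idx1) \<phi>" using \<phi> by simp
    show "set ?idx1 \<subseteq> {..<m + (n + n)}" by auto
  qed (rule that)
  have hs: "holds C \<phi>s (x @ y) \<longleftrightarrow> holds C \<phi> (y @ x)" if "length x = m" "length y = n" for x y
  proof -
    have "map ((!) (x @ y)) ?idx = y @ x"
      using that by (intro nth_equalityI) (auto simp: nth_append)
    then show ?thesis unfolding \<phi>s(2) by simp
  qed
  have h1: "holds C \<phi>1 (x @ y @ z) \<longleftrightarrow> holds C \<phi> (z @ x)" if "length x = m" "length y = n" "length z = n" for x y z
  proof -
    have "map ((!) (x @ y @ z)) ?idx1 = z @ x"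
      using that by (intro nth_equalityI) (auto simp: nth_append)
    then show ?thesis unfolding \<phi>1(2) by simp
  qed
  define \<psi> where "\<psi> = Conj \<phi>s (Neg \<phi>1)"
  have \<psi>: "formula L (m + (n + n)) \<psi>"
    using formula_mono[OF \<phi>s(1), of "m + (n + n)"] \<phi>1(1) by (auto simp: \<psi>_def formula_def)
  have h\<psi>: "holds C \<psi> (x @ y @ z) \<longleftrightarrow> holds C \<phi> (y @ x) \<and> \<not> holds C \<phi> (z @ x)"
    if "length x = m" "length y = n" "length z = n" for x y z
  proof -
    have "holds C \<phi>s ((x @ y) @ z) \<longleftrightarrow> holds C \<phi>s (x @ y)"
      by (rule holds_append) (use \<phi>s(1) that in simp)
    then show ?thesis using hs[OF that(1,2)] h1[OF that] by (simp add: \<psi>_def holds_def)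
  qed
  have "\<not> divides_over L C m M (\<psi>, d)"
  proof
    assume div: "divides_over L C m M (\<psi>, d)"
    have st: "strict d Q" using cQ d heir by (rule strict_of_heir)
    obtain l where l: "\<And>gs. generic (n + n) (replicate l Q) gs \<Longrightarrow> \<not> joint m \<psi> (set gs)"
      using strict_generic[OF NTP2 st d(1) \<psi> div] by auto
    obtain gs where gs: "generic (n + n) (replicate l Q) gs"
      using generic_exists[of "replicate l Q" "n + n"] cQ by auto
    \<comment> \<open>Inconsistency along \<open>gs\<close> is definable over \<open>M\<close>, so
      it passes to suitable pairs of actual \<open>a i\<close>.\<close>
    let ?P = "\<lambda>z. \<not> joint m \<psi> (set (chop (n + n) l z))"
    have lg: "length gs = l" "\<And>g. g \<in> set gs \<Longrightarrow> length g = n + n"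
      using generic_length[OF gs] generic_tuples[OF gs] by (auto simp: tuples_def)
    have "?P (concat gs)" using l[OF gs] chop_concat[of gs "n + n"] lg by simp
    moreover have "definable M (l * (n + n)) ?P" by (intro definable_not definable_joint \<psi>)
    ultimately obtain ps where ps: "length ps = l" "fst ` set ps \<inter> snd ` set ps = {}"
      "?P (concat (map (\<lambda>(i, j). a i @ a j) ps))"
      using pick_pairs[OF Q W(1) W2 aM gs, of ?P "{}"] by auto
    have "chop (n + n) (length (map (\<lambda>(i, j). a i @ a j) ps)) (concat (map (\<lambda>(i, j). a i @ a j) ps)) =
        map (\<lambda>(i, j). a i @ a j) ps"
      by (rule chop_concat) (auto simp: la)
    then have "\<not> joint m \<psi> ((\<lambda>(i, j). a i @ a j) ` set ps)" using ps(1,3) by simp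
    \<comment> \<open>The set of all first indices contains no second index, so the \<open>b\<close>
      belonging to it solves all instances.\<close>
    moreover have "holds C \<psi> (b (fst ` set ps) @ a i @ a j)" if "(i, j) \<in> set ps" for i j
    proof -
      have "i \<in> fst ` set ps" "j \<in> snd ` set ps" using that by force+
      then have "i \<in> fst ` set ps" "j \<notin> fst ` set ps" using ps(2) by auto
      then show ?thesis using h\<psi>[OF tuples_length[OF b] la la] ab by simp
    qed
    then have "joint m \<psi> ((\<lambda>(i, j). a i @ a j) ` set ps)"
      unfolding joint_def using b by (intro bexI[of _ "b (fst ` set ps)"]) auto
    ultimately show False by simp
  qed
  then obtain p where p: "p \<in> types L C m U" "\<not> type_forks_over L C m M p" "(\<psi>, d) \<in> p"
    by (rule nonforking_extension[OF NTP2 d(1) \<psi>])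
  have cons: "\<exists>x\<in>tuples U m. \<forall>(\<phi>, b)\<in>\<Delta>. holds C \<phi> (x @ b)" if "\<Delta> \<subseteq> p" "finite \<Delta>" for \<Delta>
    using p(1) that by (auto simp: types_def consistent_def)
  have lx: "length x = m" if "x \<in> tuples U m" for x using that by (rule tuples_length)
  have l01: "length d0 = n" "length d1 = n" using d01 by (auto simp: tuples_length)
  have "(\<phi>s, d0) \<in> p"
  proof (rule ccontr)
    assume neg: "(\<phi>s, d0) \<notin> p"
    have "(\<phi>s, d0) \<in> fmls_over L m U" using \<phi>s(1) d01(1) l01 by (simp add: fmls_over_def tuples_def)
    then have "(Neg \<phi>s, d0) \<in> p" using p(1) neg by (auto simp: types_def)
    then obtain x where x: "x \<in> tuples U m" "holds C (Neg \<phi>s) (x @ d0)" "holds C \<psi> (x @ d)"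
      using cons[of "{(Neg \<phi>s, d0), (\<psi>, d)}"] p(3) by auto
    then show False using h\<psi>[OF lx[OF x(1)] l01] hs[OF lx[OF x(1)] l01(1)] d01(3) by (simp add: holds_def)
  qed
  moreover have "(\<phi>s, d1) \<notin> p"
  proof
    assume "(\<phi>s, d1) \<in> p"
    then obtain x where x: "x \<in> tuples U m" "holds C \<phi>s (x @ d1)" "holds C \<psi> (x @ d)"
      using cons[of "{(\<phi>s, d1), (\<psi>, d)}"] p(3) by auto
    then show False using h\<psi>[OF lx[OF x(1)] l01] hs[OF lx[OF x(1)] l01(2)] d01(3) by simp
  qed
  moreover obtain \<sigma> where \<sigma>: "Aut M \<sigma>" "map \<sigma> d0 = d1" using eq_type_Aut[OF M_U M_small d01(1,2) eq] by auto
  ultimately have "type_image \<sigma> p \<noteq> p" by (force simp: type_image_def)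
  then have "\<not> invariant_over L C M p" using \<sigma>(1) unfolding invariant_over_def Aut_def by blast
  moreover have "small_model L \<kappa> C M" using M_elem M_small by (simp add: small_model_def)
  ultimately show ?thesis using p(1,2) by blast
qed

theorem theorem4p2:
  fixes L :: "('f, 'r) lang" and T :: "('f, 'r) fm set"
    and \<kappa> :: "'k rel" and C :: "('f, 'r, 'a) struct"
  assumes "complete_theory TYPE('a) L T"
    and "monster_model L T \<kappa> C"
    and "NTP2 L C"
    and "has_IP L C"
  shows "\<exists>M n p. small_model L \<kappa> C M \<and> p \<in> types L C n (univ C) \<and>
           \<not> type_forks_over L C n M p \<and> \<not> invariant_over L C M p"
proof -
  interpret monster L C T \<kappa> by unfold_locales (rule assms(2))
  obtain n m \<phi> and a :: "nat \<Rightarrow> 'a list" and b where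
    "formula L (n + m) \<phi>" "\<And>i. a i \<in> tuples U n" "\<And>u. b u \<in> tuples U m"
    "\<And>i u. holds C \<phi> (a i @ b u) \<longleftrightarrow> i \<in> u"
    using assms(4) unfolding has_IP_def by metis
  from nonforking_noninvariant[OF assms(3) this] show ?thesis by blast
qed

end
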